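(* Let $b>1$ be an integer and $w=w_1\dots w_p$ a non-empty word of length $p$ over $\{0,\dots,b-1\}$. For every $k\ge1$, $$I(b,w,k)=\sum_{j=1}^\infty \mathfrak{L}_j(b,w)\,\lambda_j(b,w)^{k-1}\,\mathfrak{R}_j(b,w),$$ and the series is absolutely convergent. The quantities $$1=\lambda_1(b,w)>\lambda_2(b,w)>\dots>\lambda_j(b,w)>\dots\to_{j\to\infty}0$$ are $\lambda_j(b,w)=G(b^{-j})$, $j\ge1$, where $G(t)=\sum_{g\in\mathcal G}t^{|g|}$ is the generating function of the number of words of each length in the return language $\mathcal G$. The first term ($j=1$) of the series is $b^p\log(b)$.
   Context: Words are finite sequences (possibly empty) of digits in $\{0,\dots,b-1\}$; $|g|$ is the length of $g$; $n(g)$ is the integer represented by $g$ in base $b$ (most significant digit on the left, $n=0$ for the empty word); $x(g)=n(g)b^{-|g|}$; for an infinite digit sequence, $x(d_1d_2\dots)=\sum_i d_ib^{-i}$. $k_w(g)$ is the number of occurrences (with overlaps) of $w$ in the word $g$ as a block of consecutive digits; for an integer $n>0$, $k_w(n)=k_w(g)$ with $g$ the base-$b$ representation of $n$ without leading zeros; $I(b,w,k)=\sum_{n>0,\,k_w(n)=k}\frac1n$. Put $k_w^+(g)=k_w(wg)-1$. For a non-empty word $g$, $g^-$ is $g$ with its last digit deleted. Languages: $\mathcal G=\{g \text{ non-empty}: k_w^+(g)=1,\ k_w^+(g^-)=0\}$ (return language), $\mathcal L=\{g\text{ non-empty}: k_w(g)=1,\ k_w(g^-)=0\}$, $\mathcal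 R=\{g: k_w^+(g)=0\}$. Set $\lambda_j(b,w)=\sum_{g\in\mathcal G}b^{-j|g|}$; these are pairwise distinct. For $j\ge1$, $\nu_j$ is the probability measure on $[0,1]$ which is the law of $x(G_1G_2G_3\cdots)$ (infinite concatenation), where the $G_i$ are i.i.d. random elements of $\mathcal G$ with $\mathbb P(G_i=g)=b^{-j|g|}/\lambda_j(b,w)$. The return operator acts on continuous functions on $[0,1]$ by $(\mathsf K_wf)(x)=\sum_{g\in\mathcal G}b^{-|g|}f(x(g)+b^{-|g|}x)$; for each $m\ge0$, $\mathcal B_m$ is the unique monic polynomial of degree $m$ with $\mathsf K_w\mathcal B_m=\lambda_{m+1}(b,w)\mathcal B_m$. Let $\eta_0=\sum_{r\in\mathcal R}b^{-|r|}\delta_{x(r)}$ (a finite measure on $[0,1)$), and $f_{\mathcal L}(z)=\sum_{g\in\mathcal L,\ g_1>0}\frac1{n(g)+z}$, where $g_1$ is the first digit of $g$. Define $$\mathfrak L_j(b,w)=\frac1{(j-1)!}\int_0^1f_{\mathcal L}^{(j-1)}(x)\,d\nu_j(x),\qquad \mathfrak R_j(b,w)=\int_0^1\mathcal B_{j-1}(x)\,d\eta_0(x).$$ *)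

theory Defs
  imports "HOL-Probability.Probability" "HOL-Computational_Algebra.Polynomial"
begin

text \<open>Words are digit lists with the most significant digit first, whereas \<open>horner_sum\<close>
  expects the least significant one first.\<close>

definition words :: "nat \<Rightarrow> nat list set"
  where "words b = lists {..<b}"

definition word_int :: "nat \<Rightarrow> nat list \<Rightarrow> nat"
  where "word_int b g = horner_sum id b (rev g)"

definition word_frac :: "nat \<Rightarrow> nat list \<Rightarrow> real"
  where "word_frac b g = real (word_int b g) / real b ^ length g"

definition stream_frac :: "nat \<Rightarrow> nat stream \<Rightarrow> real"
  where "stream_frac b d = (\<Sum>i. real (d !! i) / real b ^ Suc i)"

text \<open>The guard \<open>b \<le> 1\<close> only ensures termination.\<close>

fun digits :: "nat \<Rightarrow> nat \<Rightarrow> nat list"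
  where "digits b n = (if n = 0 \<or> b \<le> 1 then [] else digits b (n div b) @ [n mod b])"

declare digits.simps [simp del]

lemma digits_correct:
  assumes "b > 1"
  shows "digits b n \<in> words b" "word_int b (digits b n) = n" "n > 0 \<Longrightarrow> hd (digits b n) > 0"
proof -
  have "digits b n \<in> words b \<and> word_int b (digits b n) = n \<and>
      (n > 0 \<longrightarrow> digits b n \<noteq> [] \<and> hd (digits b n) > 0)"
  proof (induction n rule: less_induct)
    case (less n)
    show ?case
    proof (cases "n = 0")
      case True
      then show ?thesis
        by (simp add: digits.simps [of b 0] words_def word_int_def)
    next
      case False
      have eq: "digits b n = digits b (n div b) @ [n mod b]"
        using False assms by (simp add: digits.simps [of b n])
      have IH: "digits b (n div b) \<in> words b" "word_int b (digits b (n div b)) = n div b"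
        "n div b > 0 \<longrightarrow> digits b (n div b) \<noteq> [] \<and> hd (digits b (n div b)) > 0"
        using less.IH [of "n div b"] False assms by auto
      have "word_int b (digits b n) = n"
        using IH(2) by (simp add: eq word_int_def)
      moreover have "digits b n \<in> words b"
        using IH(1) assms by (simp add: eq words_def)
      moreover have "hd (digits b n) > 0"
      proof (cases "n div b = 0")
        case True
        then have "n < b"
          using assms by (simp add: div_eq_0_iff)
        then show ?thesis
          using False by (simp add: eq True digits.simps [of b 0])
      next
        case False
        then show ?thesis
          using IH(3) by (simp add: eq)
      qed
      ultimately show ?thesis
        by (simp add: eq)
    qed
  qed
  then show "digits b n \<in> words b" "word_int b (digits b n) = n"
    "n > 0 \<Longrightarrow> hd (digits b n) > 0"
    by auto
qed

definition occ :: "nat list \<Rightarrow> nat list \<Rightarrow> nat"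
  where "occ w g = card {i. i + length w \<le> length g \<and> take (length w) (drop i g) = w}"

text \<open>No truncation occurs in the subtraction: \<open>w\<close> is a prefix of \<open>w @ g\<close>.\<close>

definition occ_after :: "nat list \<Rightarrow> nat list \<Rightarrow> nat"
  where "occ_after w g = occ w (w @ g) - 1"

definition irwin_set :: "nat \<Rightarrow> nat list \<Rightarrow> nat \<Rightarrow> nat set"
  where "irwin_set b w k = {n. n > 0 \<and> occ w (digits b n) = k}"

definition irwin_sum :: "nat \<Rightarrow> nat list \<Rightarrow> nat \<Rightarrow> real"
  where "irwin_sum b w k = (\<Sum>\<^sub>\<infinity>n\<in>irwin_set b w k. 1 / real n)"

definition lang_G :: "nat \<Rightarrow> nat list \<Rightarrow> nat list set"
  where "lang_G b w =
    {g \<in> words b. g \<noteq> [] \<and> occ_after w g = 1 \<and> occ_after w (butlast g) = 0}"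

definition lang_L :: "nat \<Rightarrow> nat list \<Rightarrow> nat list set"
  where "lang_L b w = {g \<in> words b. g \<noteq> [] \<and> occ w g = 1 \<and> occ w (butlast g) = 0}"

definition lang_R :: "nat \<Rightarrow> nat list \<Rightarrow> nat list set"
  where "lang_R b w = {g \<in> words b. occ_after w g = 0}"

definition gf_G :: "nat \<Rightarrow> nat list \<Rightarrow> real \<Rightarrow> real"
  where "gf_G b w t = (\<Sum>\<^sub>\<infinity>g\<in>lang_G b w. t ^ length g)"

definition lam :: "nat \<Rightarrow> nat list \<Rightarrow> nat \<Rightarrow> real"
  where "lam b w j = (\<Sum>\<^sub>\<infinity>g\<in>lang_G b w. 1 / real b ^ (j * length g))"

definition return_word_pmf :: "nat \<Rightarrow> nat list \<Rightarrow> nat \<Rightarrow> nat list pmf"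
  where "return_word_pmf b w j =
    embed_pmf (\<lambda>g. if g \<in> lang_G b w then 1 / real b ^ (j * length g) / lam b w j else 0)"

definition nu :: "nat \<Rightarrow> nat list \<Rightarrow> nat \<Rightarrow> real measure"
  where "nu b w j =
    distr (stream_space (measure_pmf (return_word_pmf b w j))) borel
      (\<lambda>gs. stream_frac b (flat gs))"

text \<open>The weighted sum of Dirac masses, over all words \<open>r\<close> of the language (several of which may
  have the same value \<open>x(r)\<close>), is the image under \<open>x\<close> of the weighted counting measure.\<close>

definition eta0 :: "nat \<Rightarrow> nat list \<Rightarrow> real measure"
  where "eta0 b w =
    distr (point_measure (lang_R b w) (\<lambda>r. ennreal (1 / real b ^ length r))) borel (word_frac b)"

definition return_op :: "nat \<Rightarrow> nat list \<Rightarrow> (real \<Rightarrow> real) \<Rightarrow> real \<Rightarrow> real"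
  where "return_op b w f x =
    (\<Sum>\<^sub>\<infinity>g\<in>lang_G b w. 1 / real b ^ length g * f (word_frac b g + x / real b ^ length g))"

definition eigenpoly :: "nat \<Rightarrow> nat list \<Rightarrow> nat \<Rightarrow> real poly"
  where "eigenpoly b w m = (THE q. degree q = m \<and> lead_coeff q = 1 \<and>
    (\<forall>x\<in>{0..1}. return_op b w (poly q) x = lam b w (Suc m) * poly q x))"

definition f_L :: "nat \<Rightarrow> nat list \<Rightarrow> real \<Rightarrow> real"
  where "f_L b w z = (\<Sum>\<^sub>\<infinity>g\<in>{g \<in> lang_L b w. hd g > 0}. 1 / (real (word_int b g) + z))"

text \<open>The terms of \<open>f_L\<close> have their poles at the integers \<open>- word_int b g \<le> -1\<close>, so that
  the two-sided derivatives make sense at every point of \<open>[0, 1]\<close>.\<close>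

definition coeff_L :: "nat \<Rightarrow> nat list \<Rightarrow> nat \<Rightarrow> real"
  where "coeff_L b w j =
    1 / fact (j - 1) * (LINT x:{0..1}|nu b w j. (deriv ^^ (j - 1)) (f_L b w) x)"

definition coeff_R :: "nat \<Rightarrow> nat list \<Rightarrow> nat \<Rightarrow> real"
  where "coeff_R b w j = (LINT x:{0..1}|eta0 b w. poly (eigenpoly b w (j - 1)) x)"

definition irwin_term :: "nat \<Rightarrow> nat list \<Rightarrow> nat \<Rightarrow> nat \<Rightarrow> real"
  where "irwin_term b w k j = coeff_L b w j * lam b w j ^ (k - 1) * coeff_R b w j"

end

theory Submission
  imports Defs "HOL-Library.Sublist" "HOL-Probability.Product_PMF"
begin

text \<open>Cutting the digits of \<open>n\<close> at the occurrences of \<open>w\<close> factors them as a word of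
  \<open>\<L>\<close>, then words of \<open>\<G>\<close>, then a word of \<open>\<R>\<close>, so that the Irwin sum for \<open>k\<close> is
  \<open>\<integral> K\<^sup>k\<^sup>-\<^sup>1 f\<^sub>L d\<eta>\<^sub>0\<close>. The functionals \<open>f \<mapsto> (1/m!) \<integral> f\<^sup>(\<^sup>m\<^sup>) d\<nu>\<^sub>m\<^sub>+\<^sub>1\<close> are
  biorthogonal to the eigenpolynomials, and the claim is the eigenfunction expansion of \<open>f\<^sub>L\<close>.

  For its convergence on \<open>[0, 1]\<close>, let \<open>g\<^sub>0\<close> be the shortest return word. Every return word is
  \<open>u g\<^sub>0\<close> for some word \<open>u\<close>, so relative to the branch of \<open>g\<^sub>0\<close>, which is diagonal in powers of
  \<open>x - x\<^sub>0\<close> with \<open>x\<^sub>0\<close> its fixed point, all other branches are contractions of \<open>[0, 1]\<close>. This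
  makes the eigenpolynomials grow slower than every \<open>(1 + \<epsilon>)\<^sup>m\<close>, while the coefficients of
  \<open>f\<^sub>L\<close> decay geometrically. Expanding \<open>1/(n + x)\<close> in powers of \<open>1 - x\<close> first, all
  coefficients have the sign \<open>(-1)\<^sup>m\<close>, which justifies the rearrangement.\<close>

section \<open>Words and occurrences\<close>

text \<open>The operator is triangular on polynomials, so solving for an eigenpolynomial divides by
  gaps between eigenvalues, and these shrink like \<open>wt g\<^sub>0 ^ k\<close>. The expansion
  around \<open>x\<^sub>0\<close> removes this obstacle: every branch that contributes off the
  diagonal carries the same small factor, which cancels the divisor. A growth rate arbitrarily close
  to 1 is essential, since the poles of \<open>f_L\<close> are close to [0,1]. For a pole at -n the
  trivial decay of the coefficients is n^-(m+1), which says nothing for n = 1; that pole needs its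
  own argument and yields the rate b/(b+1), close to 1 for large b. No spectral theory is involved.
  The operator is handled on polynomials, its powers are encoded by words with a prescribed number
  of occurrences, and all exact values (total masses, the logarithm in the leading term, invariance
  of Lebesgue measure) come from one conservation law on the tree of digits.\<close>

lemma Nil_in_words [simp]: "[] \<in> words b"
  by (simp add: words_def)

lemma append_in_words [simp]: "u @ v \<in> words b \<longleftrightarrow> u \<in> words b \<and> v \<in> words b"
  by (auto simp: words_def)

lemma Cons_in_words [simp]: "d # v \<in> words b \<longleftrightarrow> d < b \<and> v \<in> words b"
  by (auto simp: words_def)

lemma card_words: "card {u \<in> words b. length u = n} = b ^ n"
  and finite_words: "finite {u \<in> words b. length u = n}"
proof -
  have "{u \<in> words b. length u = n} = {u. set u \<subseteq> {..<b} \<and> length u = n}"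
    by (auto simp: words_def)
  then show "card {u \<in> words b. length u = n} = b ^ n" "finite {u \<in> words b. length u = n}"
    by (simp_all add: card_lists_length_eq finite_lists_length_eq)
qed

lemma finite_words_le: "finite {u \<in> words b. length u \<le> n}"
proof -
  have "{u \<in> words b. length u \<le> n} = (\<Union>k\<le>n. {u \<in> words b. length u = k})"
    by auto
  then show ?thesis
    by (simp add: finite_words)
qed

section \<open>Integers represented by words\<close>

lemma word_int_Nil [simp]: "word_int b [] = 0"
  by (simp add: word_int_def)

lemma word_int_snoc: "word_int b (g @ [d]) = b * word_int b g + d"
  by (simp add: word_int_def)

lemma word_int_append: "word_int b (g @ r) = word_int b g * b ^ length r + word_int b r"
proof (induction r rule: rev_induct)
  case (snoc d r)
  have "word_int b (g @ r @ [d]) = b * word_int b (g @ r) + d"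
    using word_int_snoc [of b "g @ r" d] by simp
  then show ?case
    by (simp add: snoc word_int_snoc algebra_simps)
qed simp

lemma word_int_less: "g \<in> words b \<Longrightarrow> word_int b g < b ^ length g"
proof (induction g rule: rev_induct)
  case (snoc d g)
  then have "d < b" "Suc (word_int b g) \<le> b ^ length g"
    by auto
  then have "b * Suc (word_int b g) \<le> b * b ^ length g"
    using mult_le_mono2 by blast
  with \<open>d < b\<close> show ?case
    by (simp add: word_int_snoc)
qed simp

lemma word_int_ge:
  assumes "g \<noteq> []" "hd g > 0"
  shows "b ^ (length g - 1) \<le> word_int b g"
proof -
  obtain d u where g: "g = [d] @ u"
    using assms by (cases g) auto
  have "word_int b [d] = d"
    using word_int_snoc [of b "[]" d] by simp
  then show ?thesis
    using assms unfolding g word_int_append by (simp add: add_increasing2)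
qed

lemma word_int_pos:
  assumes "b > 1" "g \<noteq> []" "hd g > 0"
  shows "word_int b g > 0"
proof -
  have "0 < b ^ (length g - 1)"
    using assms(1) by simp
  then show ?thesis
    using word_int_ge [OF assms(2,3)] by (rule less_le_trans)
qed

lemma digits_word_int:
  assumes "b > 1" "u \<in> words b" "u \<noteq> []" "hd u > 0"
  shows "digits b (word_int b u) = u"
  using assms(2-)
proof (induction u rule: rev_induct)
  case (snoc d u)
  have d: "d < b"
    using snoc.prems by simp
  have "word_int b (u @ [d]) \<noteq> 0"
    using word_int_pos [OF assms(1) snoc.prems(2,3)] by simp
  then have "digits b (word_int b (u @ [d])) = digits b (word_int b u) @ [d]"
    using assms(1) d by (subst digits.simps) (simp add: word_int_snoc)
  moreover have "digits b (word_int b u) = u"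
  proof (cases "u = []")
    case True
    then show ?thesis
      by (simp add: digits.simps)
  next
    case False
    then show ?thesis
      using snoc by simp
  qed
  ultimately show ?case
    by simp
qed simp

lemma digits_ne_Nil: "b > 1 \<Longrightarrow> n > 0 \<Longrightarrow> digits b n \<noteq> []"
  by (subst digits.simps) simp

text \<open>Both \<open>occ w\<close> and \<open>occ_after w\<close> start at \<open>0\<close> and grow by at most one per digit; the
  languages \<open>lang_L\<close> and \<open>lang_G\<close> are their sets of first passage to \<open>1\<close>.\<close>

definition unit_steps :: "(nat list \<Rightarrow> nat) \<Rightarrow> bool"
  where "unit_steps c \<longleftrightarrow> c [] = 0 \<and> (\<forall>u d. c (u @ [d]) = c u \<or> c (u @ [d]) = Suc (c u))"

definition first_passage :: "nat \<Rightarrow> (nat list \<Rightarrow> nat) \<Rightarrow> nat list set"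
  where "first_passage b c = {g \<in> words b. g \<noteq> [] \<and> c g = 1 \<and> c (butlast g) = 0}"

lemma lang_L_eq: "lang_L b w = first_passage b (occ w)"
  by (simp add: lang_L_def first_passage_def)

lemma lang_G_eq: "lang_G b w = first_passage b (occ_after w)"
  by (simp add: lang_G_def first_passage_def)

lemma first_passage_words: "g \<in> first_passage b c \<Longrightarrow> g \<in> words b"
  by (simp add: first_passage_def)

lemma unit_steps_mono:
  assumes "unit_steps c"
  shows "c u \<le> c (u @ v)"
proof (induction v rule: rev_induct)
  case (snoc d v)
  then show ?case
    using assms unfolding unit_steps_def by (metis append.assoc le_SucI)
qed simp

text \<open>A proper extension of \<open>g\<close> still contains \<open>g\<close> when its last
  digit is deleted, so monotonicity makes the count positive too early: first passage words form a
  prefix code.\<close>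

lemma first_passage_prefix:
  assumes "unit_steps c" "g \<in> first_passage b c" "g @ s \<in> first_passage b c"
  shows "s = []"
proof (rule ccontr)
  assume "s \<noteq> []"
  then have "c g \<le> c (butlast (g @ s))"
    using unit_steps_mono [OF assms(1), of g "butlast s"] by (simp add: butlast_append)
  then show False
    using assms(2,3) by (simp add: first_passage_def)
qed

lemma first_passage_unique:
  assumes "unit_steps c" "g \<in> first_passage b c" "h \<in> first_passage b c" "g @ r = h @ s"
  shows "g = h" "r = s"
proof -
  from assms(4) obtain t where "g = h @ t \<and> t @ r = s \<or> g @ t = h \<and> r = t @ s"
    by (auto simp: append_eq_append_conv2)
  then show "g = h" "r = s"
    using first_passage_prefix [OF assms(1)] assms(2,3) by auto
qed

lemma first_passage_exists:
  assumes "unit_steps c" "u \<in> words b" "c u \<ge> 1"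
  shows "\<exists>g r. u = g @ r \<and> g \<in> first_passage b c"
  using assms(2,3)
proof (induction u rule: rev_induct)
  case Nil
  then show ?case
    using assms(1) by (simp add: unit_steps_def)
next
  case (snoc d u)
  show ?case
  proof (cases "c u = 0")
    case True
    then have "c (u @ [d]) = 1"
      using snoc.prems assms(1) unfolding unit_steps_def
      by (metis One_nat_def not_one_le_zero)
    then have "u @ [d] \<in> first_passage b c"
      using True snoc.prems by (simp add: first_passage_def)
    then show ?thesis
      by (metis append_Nil2)
  next
    case False
    then obtain g r where "u = g @ r" "g \<in> first_passage b c"
      using snoc by auto
    then show ?thesis
      by (intro exI [of _ g] exI [of _ "r @ [d]"]) simp
  qed
qed

section \<open>Counting occurrences digit by digit\<close>

lemma occ_Nil [simp]: "w \<noteq> [] \<Longrightarrow> occ w [] = 0"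
  by (simp add: occ_def)

text \<open>A window that does not already lie inside \<open>g\<close> ends at the new digit; hence
  at most one occurrence is new, and a suffix test detects it. The later facts on counts reduce to
  such tests.\<close>

lemma occ_snoc:
  assumes "w \<noteq> []"
  shows "occ w (g @ [d]) = occ w g + (if suffix w (g @ [d]) then 1 else 0)"
proof -
  define P where "P = (\<lambda>v i. i + length w \<le> length v \<and> take (length w) (drop i v) = w)"
  have fin: "finite {i. P v i}" for v
    by (rule finite_subset [of _ "{..length v}"]) (auto simp: P_def)
  have old: "P (g @ [d]) i \<longleftrightarrow> P g i" if "i + length w \<noteq> Suc (length g)" for i
    using that by (auto simp: P_def)
  have new: "P (g @ [d]) i \<longleftrightarrow> suffix w (g @ [d])" if "i + length w = Suc (length g)" for i
  proof -
    have "P (g @ [d]) i \<longleftrightarrow> drop i (g @ [d]) = w"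
      using that by (auto simp: P_def)
    also have "\<dots> \<longleftrightarrow> suffix w (g @ [d])"
    proof
      assume "drop i (g @ [d]) = w"
      then show "suffix w (g @ [d])"
        using suffix_drop by blast
    next
      assume "suffix w (g @ [d])"
      then obtain z where z: "g @ [d] = z @ w"
        by (auto simp: suffix_def)
      then have "length z = i"
        using that by (metis add_right_cancel length_append length_append_singleton)
      then show "drop i (g @ [d]) = w"
        using z by simp
    qed
    finally show ?thesis .
  qed
  have "{i. P (g @ [d]) i} = {i. P g i} \<union> (if suffix w (g @ [d]) then {Suc (length g) - length w} else {})"
  proof (intro set_eqI)
    fix i
    show "i \<in> {i. P (g @ [d]) i} \<longleftrightarrow>
      i \<in> {i. P g i} \<union> (if suffix w (g @ [d]) then {Suc (length g) - length w} else {})"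
    proof (cases "i + length w = Suc (length g)")
      case True
      then have "\<not> P g i" "i = Suc (length g) - length w"
        by (auto simp: P_def)
      with new [OF True] show ?thesis
        by auto
    next
      case False
      have "i \<noteq> Suc (length g) - length w" if "suffix w (g @ [d])"
        using suffix_length_le [OF that] False by auto
      with old [OF False] show ?thesis
        by auto
    qed
  qed
  moreover have "\<not> P g (Suc (length g) - length w)"
    using assms by (cases w) (auto simp: P_def)
  ultimately show ?thesis
    using fin [of g] by (simp add: occ_def P_def)
qed

lemma occ_self [simp]: "occ w w = 1"
proof -
  have "{i. i + length w \<le> length w \<and> take (length w) (drop i w) = w} = {0}"
    by auto
  then show ?thesis
    by (simp add: occ_def)
qed

lemma unit_steps_occ: "w \<noteq> [] \<Longrightarrow> unit_steps (occ w)"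
  by (auto simp: unit_steps_def occ_snoc)

lemma occ_prefix_self: "w \<noteq> [] \<Longrightarrow> occ w (w @ r) = Suc (occ_after w r)"
  using unit_steps_mono [OF unit_steps_occ, of w w r] by (simp add: occ_after_def)

lemma occ_after_Nil [simp]: "occ_after w [] = 0"
  by (simp add: occ_after_def)

lemma occ_after_snoc:
  assumes "w \<noteq> []"
  shows "occ_after w (g @ [d]) = occ_after w g + (if suffix w (w @ g @ [d]) then 1 else 0)"
proof -
  have "Suc (occ_after w (g @ [d])) = Suc (occ_after w g) + (if suffix w ((w @ g) @ [d]) then 1 else 0)"
    using occ_snoc [OF assms, of "w @ g" d] unfolding occ_prefix_self [OF assms, symmetric]
    by (simp only: append_assoc)
  then show ?thesis
    by simp
qed

lemma unit_steps_occ_after: "w \<noteq> [] \<Longrightarrow> unit_steps (occ_after w)"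
  by (auto simp: unit_steps_def occ_after_snoc)

lemma suffix_append_left_iff: "length w \<le> length r \<Longrightarrow> suffix w (v @ r) \<longleftrightarrow> suffix w r"
  by (metis suffix_appendI suffix_length_suffix suffix_order.refl)

text \<open>Renewal property: whether an occurrence ends at a given digit of \<open>r\<close>
  depends on the last \<open>length w\<close> digits only, and these lie inside
  \<open>w @ r\<close>. What precedes a completed \<open>w\<close> is forgotten.\<close>

lemma occ_append:
  assumes "w \<noteq> []"
  shows "occ w (v @ w @ r) = occ w (v @ w) + occ_after w r"
proof (induction r rule: rev_induct)
  case (snoc d r)
  have "suffix w (v @ w @ r @ [d]) \<longleftrightarrow> suffix w (w @ r @ [d])"
    by (rule suffix_append_left_iff) simp
  then show ?case
    using occ_snoc [OF assms, of "v @ w @ r" d] occ_after_snoc [OF assms, of r d] snoc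
    by (simp split: if_splits)
qed simp

text \<open>A preceding \<open>w\<close> can only create further occurrences. Words with
  \<open>occ_after w u = 0\<close> therefore avoid \<open>w\<close>, so that one negligibility
  statement serves both \<open>lang_L\<close> and \<open>lang_G\<close>.\<close>

lemma occ_le_occ_after:
  assumes "w \<noteq> []"
  shows "occ w u \<le> occ_after w u"
proof (induction u rule: rev_induct)
  case (snoc d u)
  have "suffix w (u @ [d]) \<Longrightarrow> suffix w (w @ u @ [d])"
    by (rule suffix_appendI)
  then show ?case
    using snoc by (simp add: occ_snoc [OF assms] occ_after_snoc [OF assms] del: suffix_snoc)
qed (use assms in simp)

lemma lang_L_suffix:
  assumes "w \<noteq> []" "g \<in> lang_L b w"
  shows "suffix w g"
proof -
  obtain u d where g: "g = u @ [d]"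
    using assms(2) by (cases g rule: rev_cases) (auto simp: lang_L_def)
  show ?thesis
    using assms(2) occ_snoc [OF assms(1), of u d]
    by (auto simp: lang_L_def g split: if_splits simp del: suffix_snoc)
qed

text \<open>The last digit raises the count from 0 to 1 and so completes an occurrence; this makes
  the renewal property applicable behind \<open>w @ g\<close>.\<close>

lemma lang_G_suffix:
  assumes "w \<noteq> []" "g \<in> lang_G b w"
  shows "suffix w (w @ g)"
proof -
  obtain u d where g: "g = u @ [d]"
    using assms(2) by (cases g rule: rev_cases) (auto simp: lang_G_def)
  show ?thesis
    using assms(2) occ_after_snoc [OF assms(1), of u d]
    by (auto simp: lang_G_def g split: if_splits simp del: suffix_snoc)
qed

section \<open>Unique factorization at the occurrences of \<open>w\<close>\<close>

definition lang_R_level :: "nat \<Rightarrow> nat list \<Rightarrow> nat \<Rightarrow> nat list set"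
  where "lang_R_level b w j = {r \<in> words b. occ_after w r = j}"

lemma lang_R_level_0: "lang_R_level b w 0 = lang_R b w"
  by (simp add: lang_R_level_def lang_R_def)

text \<open>Iterated, this identifies level k with k return words followed by a word of
  \<open>lang_R\<close>. It stands in for powers of the return operator: integrating the k-th power
  applied to a function against \<open>eta0\<close> is a weighted sum over level k.\<close>

lemma bij_betw_lang_R_level:
  assumes "w \<noteq> []"
  shows "bij_betw (\<lambda>(g, r). g @ r) (lang_G b w \<times> lang_R_level b w j) (lang_R_level b w (Suc j))"
proof -
  have app: "occ_after w (g @ r) = Suc (occ_after w r)" if g: "g \<in> lang_G b w" for g r
  proof -
    obtain v where v: "w @ g = v @ w"
      using lang_G_suffix [OF assms g] by (auto simp: suffix_def)
    have "Suc (occ_after w (g @ r)) = occ w (v @ w @ r)"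
      using v by (metis append_assoc assms occ_prefix_self)
    also have "\<dots> = occ w (w @ g) + occ_after w r"
      using v occ_append [OF assms] by simp
    also have "occ w (w @ g) = 2"
      using g by (simp add: occ_prefix_self [OF assms] lang_G_def)
    finally show ?thesis
      by simp
  qed
  show ?thesis
  proof (rule bij_betw_imageI)
    show "inj_on (\<lambda>(g, r). g @ r) (lang_G b w \<times> lang_R_level b w j)"
    proof (rule inj_onI, clarify)
      fix g r h s
      assume "g \<in> lang_G b w" "h \<in> lang_G b w" "g @ r = h @ s"
      then show "g = h \<and> r = s"
        using first_passage_unique [OF unit_steps_occ_after [OF assms], of g b h r s]
        by (auto simp: lang_G_eq)
    qed
    show "(\<lambda>(g, r). g @ r) ` (lang_G b w \<times> lang_R_level b w j) = lang_R_level b w (Suc j)"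
    proof safe
      fix g r
      assume "g \<in> lang_G b w" "r \<in> lang_R_level b w j"
      then show "g @ r \<in> lang_R_level b w (Suc j)"
        using app by (auto simp: lang_R_level_def lang_G_def)
    next
      fix u
      assume u: "u \<in> lang_R_level b w (Suc j)"
      then obtain g r where gr: "u = g @ r" "g \<in> lang_G b w"
        using first_passage_exists [OF unit_steps_occ_after [OF assms], of u b]
        by (auto simp: lang_R_level_def lang_G_eq)
      then have "r \<in> lang_R_level b w j"
        using u app by (auto simp: lang_R_level_def)
      with gr show "u \<in> (\<lambda>(g, r). g @ r) ` (lang_G b w \<times> lang_R_level b w j)"
        by (auto intro!: image_eqI [of _ _ "(g, r)"])
    qed
  qed
qed

definition lang_L_pos :: "nat \<Rightarrow> nat list \<Rightarrow> nat list set"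
  where "lang_L_pos b w = {g \<in> lang_L b w. hd g > 0}"

text \<open>The part in \<open>lang_L\<close> is nonempty and so contains the leading digit; hence
  the positivity condition on it and none on \<open>r\<close>. One of the \<open>Suc k\<close>
  occurrences is used up by \<open>g\<close>.\<close>

lemma bij_betw_irwin_set:
  assumes "b > 1" "w \<noteq> []"
  shows "bij_betw (\<lambda>(g, r). word_int b (g @ r)) (lang_L_pos b w \<times> lang_R_level b w k)
    (irwin_set b w (Suc k))"
proof -
  have app: "occ w (g @ r) = Suc (occ_after w r)" if g: "g \<in> lang_L_pos b w" for g r
  proof -
    have "g \<in> lang_L b w"
      using g by (simp add: lang_L_pos_def)
    then obtain v where v: "g = v @ w"
      using lang_L_suffix [OF assms(2)] by (auto simp: suffix_def)
    then have "occ w (g @ r) = occ w g + occ_after w r"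
      using occ_append [OF assms(2), of v r] by simp
    then show ?thesis
      using \<open>g \<in> lang_L b w\<close> by (simp add: lang_L_def)
  qed
  have dig: "digits b (word_int b (g @ r)) = g @ r"
    if "g \<in> lang_L_pos b w" "r \<in> lang_R_level b w k" for g r
    using that assms(1) by (intro digits_word_int) (auto simp: lang_L_pos_def lang_L_def lang_R_level_def)
  have pos: "word_int b (g @ r) > 0" if "g \<in> lang_L_pos b w" for g r
    using that assms(1) by (intro word_int_pos) (auto simp: lang_L_pos_def lang_L_def)
  show ?thesis
  proof (rule bij_betw_imageI)
    show "inj_on (\<lambda>(g, r). word_int b (g @ r)) (lang_L_pos b w \<times> lang_R_level b w k)"
    proof (rule inj_onI, clarify)
      fix g r h s
      assume A: "g \<in> lang_L_pos b w" "r \<in> lang_R_level b w k" "h \<in> lang_L_pos b w"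
        "s \<in> lang_R_level b w k" "word_int b (g @ r) = word_int b (h @ s)"
      then have "g @ r = h @ s"
        by (metis dig)
      then show "g = h \<and> r = s"
        using first_passage_unique [OF unit_steps_occ [OF assms(2)], of g b h r s] A(1,3)
        by (auto simp: lang_L_pos_def lang_L_eq)
    qed
    show "(\<lambda>(g, r). word_int b (g @ r)) ` (lang_L_pos b w \<times> lang_R_level b w k)
        = irwin_set b w (Suc k)"
    proof safe
      fix g r
      assume "g \<in> lang_L_pos b w" "r \<in> lang_R_level b w k"
      then show "word_int b (g @ r) \<in> irwin_set b w (Suc k)"
        using dig [of g r] app [of g r] pos [of g r] by (auto simp: irwin_set_def lang_R_level_def)
    next
      fix n
      assume n: "n \<in> irwin_set b w (Suc k)"
      define u where "u = digits b n"
      have u: "u \<in> words b" "word_int b u = n" "hd u > 0" "u \<noteq> []" "occ w u = Suc k"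
        using n assms(1) digits_correct [of b n] digits_ne_Nil [of b n]
        by (auto simp: u_def irwin_set_def)
      then obtain g r where gr: "u = g @ r" "g \<in> lang_L b w"
        using first_passage_exists [OF unit_steps_occ [OF assms(2)], of u b] by (auto simp: lang_L_eq)
      then have g: "g \<in> lang_L_pos b w"
        using u(3) by (auto simp: lang_L_pos_def lang_L_def)
      then have "r \<in> lang_R_level b w k"
        using u gr app by (auto simp: lang_R_level_def)
      with g gr u(2) show "n \<in> (\<lambda>(g, r). word_int b (g @ r)) ` (lang_L_pos b w \<times> lang_R_level b w k)"
        by (auto intro!: image_eqI [of _ _ "(g, r)"])
    qed
  qed
qed

section \<open>First passage sums\<close>

lemma has_sum_exhaust:
  fixes f :: "'a \<Rightarrow> real" and l :: "'a \<Rightarrow> nat"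
  assumes "f summable_on A" "\<And>N. finite {x \<in> A. l x \<le> N}"
    and lim: "(\<lambda>N. sum f {x \<in> A. l x \<le> N}) \<longlonglongrightarrow> S"
  shows "(f has_sum S) A"
proof -
  have "filterlim (\<lambda>N. {x \<in> A. l x \<le> N}) (finite_subsets_at_top A) sequentially"
    unfolding filterlim_finite_subsets_at_top
  proof safe
    fix X assume X: "finite X" "X \<subseteq> A"
    show "\<forall>\<^sub>F N in sequentially. finite {x \<in> A. l x \<le> N} \<and> X \<subseteq> {x \<in> A. l x \<le> N} \<and> {x \<in> A. l x \<le> N} \<subseteq> A"
      using eventually_ge_at_top [of "Max (l ` X)"]
    proof eventually_elim
      case (elim N)
      have "l x \<le> N" if "x \<in> X" for x
        using elim that X(1) by (meson Max_ge finite_imageI imageI order_trans)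
      then show ?case
        using X assms(2) by auto
    qed
  qed
  moreover have "(sum f \<longlongrightarrow> infsum f A) (finite_subsets_at_top A)"
    using assms(1) infsum_tendsto by blast
  ultimately have "(\<lambda>N. sum f {x \<in> A. l x \<le> N}) \<longlonglongrightarrow> infsum f A"
    using filterlim_compose by blast
  then have "infsum f A = S"
    using lim LIMSEQ_unique by blast
  then show ?thesis
    using assms(1) has_sum_infsum by blast
qed

lemma summable_on_exhaust:
  fixes f :: "'a \<Rightarrow> real" and l :: "'a \<Rightarrow> nat"
  assumes "\<And>x. x \<in> A \<Longrightarrow> f x \<ge> 0" "\<And>N. finite {x \<in> A. l x \<le> N}"
    and bound: "\<And>N. sum f {x \<in> A. l x \<le> N} \<le> C"
  shows "f summable_on A"
proof (rule nonneg_bdd_above_summable_on)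
  show "bdd_above (sum f ` {F. F \<subseteq> A \<and> finite F})"
  proof (rule bdd_aboveI2 [where M = C])
    fix F assume "F \<in> {F. F \<subseteq> A \<and> finite F}"
    then have F: "F \<subseteq> A" "finite F" by auto
    have "l x \<le> Max (l ` F)" if "x \<in> F" for x
      using that F(2) by simp
    then have "sum f F \<le> sum f {x \<in> A. l x \<le> Max (l ` F)}"
      using F assms(1,2) by (intro sum_mono2) auto
    then show "sum f F \<le> C"
      using bound order_trans by blast
  qed
qed (use assms(1) in auto)

section \<open>Words that avoid \<open>w\<close> are negligible\<close>

definition live :: "nat \<Rightarrow> (nat list \<Rightarrow> nat) \<Rightarrow> nat \<Rightarrow> nat list set"
  where "live b c n = {u \<in> words b. length u = n \<and> c u = 0}"

lemma finite_live: "finite (live b c n)"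
  by (rule finite_subset [OF _ finite_words [of b n]]) (auto simp: live_def)

lemma occ_suffix_pos:
  assumes "w \<noteq> []" "suffix w u"
  shows "occ w u > 0"
proof -
  obtain v d where u: "u = v @ [d]"
    using assms by (cases u rule: rev_cases) auto
  show ?thesis
    using assms occ_snoc [OF assms(1), of v d] by (simp add: u del: suffix_snoc)
qed

text \<open>The final block of \<open>length w\<close> digits must differ from \<open>w\<close>,
  which leaves \<open>b ^ length w - 1\<close> choices; occurrences across the block boundary are
  ignored.\<close>

lemma card_live_occ_add:
  assumes "w \<noteq> []" "w \<in> words b"
  shows "card (live b (occ w) (n + length w)) \<le> card (live b (occ w) n) * (b ^ length w - 1)"
proof -
  define V where "V = {v \<in> words b. length v = length w} - {w}"
  have V: "finite V" "card V = b ^ length w - 1"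
    using assms(2) by (simp_all add: V_def finite_words card_words)
  have "card (live b (occ w) (n + length w)) \<le> card (live b (occ w) n \<times> V)"
  proof (rule card_inj_on_le [of "\<lambda>u. (take n u, drop n u)"])
    show "inj_on (\<lambda>u. (take n u, drop n u)) (live b (occ w) (n + length w))"
    proof (rule inj_onI)
      fix u v :: "nat list"
      assume "(take n u, drop n u) = (take n v, drop n v)"
      then have "take n u @ drop n u = take n v @ drop n v"
        by simp
      then show "u = v"
        by (simp only: append_take_drop_id)
    qed
    show "(\<lambda>u. (take n u, drop n u)) ` live b (occ w) (n + length w) \<subseteq> live b (occ w) n \<times> V"
    proof clarify
      fix u assume u: "u \<in> live b (occ w) (n + length w)"
      have split: "take n u \<in> words b" "drop n u \<in> words b"
        using u append_take_drop_id [of n u] append_in_words [of "take n u" "drop n u" b]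
        by (auto simp: live_def)
      have "occ w (take n u) \<le> occ w u"
        using unit_steps_mono [OF unit_steps_occ [OF assms(1)], of "take n u" "drop n u"] by simp
      then have "take n u \<in> live b (occ w) n"
        using u split by (auto simp: live_def)
      moreover have "drop n u \<noteq> w"
        using occ_suffix_pos [OF assms(1), of u] suffix_drop [of n u] u by (auto simp: live_def)
      ultimately show "take n u \<in> live b (occ w) n \<and> drop n u \<in> V"
        using u split by (auto simp: V_def live_def)
    qed
  qed (simp add: V finite_live)
  then show ?thesis
    by (simp add: V card_cartesian_product)
qed

lemma live_occ_tendsto_0:
  assumes "b > 1" "w \<noteq> []" "w \<in> words b"
  shows "(\<lambda>n. real (card (live b (occ w) n)) / real b ^ n) \<longlonglongrightarrow> 0"
proof -
  define p where "p = length w"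
  \<comment> \<open>Each further block of \<open>p\<close> digits multiplies the proportion of words
    avoiding \<open>w\<close> by at most \<open>q\<close>.\<close>
  define q where "q = 1 - 1 / real b ^ p"
  have p: "p > 0"
    using assms by (simp add: p_def)
  have bp: "real b ^ p \<ge> 1"
    using assms(1) by simp
  have q: "0 \<le> q" "q < 1"
    using bp assms(1) by (auto simp: q_def field_simps)
  have step: "real (card (live b (occ w) (n + p))) / real b ^ (n + p)
      \<le> q * (real (card (live b (occ w) n)) / real b ^ n)" for n
  proof -
    have "real (card (live b (occ w) (n + p))) \<le> real (card (live b (occ w) n) * (b ^ p - 1))"
      using card_live_occ_add [OF assms(2,3), of n] unfolding p_def by (rule of_nat_mono)
    also have "\<dots> = real (card (live b (occ w) n)) * (real b ^ p - 1)"
      using assms(1) by (simp add: of_nat_diff)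
    also have "real b ^ p - 1 = real b ^ p * q"
      using assms(1) by (simp add: q_def field_simps)
    finally have "real (card (live b (occ w) (n + p))) / real b ^ (n + p)
        \<le> (real (card (live b (occ w) n)) * (real b ^ p * q)) / real b ^ (n + p)"
      by (rule divide_right_mono) simp
    also have "\<dots> = q * (real (card (live b (occ w) n)) / real b ^ n)"
      using assms(1) by (simp add: power_add)
    finally show ?thesis .
  qed
  have bound: "real (card (live b (occ w) n)) / real b ^ n \<le> q ^ (n div p)" for n
  proof (induction n rule: less_induct)
    case (less n)
    show ?case
    proof (cases "n < p")
      case True
      have "card (live b (occ w) n) \<le> card {u \<in> words b. length u = n}"
        by (rule card_mono [OF finite_words]) (auto simp: live_def)
      then have "real (card (live b (occ w) n)) \<le> real (b ^ n)"
        unfolding card_words by (rule of_nat_mono)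
      then show ?thesis
        using True assms(1) by (simp add: field_simps)
    next
      case False
      then have "real (card (live b (occ w) n)) / real b ^ n
          \<le> q * (real (card (live b (occ w) (n - p))) / real b ^ (n - p))"
        using step [of "n - p"] by simp
      also have "\<dots> \<le> q * q ^ ((n - p) div p)"
        using less [of "n - p"] p False q by (intro mult_left_mono) auto
      also have "\<dots> = q ^ (n div p)"
        using False p by (simp add: le_div_geq)
      finally show ?thesis .
    qed
  qed
  have "filterlim (\<lambda>n. n div p) at_top at_top"
    using filterlim_at_top_div_const_nat p by blast
  then have "(\<lambda>n. q ^ (n div p)) \<longlonglongrightarrow> 0"
    using LIMSEQ_realpow_zero [OF q] filterlim_compose by blast
  then show ?thesis
    by (rule Lim_null_comparison [rotated]) (use bound in auto)
qed

lemma live_tendsto_0: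
  assumes "b > 1" "w \<noteq> []" "w \<in> words b" and le: "\<And>u. occ w u \<le> c u"
  shows "(\<lambda>n. real (card (live b c n)) / real b ^ n) \<longlonglongrightarrow> 0"
proof (rule Lim_null_comparison [OF always_eventually live_occ_tendsto_0 [OF assms(1-3)]], intro allI)
  fix n
  have "live b c n \<subseteq> live b (occ w) n"
    using le by (auto simp: live_def) (metis le_zero_eq)
  then show "norm (real (card (live b c n)) / real b ^ n) \<le> real (card (live b (occ w) n)) / real b ^ n"
    using card_mono [OF finite_live, of "live b c n" b "occ w" n] by (simp add: divide_right_mono)
qed

text \<open>Conservation of mass in the digit tree: a live word hands its value down to its b
  children, each of which is live or has just reached the count 1. Passed mass plus live mass stays
  \<open>h []\<close>.\<close>

lemma first_passage_partial_sum:
  fixes h :: "nat list \<Rightarrow> real"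
  assumes c: "unit_steps c"
    and add: "\<And>u. u \<in> words b \<Longrightarrow> c u = 0 \<Longrightarrow> h u = (\<Sum>d<b. h (u @ [d]))"
  shows "(\<Sum>g\<in>{g \<in> first_passage b c. length g \<le> N}. h g) + (\<Sum>u\<in>live b c N. h u) = h []"
proof (induction N)
  case 0
  have "(\<Sum>g\<in>{g \<in> first_passage b c. length g \<le> 0}. h g) = 0"
    by (rule sum.neutral) (auto simp: first_passage_def)
  moreover have "live b c 0 = {[]}"
    using c by (auto simp: live_def unit_steps_def)
  ultimately show ?case
    by simp
next
  case (Suc N)
  have fin: "finite {g \<in> first_passage b c. P g \<and> length g \<le> n}" for n P
    by (rule finite_subset [OF _ finite_words_le [of b n]]) (auto simp: first_passage_def)
  have fin': "finite {g \<in> first_passage b c. length g = n}" for n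
    by (rule finite_subset [OF _ finite_words_le [of b n]]) (auto simp: first_passage_def)
  have eq1: "{g \<in> first_passage b c. length g \<le> Suc N}
      = {g \<in> first_passage b c. length g \<le> N} \<union> {g \<in> first_passage b c. length g = Suc N}"
    by auto
  have img: "(\<lambda>(u, d). u @ [d]) ` (live b c N \<times> {..<b})
      = live b c (Suc N) \<union> {g \<in> first_passage b c. length g = Suc N}"
  proof (intro set_eqI iffI)
    fix v assume "v \<in> (\<lambda>(u, d). u @ [d]) ` (live b c N \<times> {..<b})"
    then obtain u d where v: "v = u @ [d]" "u \<in> words b" "length u = N" "c u = 0" "d < b"
      by (auto simp: live_def)
    then have "c v = 0 \<or> c v = 1"
      using c unfolding unit_steps_def by (metis One_nat_def)
    then show "v \<in> live b c (Suc N) \<union> {g \<in> first_passage b c. length g = Suc N}"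
      using v by (auto simp: live_def first_passage_def)
  next
    fix v assume v: "v \<in> live b c (Suc N) \<union> {g \<in> first_passage b c. length g = Suc N}"
    then have "length v = Suc N"
      by (auto simp: live_def)
    then obtain u d where u: "v = u @ [d]"
      by (cases v rule: rev_cases) auto
    moreover have "c u = 0"
      using v unit_steps_mono [OF c, of u "[d]"] unfolding u by (auto simp: live_def first_passage_def)
    ultimately show "v \<in> (\<lambda>(u, d). u @ [d]) ` (live b c N \<times> {..<b})"
      using v \<open>length v = Suc N\<close>
      by (intro image_eqI [of _ _ "(u, d)"]) (auto simp: live_def first_passage_def)
  qed
  have "(\<Sum>u\<in>live b c N. h u) = (\<Sum>u\<in>live b c N. \<Sum>d<b. h (u @ [d]))"
    by (intro sum.cong refl add) (auto simp: live_def)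
  also have "\<dots> = (\<Sum>(u, d)\<in>live b c N \<times> {..<b}. h (u @ [d]))"
    by (rule sum.cartesian_product)
  also have "\<dots> = (\<Sum>v\<in>(\<lambda>(u, d). u @ [d]) ` (live b c N \<times> {..<b}). h v)"
    by (subst sum.reindex) (auto simp: inj_on_def case_prod_beta)
  also have "\<dots> = (\<Sum>v\<in>live b c (Suc N). h v) + (\<Sum>g | g \<in> first_passage b c \<and> length g = Suc N. h g)"
    unfolding img
    by (rule sum.union_disjoint) (auto simp: finite_live fin' , auto simp: live_def first_passage_def)
  finally have "(\<Sum>u\<in>live b c N. h u)
      = (\<Sum>v\<in>live b c (Suc N). h v) + (\<Sum>g | g \<in> first_passage b c \<and> length g = Suc N. h g)" .
  moreover have "(\<Sum>g\<in>{g \<in> first_passage b c. length g \<le> Suc N}. h g)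
      = (\<Sum>g\<in>{g \<in> first_passage b c. length g \<le> N}. h g)
        + (\<Sum>g | g \<in> first_passage b c \<and> length g = Suc N. h g)"
    unfolding eq1 using fin [of "\<lambda>_. True" N] fin' by (intro sum.union_disjoint) auto
  ultimately show ?case
    using Suc by simp
qed

lemma finite_first_passage_le: "finite {g \<in> first_passage b c. length g \<le> N}"
  by (rule finite_subset [OF _ finite_words_le [of b N]]) (auto simp: first_passage_def)

text \<open>Kraft's inequality: the weight is additive over children and is 1 at the root, and the
  live mass is nonnegative.\<close>

lemma first_passage_weight_summable:
  assumes "b > 1" and c: "unit_steps c"
  shows "(\<lambda>g. 1 / real b ^ length g) summable_on first_passage b c"
proof (rule summable_on_exhaust [where l = length and C = 1])
  fix N
  have "(\<Sum>g\<in>{g \<in> first_passage b c. length g \<le> N}. 1 / real b ^ length g)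
      + (\<Sum>u\<in>live b c N. 1 / real b ^ length u) = 1 / real b ^ length ([] :: nat list)"
    by (rule first_passage_partial_sum [OF c]) (use assms(1) in simp)
  moreover have "(\<Sum>u\<in>live b c N. 1 / real b ^ length u) \<ge> 0"
    by (rule sum_nonneg) simp
  ultimately show "(\<Sum>g\<in>{g \<in> first_passage b c. length g \<le> N}. 1 / real b ^ length g) \<le> 1"
    by simp
qed (auto simp: finite_first_passage_le)

text \<open>A quantity that splits additively over the children of a word is, at the root of the digit
  tree, the sum over the first passage words: these cut every branch, except for a set of branches
  whose weight vanishes in the limit.\<close>

lemma first_passage_has_sum:
  fixes h :: "nat list \<Rightarrow> real"
  assumes "b > 1" and c: "unit_steps c"
    and lim: "(\<lambda>n. real (card (live b c n)) / real b ^ n) \<longlonglongrightarrow> 0"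
    and add: "\<And>u. u \<in> words b \<Longrightarrow> c u = 0 \<Longrightarrow> h u = (\<Sum>d<b. h (u @ [d]))"
    and bound: "\<And>u. u \<in> words b \<Longrightarrow> \<bar>h u\<bar> \<le> C / real b ^ length u"
  shows "(h has_sum h []) (first_passage b c)"
proof (rule has_sum_exhaust [where l = length])
  have "(\<lambda>g. C * (1 / real b ^ length g)) summable_on first_passage b c"
    using first_passage_weight_summable [OF assms(1) c] by (rule summable_on_cmult_right)
  then have "(\<lambda>g. norm (h g)) summable_on first_passage b c"
    by (rule Infinite_Sum.abs_summable_on_comparison_test') (use bound first_passage_words in auto)
  then show "h summable_on first_passage b c"
    using summable_on_iff_abs_summable_on_real by blast
  have "(\<lambda>N. \<Sum>u\<in>live b c N. h u) \<longlonglongrightarrow> 0"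
  proof (rule Lim_null_comparison [OF always_eventually], intro allI)
    fix N
    have "norm (\<Sum>u\<in>live b c N. h u) \<le> (\<Sum>u\<in>live b c N. C / real b ^ N)"
      by (rule sum_norm_le) (use bound in \<open>auto simp: live_def\<close>)
    then show "norm (\<Sum>u\<in>live b c N. h u) \<le> real (card (live b c N)) / real b ^ N * C"
      by simp
    show "(\<lambda>N. real (card (live b c N)) / real b ^ N * C) \<longlonglongrightarrow> 0"
      using lim by (rule tendsto_mult_left_zero)
  qed
  then have "(\<lambda>N. h [] - (\<Sum>u\<in>live b c N. h u)) \<longlonglongrightarrow> h []"
    using tendsto_diff [OF tendsto_const [of "h []"]] by fastforce
  moreover have "(\<Sum>g\<in>{g \<in> first_passage b c. length g \<le> N}. h g) = h [] - (\<Sum>u\<in>live b c N. h u)" for N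
    using first_passage_partial_sum [OF c add, of N] by simp
  ultimately show "(\<lambda>N. \<Sum>g\<in>{g \<in> first_passage b c. length g \<le> N}. h g) \<longlonglongrightarrow> h []"
    by simp
qed (simp add: finite_first_passage_le)

text \<open>A word containing \<open>w\<close> is cut at its last occurrence. The remainder creates
  no occurrence behind this \<open>w\<close>, which is the defining condition of
  \<open>lang_R\<close>.\<close>

lemma bij_betw_last_occ:
  assumes "w \<noteq> []" "w \<in> words b"
  shows "bij_betw (\<lambda>(r, u). u @ w @ r)
    (SIGMA r:{r \<in> lang_R b w. length r \<le> n}. {u \<in> words b. length u = n - length r})
    {v \<in> words b. length v = n + length w \<and> occ w v > 0}"
proof (rule bij_betw_imageI)
  \<comment> \<open>A shifted copy of \<open>w\<close> inside \<open>w @ r\<close> would be a second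
    occurrence; this makes the cut unique.\<close>
  have key: "t = []" if r: "r \<in> lang_R b w" and eq: "w @ r = t @ w @ s" for r s t
  proof (rule ccontr)
    assume t: "t \<noteq> []"
    have "occ w (t @ w @ s) = 1"
      using r eq occ_prefix_self [OF assms(1), of r] by (simp add: lang_R_def)
    then have le: "occ w (t @ w) \<le> 1"
      using unit_steps_mono [OF unit_steps_occ [OF assms(1)], of "t @ w" s] by simp
    have "length w \<le> length (t @ w)"
      by simp
    then obtain x where x: "t @ w = w @ x"
      using eq by (metis append.assoc append_eq_append_conv_if append_take_drop_id)
    with t have "x \<noteq> []"
      by auto
    then obtain y d where y: "x = y @ [d]"
      by (cases x rule: rev_cases) auto
    have "suffix w (w @ y @ [d])"
      using x y by (metis suffixI)
    then have "occ_after w (y @ [d]) \<ge> 1"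
      using occ_after_snoc [OF assms(1), of y d] by simp
    then show False
      using le occ_prefix_self [OF assms(1), of x] by (simp add: x y)
  qed
  show "inj_on (\<lambda>(r, u). u @ w @ r)
    (SIGMA r:{r \<in> lang_R b w. length r \<le> n}. {u \<in> words b. length u = n - length r})"
  proof (rule inj_onI, clarify)
    fix r u s v
    assume A: "r \<in> lang_R b w" "s \<in> lang_R b w" "u @ w @ r = v @ w @ s"
    then obtain t where "u = v @ t \<and> t @ w @ r = w @ s \<or> u @ t = v \<and> w @ r = t @ w @ s"
      using append_eq_append_conv2 [THEN iffD1] by blast
    then have "t = []"
      using key [of r t s] key [of s t r] A by metis
    then show "r = s \<and> u = v"
      using A(3) \<open>u = v @ t \<and> t @ w @ r = w @ s \<or> u @ t = v \<and> w @ r = t @ w @ s\<close> by auto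
  qed
  have ex: "\<exists>u r. v = u @ w @ r \<and> occ_after w r = 0" if "occ w v > 0" for v
    using that
  proof (induction v rule: rev_induct)
    case Nil
    then show ?case using assms(1) by simp
  next
    case (snoc d v)
    show ?case
    proof (cases "suffix w (v @ [d])")
      case True
      then obtain u where "v @ [d] = u @ w"
        by (auto simp: suffix_def)
      then show ?thesis
        by (intro exI [of _ u] exI [of _ "[]"]) simp
    next
      case False
      then have "occ w v > 0"
        using snoc.prems occ_snoc [OF assms(1), of v d] by (simp del: suffix_snoc)
      then obtain u r where v: "v = u @ w @ r" "occ_after w r = 0"
        using snoc.IH by blast
      have "\<not> suffix w (w @ r @ [d])"
        using False suffix_append_left_iff [of w "w @ r @ [d]" u] by (simp add: v del: suffix_snoc)
      then have "occ_after w (r @ [d]) = 0"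
        using v occ_after_snoc [OF assms(1), of r d] by (simp del: suffix_snoc)
      then show ?thesis
        using v by (intro exI [of _ u] exI [of _ "r @ [d]"]) simp
    qed
  qed
  show "(\<lambda>(r, u). u @ w @ r) `
      (SIGMA r:{r \<in> lang_R b w. length r \<le> n}. {u \<in> words b. length u = n - length r})
    = {v \<in> words b. length v = n + length w \<and> occ w v > 0}"
  proof safe
    fix v
    assume v: "v \<in> words b" "length v = n + length w" "occ w v > 0"
    then obtain u r where "v = u @ w @ r" "occ_after w r = 0"
      using ex by blast
    with v show "v \<in> (\<lambda>(r, u). u @ w @ r) `
      (SIGMA r:{r \<in> lang_R b w. length r \<le> n}. {u \<in> words b. length u = n - length r})"
      by (intro image_eqI [of _ _ "(r, u)"]) (auto simp: lang_R_def)
  next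
    fix r u
    assume "r \<in> lang_R b w"
    show "occ w (u @ w @ r) > 0"
      using occ_append [OF assms(1), of u r] occ_suffix_pos [OF assms(1), of "u @ w"]
      by (simp add: suffix_def)
  qed (use assms(2) in \<open>auto simp: lang_R_def\<close>)
qed

text \<open>The words of length \<open>n + length w\<close> that contain \<open>w\<close> are
  counted by their last occurrence, as a sum of \<open>b ^ (n - length r)\<close>. Division by
  \<open>b ^ n\<close> leaves \<open>b ^ length w\<close>, up to a multiple of the vanishing
  proportion of words avoiding \<open>w\<close>.\<close>

lemma lang_R_has_sum:
  assumes "b > 1" "w \<noteq> []" "w \<in> words b"
  shows "((\<lambda>r. 1 / real b ^ length r) has_sum real b ^ length w) (lang_R b w)"
proof -
  define a where "a n = real (card (live b (occ w) n)) / real b ^ n" for n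
  have fin: "finite {r \<in> lang_R b w. length r \<le> n}" for n
    by (rule finite_subset [OF _ finite_words_le [of b n]]) (auto simp: lang_R_def)
  have part: "(\<Sum>r\<in>{r \<in> lang_R b w. length r \<le> n}. 1 / real b ^ length r)
      = real b ^ length w - real b ^ length w * a (n + length w)" for n
  proof -
    let ?m = "n + length w"
    have "card {v \<in> words b. length v = ?m \<and> occ w v > 0}
        = card (SIGMA r:{r \<in> lang_R b w. length r \<le> n}. {u \<in> words b. length u = n - length r})"
      using bij_betw_same_card [OF bij_betw_last_occ [OF assms(2,3), of n]] by simp
    also have "\<dots> = (\<Sum>r\<in>{r \<in> lang_R b w. length r \<le> n}. b ^ (n - length r))"
      using fin by (subst card_SigmaI) (auto simp: finite_words card_words)
    finally have 1: "card {v \<in> words b. length v = ?m \<and> occ w v > 0}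
        = (\<Sum>r\<in>{r \<in> lang_R b w. length r \<le> n}. b ^ (n - length r))" .
    have "{v \<in> words b. length v = ?m} = live b (occ w) ?m \<union> {v \<in> words b. length v = ?m \<and> occ w v > 0}"
      by (auto simp: live_def)
    then have "b ^ ?m = card (live b (occ w) ?m \<union> {v \<in> words b. length v = ?m \<and> occ w v > 0})"
      by (metis card_words)
    also have "\<dots> = card (live b (occ w) ?m) + card {v \<in> words b. length v = ?m \<and> occ w v > 0}"
      by (rule card_Un_disjoint)
        (auto simp: finite_live live_def intro: finite_subset [OF _ finite_words [of b ?m]])
    finally have "real (b ^ ?m) = real (card (live b (occ w) ?m)
        + (\<Sum>r\<in>{r \<in> lang_R b w. length r \<le> n}. b ^ (n - length r)))"
      unfolding 1 by simp
    then have 2: "real b ^ ?m = real (card (live b (occ w) ?m))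
        + (\<Sum>r\<in>{r \<in> lang_R b w. length r \<le> n}. real b ^ (n - length r))"
      by simp
    have "(\<Sum>r\<in>{r \<in> lang_R b w. length r \<le> n}. 1 / real b ^ length r)
        = (\<Sum>r\<in>{r \<in> lang_R b w. length r \<le> n}. real b ^ (n - length r)) / real b ^ n"
      unfolding sum_divide_distrib
      by (intro sum.cong refl) (use assms(1) in \<open>auto simp: power_diff field_simps\<close>)
    also have "\<dots> = (real b ^ ?m - real (card (live b (occ w) ?m))) / real b ^ n"
      using 2 by simp
    also have "\<dots> = real b ^ length w - real b ^ length w * a ?m"
      using assms(1) by (simp add: a_def power_add field_simps)
    finally show ?thesis .
  qed
  have "a \<longlonglongrightarrow> 0"
    unfolding a_def using live_occ_tendsto_0 [OF assms] .
  then have "(\<lambda>n. a (n + length w)) \<longlonglongrightarrow> 0"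
    by (rule LIMSEQ_ignore_initial_segment)
  then have "(\<lambda>n. real b ^ length w - real b ^ length w * a (n + length w))
      \<longlonglongrightarrow> real b ^ length w - real b ^ length w * 0"
    by (intro tendsto_intros)
  then have lim: "(\<lambda>n. \<Sum>r\<in>{r \<in> lang_R b w. length r \<le> n}. 1 / real b ^ length r) \<longlonglongrightarrow> real b ^ length w"
    by (simp add: part)
  show ?thesis
  proof (rule has_sum_exhaust [OF summable_on_exhaust fin lim])
    show "(\<Sum>r\<in>{r \<in> lang_R b w. length r \<le> n}. 1 / real b ^ length r) \<le> real b ^ length w" for n
      by (simp add: part a_def)
  qed (auto simp: fin)
qed

section \<open>The return operator on polynomials\<close>

lemma coeff_pcompose_affine:
  fixes p :: "real poly"
  shows "coeff (pcompose p [:a, c:]) k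
    = (\<Sum>n\<le>degree p. coeff p n * (real (n choose k) * c ^ k * a ^ (n - k)))"
proof -
  have lin: "coeff ([:a, c:] ^ n) k = real (n choose k) * c ^ k * a ^ (n - k)" for n
  proof (cases "k \<le> n")
    case False
    have "degree ([:a, c:] ^ n) \<le> degree [:a, c:] * n"
      by (rule degree_power_le)
    also have "\<dots> \<le> n"
      by simp
    finally show ?thesis
      using False by (simp add: coeff_eq_0 binomial_eq_0)
  qed (rule coeff_linear_poly_power)
  have pow: "pcompose ([:0, 1:] ^ n) r = r ^ n" for n and r :: "real poly"
    by (induction n) (simp_all add: pcompose_mult pcompose_1 pcompose_pCons)
  have "pcompose p [:a, c:] = pcompose (\<Sum>n\<le>degree p. smult (coeff p n) ([:0, 1:] ^ n)) [:a, c:]"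
    using poly_as_sum_of_monoms [of p] by (simp add: monom_altdef)
  also have "\<dots> = (\<Sum>n\<le>degree p. smult (coeff p n) ([:a, c:] ^ n))"
    by (simp only: pcompose_sum pcompose_smult pow)
  finally show ?thesis
    by (simp only: coeff_sum coeff_smult lin)
qed

lemma has_sum_finite_sum:
  fixes f :: "'i \<Rightarrow> 'a \<Rightarrow> real"
  assumes "\<And>i. i \<in> I \<Longrightarrow> (f i has_sum s i) A"
  shows "((\<lambda>x. \<Sum>i\<in>I. f i x) has_sum (\<Sum>i\<in>I. s i)) A"
  using assms
proof (induction I rule: infinite_finite_induct)
  case (insert i I)
  then show ?case
    by (simp add: has_sum_add)
qed simp_all

text \<open>On polynomials a linear functional is a finite sum over coefficients, so it commutes
  with sums over \<open>G\<close> without any continuity. \<open>K_functional\<close> exploits this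
  for evaluation, recentered coefficients, integrals and dual functionals alike.\<close>

definition poly_functional :: "(real poly \<Rightarrow> real) \<Rightarrow> bool"
  where "poly_functional \<Lambda> \<longleftrightarrow>
    (\<forall>p q. \<Lambda> (p + q) = \<Lambda> p + \<Lambda> q) \<and> (\<forall>c p. \<Lambda> (smult c p) = c * \<Lambda> p)"

lemma poly_functional_sum:
  assumes "poly_functional \<Lambda>"
  shows "\<Lambda> (\<Sum>i\<in>A. f i) = (\<Sum>i\<in>A. \<Lambda> (f i))"
proof (induction A rule: infinite_finite_induct)
  have "\<Lambda> (smult 0 0) = 0 * \<Lambda> 0"
    using assms unfolding poly_functional_def by blast
  then have 0: "\<Lambda> 0 = 0"
    by simp
  {
    case (infinite A)
    then show ?case by (simp add: 0)
  next
    case empty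
    then show ?case by (simp add: 0)
  next
    case (insert x A)
    then show ?case
      using assms by (simp add: poly_functional_def)
  }
qed

lemma poly_functional_expand:
  assumes "poly_functional \<Lambda>" "degree p \<le> d"
  shows "\<Lambda> p = (\<Sum>k\<le>d. coeff p k * \<Lambda> (monom 1 k))"
proof -
  have "p = (\<Sum>k\<le>d. smult (coeff p k) (monom 1 k))"
    using poly_as_sum_of_monoms' [OF assms(2)] by (simp add: smult_monom)
  then have "\<Lambda> p = (\<Sum>k\<le>d. \<Lambda> (smult (coeff p k) (monom 1 k)))"
    using poly_functional_sum [OF assms(1)] by metis
  then show ?thesis
    using assms(1) by (simp add: poly_functional_def)
qed

lemma poly_functional_poly: "poly_functional (\<lambda>p. poly p x)"
  by (simp add: poly_functional_def)

lemma word_frac_append: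
  assumes "b > 0"
  shows "word_frac b (g @ r) = word_frac b g + word_frac b r / real b ^ length g"
  using assms by (simp add: word_frac_def word_int_append power_add field_simps)

lemma word_frac_nonneg: "word_frac b g \<ge> 0"
  by (simp add: word_frac_def)

lemma word_frac_le:
  assumes "b > 0" "g \<in> words b"
  shows "word_frac b g + 1 / real b ^ length g \<le> 1"
proof -
  have "real (word_int b g + 1) \<le> real (b ^ length g)"
    using word_int_less [OF assms(2)] by (intro of_nat_mono) simp
  then show ?thesis
    using assms(1) by (simp add: word_frac_def field_simps)
qed

section \<open>Branch maps and eigenvalues\<close>

locale return_words =
  fixes b :: nat and w :: "nat list"
  assumes b_gt: "b > 1" and w_ne: "w \<noteq> []" and w_words: "w \<in> words b"
begin

abbreviation wt :: "nat list \<Rightarrow> real"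
  where "wt g \<equiv> 1 / real b ^ length g"

definition phi :: "nat list \<Rightarrow> real \<Rightarrow> real"
  where "phi g x = word_frac b g + wt g * x"

abbreviation lm :: "nat \<Rightarrow> real"
  where "lm \<equiv> lam b w"

abbreviation G :: "nat list set"
  where "G \<equiv> lang_G b w"

lemma wt_pos: "wt g > 0"
  using b_gt by simp

lemma wt_le_1: "wt g \<le> 1"
  using b_gt by simp

lemma wt_append: "wt (g @ h) = wt g * wt h"
  by (simp add: power_add)

lemma wt_le: "g \<noteq> [] \<Longrightarrow> wt g \<le> 1 / real b"
proof -
  assume "g \<noteq> []"
  then have "real b ^ 1 \<le> real b ^ length g"
    using b_gt by (intro power_increasing) (cases g, auto)
  then show ?thesis
    using b_gt by (simp add: field_simps)
qed

lemma phi_append: "phi (g @ h) x = phi g (phi h x)"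
  using b_gt by (simp add: phi_def word_frac_append power_add algebra_simps)

lemma word_frac_append': "word_frac b (g @ r) = phi g (word_frac b r)"
  using b_gt by (simp add: phi_def word_frac_append)

lemma phi_in: "g \<in> words b \<Longrightarrow> x \<in> {0..1} \<Longrightarrow> phi g x \<in> {0..1}"
  using word_frac_nonneg [of b g] word_frac_le [of b g] b_gt mult_left_le [of x "wt g"]
  by (auto simp: phi_def)

lemma word_frac_in: "g \<in> words b \<Longrightarrow> word_frac b g \<in> {0..1}"
  using phi_in [of g 0] by (simp add: phi_def)

lemma G_words: "g \<in> G \<Longrightarrow> g \<in> words b"
  by (simp add: lang_G_def)

lemma G_ne: "g \<in> G \<Longrightarrow> g \<noteq> []"
  by (simp add: lang_G_def)

lemma G_has_sum:
  assumes "\<And>u. u \<in> words b \<Longrightarrow> occ_after w u = 0 \<Longrightarrow> h u = (\<Sum>d<b. h (u @ [d]))"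
    and "\<And>u. u \<in> words b \<Longrightarrow> \<bar>h u\<bar> \<le> C / real b ^ length u"
  shows "(h has_sum h []) G"
  unfolding lang_G_eq
  by (rule first_passage_has_sum [OF b_gt unit_steps_occ_after [OF w_ne] live_tendsto_0
        [OF b_gt w_ne w_words occ_le_occ_after [OF w_ne]] assms])

text \<open>Almost every infinite digit sequence contains a return, and the root has weight 1; this
  is the source of \<open>lm 1 = 1\<close>.\<close>

lemma wt_has_sum: "(wt has_sum 1) G"
  using G_has_sum [of wt 1] b_gt by simp

lemma wt_power: "1 / real b ^ (j * length g) = wt g ^ j"
  by (simp add: power_one_over mult.commute flip: power_mult)

lemma wt_power_summable:
  assumes "j \<ge> 1"
  shows "(\<lambda>g. wt g ^ j) summable_on G"
proof (rule summable_on_comparison_test [OF has_sum_imp_summable [OF wt_has_sum]])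
  fix g
  show "wt g ^ j \<le> wt g"
    using power_decreasing [OF assms, of "wt g"] wt_le_1 [of g] b_gt by simp
qed simp

lemma lam_has_sum: "j \<ge> 1 \<Longrightarrow> ((\<lambda>g. wt g ^ j) has_sum lm j) G"
  using wt_power_summable [of j] unfolding lam_def wt_power by simp

lemma lam_1: "lm 1 = 1"
  using lam_has_sum [of 1] wt_has_sum by (auto dest: has_sum_unique)

lemma G_nonempty: "G \<noteq> {}"
proof
  assume "G = {}"
  then have "(wt has_sum 1) {}"
    using wt_has_sum by simp
  then show False
    using has_sum_unique [OF has_sum_empty] by fastforce
qed

lemma wt_power_le_lam: "j \<ge> 1 \<Longrightarrow> g \<in> G \<Longrightarrow> wt g ^ j \<le> lm j"
  using finite_sum_le_has_sum [OF lam_has_sum, of j "{g}"] by simp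

lemma lam_pos:
  assumes "j \<ge> 1"
  shows "lm j > 0"
proof -
  obtain g where "g \<in> G"
    using G_nonempty by auto
  then have "wt g ^ j \<le> lm j"
    by (rule wt_power_le_lam [OF assms])
  moreover have "wt g ^ j > 0"
    using wt_pos by (rule zero_less_power)
  ultimately show ?thesis
    by linarith
qed

text \<open>Return words are nonempty, so one more power of the weight costs at least a factor b.
  Strict decrease and geometric convergence to 0 both rest on this.\<close>

lemma lam_Suc_le:
  assumes "j \<ge> 1"
  shows "lm (Suc j) \<le> lm j / real b"
proof -
  have "((\<lambda>g. 1 / real b * wt g ^ j) has_sum 1 / real b * lm j) G"
    by (rule has_sum_cmult_right [OF lam_has_sum [OF assms]])
  moreover have "wt g ^ Suc j \<le> 1 / real b * wt g ^ j" if "g \<in> G" for g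
    using mult_right_mono [OF wt_le [OF G_ne [OF that]], of "wt g ^ j"] by simp
  ultimately show ?thesis
    using has_sum_mono [OF lam_has_sum [of "Suc j"]] by fastforce
qed

lemma lam_Suc_less:
  assumes "j \<ge> 1"
  shows "lm (Suc j) < lm j"
proof -
  have "lm j / real b < lm j"
    using lam_pos [OF assms] b_gt by (simp add: divide_less_eq)
  then show ?thesis
    using lam_Suc_le [OF assms] by simp
qed

lemma lam_add_le: "j \<ge> 1 \<Longrightarrow> lm (j + i) \<le> lm j / real b ^ i"
proof (induction i)
  case (Suc i)
  have "lm (j + Suc i) \<le> lm (j + i) / real b"
    using lam_Suc_le [of "j + i"] Suc.prems by simp
  also have "\<dots> \<le> (lm j / real b ^ i) / real b"
    using Suc by (intro divide_right_mono) auto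
  finally show ?case
    by (simp add: mult.commute)
qed simp

lemma lam_less: "1 \<le> i \<Longrightarrow> i < j \<Longrightarrow> lm j < lm i"
proof (induction j)
  case (Suc j)
  then show ?case
    using lam_Suc_less [of j] by (cases "i = j") force+
qed simp

lemma lam_tendsto_0: "lm \<longlonglongrightarrow> 0"
proof (rule LIMSEQ_imp_Suc, rule Lim_null_comparison [OF always_eventually], intro allI)
  fix n
  show "norm (lm (Suc n)) \<le> (1 / real b) ^ n"
    using lam_add_le [of 1 n] lam_pos [of "Suc n"] lam_1 by (simp add: power_one_over)
  show "(\<lambda>n. (1 / real b) ^ n) \<longlonglongrightarrow> 0"
    using b_gt by (intro LIMSEQ_realpow_zero) auto
qed

lemma lam_eq_gf: "lm j = gf_G b w (1 / real b ^ j)"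
  unfolding lam_def gf_G_def
  by (intro infsum_cong) (simp add: power_one_over flip: power_mult)

lemma gf_sums:
  assumes "j \<ge> 1"
  shows "(\<lambda>n. real (card {g \<in> G. length g = n}) * (1 / real b ^ j) ^ n) sums gf_G b w (1 / real b ^ j)"
proof -
  define t where "t = 1 / real b ^ j"
  have "((\<lambda>g. t ^ length g) has_sum lm j) G"
    using lam_has_sum [OF assms] by (simp add: t_def power_one_over mult.commute flip: power_mult)
  moreover have "bij_betw (\<lambda>(n, g). g) (SIGMA n:UNIV. {g \<in> G. length g = n}) G"
    by (rule bij_betwI [where g = "\<lambda>g. (length g, g)"]) auto
  ultimately have "((\<lambda>(n, g). t ^ length g) has_sum lm j) (SIGMA n:UNIV. {g \<in> G. length g = n})"
    by (subst (asm) has_sum_reindex_bij_betw [symmetric]) (auto simp: case_prod_unfold)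
  then have "((\<lambda>n. real (card {g \<in> G. length g = n}) * t ^ n) has_sum lm j) UNIV"
  proof (rule has_sum_SigmaD)
    fix n
    have "finite {g \<in> G. length g = n}"
      by (rule finite_subset [OF _ finite_words [of b n]]) (auto simp: lang_G_def)
    then show "((\<lambda>g. case (n, g) of (n, g) \<Rightarrow> t ^ length g) has_sum real (card {g \<in> G. length g = n}) * t ^ n)
        {g \<in> G. length g = n}"
      by (intro has_sum_finiteI) auto
  qed
  then show ?thesis
    using has_sum_imp_sums lam_eq_gf [of j] by (simp add: t_def)
qed

section \<open>The operator on polynomials is triangular\<close>

abbreviation branch :: "nat list \<Rightarrow> real poly \<Rightarrow> real poly"
  where "branch g q \<equiv> pcompose q [:word_frac b g, wt g:]"

lemma poly_branch: "poly (branch g q) x = poly q (phi g x)"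
  by (simp add: poly_pcompose phi_def mult.commute)

lemma degree_branch: "degree (branch g q) = degree q"
  using b_gt by (simp add: degree_pcompose)

text \<open>Uniformity in g makes the coefficientwise sums over \<open>G\<close> converge. The
  induction follows Horner's scheme: a branch map has coefficients in [0,1], so its shift and its
  linear term contribute \<open>M\<close> each.\<close>

lemma coeff_branch_bounded: "\<exists>M. \<forall>k. \<forall>g\<in>G. \<bar>coeff (branch g q) k\<bar> \<le> M"
proof (induction q)
  case 0
  then show ?case by auto
next
  case (pCons a q)
  then obtain M where M: "\<And>k g. g \<in> G \<Longrightarrow> \<bar>coeff (branch g q) k\<bar> \<le> M"
    by blast
  show ?case
  proof (intro exI [of _ "\<bar>a\<bar> + M + M"] allI ballI)
    fix k g assume g: "g \<in> G"
    have f: "\<bar>word_frac b g\<bar> \<le> 1" "\<bar>wt g\<bar> \<le> 1"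
      using word_frac_in [OF G_words [OF g]] wt_le_1 [of g] by auto
    have bound: "\<bar>c * coeff (branch g q) i\<bar> \<le> M" if "\<bar>c\<bar> \<le> 1" for c i
      using mult_mono [OF that M [OF g, of i]] by (simp add: abs_mult)
    have "0 \<le> M"
      using M [OF g, of 0] by linarith
    have "coeff (branch g (pCons a q)) k = coeff [:a:] k + word_frac b g * coeff (branch g q) k
        + (case k of 0 \<Rightarrow> 0 | Suc i \<Rightarrow> wt g * coeff (branch g q) i)"
      by (simp add: pcompose_pCons coeff_pCons split: nat.splits)
    moreover have "\<bar>coeff [:a:] k\<bar> \<le> \<bar>a\<bar>"
      by (simp add: coeff_pCons split: nat.splits)
    moreover have "\<bar>case k of 0 \<Rightarrow> 0 | Suc i \<Rightarrow> wt g * coeff (branch g q) i\<bar> \<le> M"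
      using bound [OF f(2)] \<open>0 \<le> M\<close> by (auto split: nat.splits)
    ultimately show "\<bar>coeff (branch g (pCons a q)) k\<bar> \<le> \<bar>a\<bar> + M + M"
      using bound [OF f(1), of k] by linarith
  qed
qed

text \<open>Acting on coefficients makes the image a polynomial by construction; affine substitution
  preserves the degree, hence the finite range of k.\<close>

definition K :: "real poly \<Rightarrow> real poly"
  where "K q = (\<Sum>k\<le>degree q. monom (\<Sum>\<^sub>\<infinity>g\<in>G. wt g * coeff (branch g q) k) k)"

lemma coeff_K_has_sum: "((\<lambda>g. wt g * coeff (branch g q) k) has_sum coeff (K q) k) G"
proof (cases "k \<le> degree q")
  case True
  obtain M where M: "\<And>k g. g \<in> G \<Longrightarrow> \<bar>coeff (branch g q) k\<bar> \<le> M"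
    using coeff_branch_bounded by blast
  have "(\<lambda>g. wt g * M) summable_on G"
    using summable_on_cmult_left [OF has_sum_imp_summable [OF wt_has_sum]] by blast
  then have "(\<lambda>g. norm (wt g * coeff (branch g q) k)) summable_on G"
    by (rule Infinite_Sum.abs_summable_on_comparison_test')
      (use M in \<open>simp add: abs_mult divide_right_mono\<close>)
  then have "(\<lambda>g. wt g * coeff (branch g q) k) summable_on G"
    using summable_on_iff_abs_summable_on_real by blast
  then have "((\<lambda>g. wt g * coeff (branch g q) k) has_sum (\<Sum>\<^sub>\<infinity>g\<in>G. wt g * coeff (branch g q) k)) G"
    by (rule has_sum_infsum)
  moreover have "coeff (K q) k = (\<Sum>\<^sub>\<infinity>g\<in>G. wt g * coeff (branch g q) k)"
    using True by (simp add: K_def coeff_sum)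
  ultimately show ?thesis
    by (simp only:)
next
  case False
  then have "coeff (branch g q) k = 0" for g
    using degree_branch [of q g] by (intro coeff_eq_0) simp
  moreover have "coeff (K q) k = 0"
    using False by (simp add: K_def coeff_sum)
  ultimately show ?thesis
    by simp
qed

lemma degree_K_le: "degree (K q) \<le> degree q"
  unfolding K_def by (rule degree_sum_le) (auto intro: order_trans [OF degree_monom_le])

lemma K_functional:
  assumes "poly_functional \<Lambda>"
  shows "((\<lambda>g. wt g * \<Lambda> (branch g q)) has_sum \<Lambda> (K q)) G"
proof -
  have "((\<lambda>g. \<Sum>k\<le>degree q. (wt g * coeff (branch g q) k) * \<Lambda> (monom 1 k)) has_sum
      (\<Sum>k\<le>degree q. coeff (K q) k * \<Lambda> (monom 1 k))) G"
    by (intro has_sum_finite_sum has_sum_cmult_left coeff_K_has_sum)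
  moreover have "(\<Sum>k\<le>degree q. coeff (K q) k * \<Lambda> (monom 1 k)) = \<Lambda> (K q)"
    by (rule poly_functional_expand [OF assms degree_K_le, symmetric])
  moreover have "(\<Sum>k\<le>degree q. (wt g * coeff (branch g q) k) * \<Lambda> (monom 1 k)) = wt g * \<Lambda> (branch g q)" for g
    using poly_functional_expand [OF assms, of "branch g q" "degree q"]
    by (simp add: degree_branch sum_distrib_left mult.assoc)
  ultimately show ?thesis
    by simp
qed

lemma poly_K_has_sum: "((\<lambda>g. wt g * poly q (phi g x)) has_sum poly (K q) x) G"
  using K_functional [OF poly_functional_poly, of q x] by (simp only: poly_branch)

lemma return_op_poly: "return_op b w (poly q) x = poly (K q) x"
  using infsumI [OF poly_K_has_sum [of q x]] by (simp add: return_op_def phi_def)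

lemma K_add: "K (p + q) = K p + K q"
proof (rule poly_eqI)
  fix k
  have "((\<lambda>g. wt g * coeff (branch g p) k + wt g * coeff (branch g q) k) has_sum
      (coeff (K p) k + coeff (K q) k)) G"
    by (intro has_sum_add coeff_K_has_sum)
  then show "coeff (K (p + q)) k = coeff (K p + K q) k"
    using coeff_K_has_sum [of "p + q" k] by (simp add: pcompose_add ring_distribs add_divide_distrib has_sum_unique)
qed

lemma K_smult: "K (smult c p) = smult c (K p)"
proof (rule poly_eqI)
  fix k
  have "((\<lambda>g. c * (wt g * coeff (branch g p) k)) has_sum (c * coeff (K p) k)) G"
    by (intro has_sum_cmult_right coeff_K_has_sum)
  then show "coeff (K (smult c p)) k = coeff (smult c (K p)) k"
    using coeff_K_has_sum [of "smult c p" k] by (simp add: pcompose_smult mult_ac has_sum_unique)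
qed

lemma K_diff: "K (p - q) = K p - K q"
  using K_add [of p "smult (-1) q"] K_smult [of "-1" q] by simp

text \<open>The diagonal of the triangular operator: a branch multiplies the leading coefficient by
  \<open>wt g ^ k\<close>, and the weight in the operator adds one more factor.\<close>

lemma coeff_K_top:
  assumes "degree q \<le> k"
  shows "coeff (K q) k = lm (Suc k) * coeff q k"
proof (cases "degree q = k")
  case True
  have "coeff (branch g q) k = coeff q k * wt g ^ k" for g
    using lead_coeff_comp [of "[:word_frac b g, wt g:]" q] degree_branch [of q g] b_gt True by simp
  then have "((\<lambda>g. wt g ^ Suc k * coeff q k) has_sum coeff (K q) k) G"
    using coeff_K_has_sum [of q k] by (simp add: mult_ac)
  moreover have "((\<lambda>g. wt g ^ Suc k * coeff q k) has_sum (lm (Suc k) * coeff q k)) G"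
    by (intro has_sum_cmult_left lam_has_sum) simp
  ultimately show ?thesis
    using has_sum_unique by blast
next
  case False
  then show ?thesis
    using assms degree_K_le [of q] by (simp add: coeff_eq_0)
qed

lemma K_eigen_degree:
  assumes "K q = smult (lm (Suc m)) q" "q \<noteq> 0"
  shows "degree q = m"
proof -
  have "lm (Suc m) * lead_coeff q = lm (Suc (degree q)) * lead_coeff q"
    using coeff_K_top [OF order_refl, of q] by (simp only: assms(1) coeff_smult)
  moreover have "lead_coeff q \<noteq> 0"
    using assms(2) by simp
  ultimately have "lm (Suc m) = lm (Suc (degree q))"
    using mult_right_cancel by blast
  then show ?thesis
    using lam_less [of "Suc m" "Suc (degree q)"] lam_less [of "Suc (degree q)" "Suc m"]
    by (cases "degree q" m rule: linorder_cases) auto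
qed

text \<open>Back substitution from the highest coefficient down. Below degree m the diagonal entries
  \<open>lm (Suc e) - lm (Suc m)\<close> are positive, so each step can divide by one.\<close>

lemma K_minus_lam_solvable:
  assumes "e \<le> m" "\<forall>k\<ge>e. coeff r k = 0"
  shows "\<exists>s. (\<forall>k\<ge>e. coeff s k = 0) \<and> K s - smult (lm (Suc m)) s = r"
  using assms
proof (induction e arbitrary: r)
  case 0
  then have "r = 0"
    by (simp add: poly_eq_iff)
  moreover have "K 0 = 0"
    using K_smult [of 0 0] by simp
  ultimately show ?case
    by (intro exI [of _ 0]) simp
next
  case (Suc e)
  define \<delta> where "\<delta> = lm (Suc e) - lm (Suc m)"
  define s\<^sub>1 where "s\<^sub>1 = monom (coeff r e / \<delta>) e"
  have \<delta>: "\<delta> > 0"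
    using lam_less [of "Suc e" "Suc m"] Suc.prems by (simp add: \<delta>_def)
  have deg: "degree s\<^sub>1 \<le> e"
    by (simp add: s\<^sub>1_def degree_monom_le)
  have "coeff (r - (K s\<^sub>1 - smult (lm (Suc m)) s\<^sub>1)) k = 0" if "k \<ge> e" for k
  proof (cases "k = e")
    case True
    have "coeff s\<^sub>1 e = coeff r e / \<delta>"
      by (simp add: s\<^sub>1_def)
    then have "\<delta> * coeff s\<^sub>1 e = coeff r e"
      using \<delta> by simp
    then show ?thesis
      using True coeff_K_top [OF deg] by (simp add: \<delta>_def algebra_simps)
  next
    case False
    then have k: "k \<ge> Suc e"
      using that by simp
    then have "coeff r k = 0" "coeff s\<^sub>1 k = 0" "coeff (K s\<^sub>1) k = 0"
      using Suc.prems deg degree_K_le [of s\<^sub>1] by (auto intro!: coeff_eq_0)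
    then show ?thesis
      by simp
  qed
  then obtain s where s: "\<forall>k\<ge>e. coeff s k = 0"
      "K s - smult (lm (Suc m)) s = r - (K s\<^sub>1 - smult (lm (Suc m)) s\<^sub>1)"
    using Suc.IH [of "r - (K s\<^sub>1 - smult (lm (Suc m)) s\<^sub>1)"] Suc.prems by auto
  show ?case
  proof (intro exI [of _ "s\<^sub>1 + s"] conjI allI impI)
    fix k assume "Suc e \<le> k"
    then show "coeff (s\<^sub>1 + s) k = 0"
      using s(1) by (simp add: s\<^sub>1_def)
  next
    show "K (s\<^sub>1 + s) - smult (lm (Suc m)) (s\<^sub>1 + s) = r"
      using s(2) by (simp add: K_add smult_add_right algebra_simps)
  qed
qed

abbreviation B :: "nat \<Rightarrow> real poly"
  where "B \<equiv> eigenpoly b w"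

lemma eigenpoly_props: "degree (B m) = m" "lead_coeff (B m) = 1" "K (B m) = smult (lm (Suc m)) (B m)"
proof -
  define P where "P q \<longleftrightarrow> degree q = m \<and> lead_coeff q = 1 \<and>
    (\<forall>x\<in>{0..1}. return_op b w (poly q) x = lm (Suc m) * poly q x)" for q
  \<comment> \<open>The eigenvalue equation is only prescribed on [0,1]; infinitely many points
    force the identity of polynomials.\<close>
  have P_iff: "P q \<longleftrightarrow> degree q = m \<and> lead_coeff q = 1 \<and> K q = smult (lm (Suc m)) q" for q
  proof -
    have "K q = smult (lm (Suc m)) q" if "\<forall>x\<in>{0..1}. poly (K q) x = lm (Suc m) * poly q x"
    proof (rule ccontr)
      assume "K q \<noteq> smult (lm (Suc m)) q"
      then have "finite {x. poly (K q - smult (lm (Suc m)) q) x = 0}"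
        by (intro poly_roots_finite) simp
      then have "finite {0..1::real}"
        by (rule rev_finite_subset) (use that in auto)
      then show False
        by (simp add: infinite_Icc)
    qed
    then show ?thesis
      by (auto simp: P_def return_op_poly)
  qed
  \<comment> \<open>Ansatz X^m + s with s of lower degree: in the resulting right-hand side the
    terms of degree m cancel, as solvability requires.\<close>
  have "coeff (smult (lm (Suc m)) (monom 1 m) - K (monom 1 m)) k = 0" if "k \<ge> m" for k
    using coeff_K_top [of "monom 1 m" k] that degree_monom_le [of "1 :: real" m]
    by (cases "k = m") auto
  then obtain s where s: "\<forall>k\<ge>m. coeff s k = 0"
      "K s - smult (lm (Suc m)) s = smult (lm (Suc m)) (monom 1 m) - K (monom 1 m)"
    using K_minus_lam_solvable [of m m "smult (lm (Suc m)) (monom 1 m) - K (monom 1 m)"] by auto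
  define q where "q = monom 1 m + s"
  have "coeff q m = 1"
    using s(1) by (simp add: q_def)
  moreover have "coeff q k = 0" if "k > m" for k
    using s(1) that by (simp add: q_def)
  ultimately have "degree q = m"
    by (metis le_degree degree_le le_antisym zero_neq_one)
  moreover have "K q = smult (lm (Suc m)) q"
    using s(2) by (simp add: q_def K_add smult_add_right algebra_simps)
  ultimately have "P q"
    using \<open>coeff q m = 1\<close> by (simp add: P_iff)
  moreover have "q' = q" if "P q'" for q'
  proof (rule ccontr)
    assume "q' \<noteq> q"
    \<comment> \<open>Two monic solutions differ by an eigenpolynomial of degree below m, which
      \<open>K_eigen_degree\<close> excludes.\<close>
    have "K (q' - q) = smult (lm (Suc m)) (q' - q)"
      using \<open>P q\<close> that by (simp add: P_iff K_diff smult_diff_right)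
    then have "degree (q' - q) = m"
      using K_eigen_degree \<open>q' \<noteq> q\<close> by simp
    moreover have "coeff (q' - q) m = 0"
      using \<open>P q\<close> that by (auto simp: P_iff)
    ultimately show False
      using \<open>q' \<noteq> q\<close> by (metis leading_coeff_0_iff right_minus_eq)
  qed
  ultimately have "P (B m)"
    unfolding eigenpoly_def P_def [symmetric] by (rule theI)
  then show "degree (B m) = m" "lead_coeff (B m) = 1" "K (B m) = smult (lm (Suc m)) (B m)"
    by (auto simp: P_iff)
qed

end

section \<open>Growth of the eigenpolynomials\<close>

lemma has_sum_abs_le:
  fixes f g :: "'a \<Rightarrow> real"
  assumes "(f has_sum x) A" "(g has_sum y) A" "\<And>a. a \<in> A \<Longrightarrow> \<bar>f a\<bar> \<le> g a"
  shows "\<bar>x\<bar> \<le> y"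
proof -
  have "x \<le> y"
    using assms(3) by (intro has_sum_mono [OF assms(1,2)]) (simp add: abs_le_iff)
  moreover have "- x \<le> y"
    using assms(3) by (intro has_sum_mono [OF has_sum_uminusI [OF assms(1)] assms(2)]) (simp add: abs_le_iff)
  ultimately show ?thesis
    by linarith
qed

context return_words
begin

section \<open>The shortest return word and its fixed point\<close>

lemma short_return: "\<exists>g\<in>G. length g \<le> length w"
proof -
  obtain x d where w: "w = x @ [d]"
    using w_ne by (cases w rule: rev_cases) auto
  \<comment> \<open>Reading \<open>w\<close> once more after \<open>w\<close> completes a further
    occurrence, so some prefix of \<open>w\<close> is a return word.\<close>
  have "occ_after w (x @ [d]) \<ge> 1"
    using occ_after_snoc [OF w_ne, of x d] suffix_appendI [of w "x @ [d]" w]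
    by (simp add: w [symmetric])
  then obtain g r where "w = g @ r" "g \<in> G"
    using first_passage_exists [OF unit_steps_occ_after [OF w_ne] w_words]
    by (auto simp: w [symmetric] lang_G_eq)
  then show ?thesis
    by (intro bexI [of _ g]) auto
qed

definition g\<^sub>0 :: "nat list"
  where "g\<^sub>0 = (ARG_MIN length g. g \<in> G)"

lemma gs_G: "g\<^sub>0 \<in> G"
  and gs_min: "g \<in> G \<Longrightarrow> length g\<^sub>0 \<le> length g"
proof -
  obtain g where "g \<in> G"
    using G_nonempty by auto
  then show "g\<^sub>0 \<in> G"
    unfolding g\<^sub>0_def by (rule arg_min_natI)
next
  assume "g \<in> G"
  then show "length g\<^sub>0 \<le> length g"
    unfolding g\<^sub>0_def by (rule arg_min_nat_le)
qed

text \<open>The shortest return word is no longer than \<open>w\<close>, hence a suffix of \<open>w\<close>; it is therefore a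
  suffix of every return word.\<close>

lemma G_decompose:
  assumes "g \<in> G"
  obtains u where "g = u @ g\<^sub>0" "u \<in> words b" "u = [] \<longleftrightarrow> g = g\<^sub>0"
proof -
  have "length g\<^sub>0 \<le> length w"
    using short_return gs_min order_trans by blast
  then have "suffix g\<^sub>0 w"
    using suffix_length_suffix [of g\<^sub>0 "w @ g\<^sub>0" w] lang_G_suffix [OF w_ne gs_G] by (simp add: suffix_def)
  then have "suffix g\<^sub>0 (w @ g)"
    using lang_G_suffix [OF w_ne assms] suffix_order.trans by blast
  then have "suffix g\<^sub>0 g"
    using gs_min [OF assms] suffix_append_left_iff by blast
  then obtain u where "g = u @ g\<^sub>0"
    by (auto simp: suffix_def)
  then show thesis
    using that [of u] G_words [OF assms] by auto
qed

definition x\<^sub>0 :: real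
  where "x\<^sub>0 = word_frac b g\<^sub>0 / (1 - wt g\<^sub>0)"

lemma wt_gs_le: "wt g\<^sub>0 \<le> 1 / 2"
proof -
  have "wt g\<^sub>0 \<le> 1 / real b"
    using wt_le G_ne gs_G by blast
  also have "\<dots> \<le> 1 / 2"
    using b_gt by (intro divide_left_mono) auto
  finally show ?thesis .
qed

lemma phi_gs_xs: "phi g\<^sub>0 x\<^sub>0 = x\<^sub>0"
proof -
  have "1 - wt g\<^sub>0 \<noteq> 0"
    using wt_gs_le by linarith
  then have "(1 - wt g\<^sub>0) * x\<^sub>0 = word_frac b g\<^sub>0"
    unfolding x\<^sub>0_def by (simp only: times_divide_eq_right nonzero_mult_div_cancel_left not_False_eq_True)
  then show ?thesis
    by (simp only: phi_def) (simp only: algebra_simps)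
qed

lemma xs_in: "x\<^sub>0 \<in> {0..1}"
proof -
  have "word_frac b g\<^sub>0 \<le> 1 - wt g\<^sub>0"
    using word_frac_le [of b g\<^sub>0] G_words [OF gs_G] b_gt by simp
  then show ?thesis
    using wt_gs_le word_frac_nonneg [of b g\<^sub>0] by (simp add: x\<^sub>0_def divide_le_eq)
qed

text \<open>In the coordinate y = x - \<open>x\<^sub>0\<close> the branch of g sends y to
  \<open>\<delta> g + wt g * y\<close>.\<close>

definition \<delta> :: "nat list \<Rightarrow> real"
  where "\<delta> g = phi g x\<^sub>0 - x\<^sub>0"

lemma \<delta>_gs: "\<delta> g\<^sub>0 = 0"
  by (simp add: \<delta>_def phi_gs_xs)

text \<open>For g = u \<open>g\<^sub>0\<close> the quotient of the weights is \<open>wt u\<close>,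
  and g moves \<open>x\<^sub>0\<close> as u does. Since \<open>word_frac b u\<close> lies between 0
  and \<open>1 - wt u\<close>, so does the size of the displacement; and
  \<open>wt u \<le> 1 / 2\<close> pays for the doubled \<epsilon> on the left.\<close>

lemma \<delta>_bound:
  assumes "g \<in> G" "g \<noteq> g\<^sub>0" "\<epsilon> \<ge> 0"
  shows "\<bar>\<delta> g\<bar> + wt g / wt g\<^sub>0 * (1 + 2 * \<epsilon>) \<le> 1 + \<epsilon>"
proof -
  obtain u where u: "g = u @ g\<^sub>0" "u \<in> words b" "u \<noteq> []"
    using G_decompose [OF assms(1)] assms(2) by metis
  have \<kappa>: "wt g / wt g\<^sub>0 = wt u"
    using b_gt unfolding u(1) by (simp add: power_add)
  have \<delta>: "\<delta> g = word_frac b u + wt u * x\<^sub>0 - x\<^sub>0"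
    by (simp add: \<delta>_def u(1) phi_append phi_gs_xs) (simp add: phi_def)
  have "wt u \<le> 1 / real b"
    by (rule wt_le [OF u(3)])
  also have "\<dots> \<le> 1 / 2"
    using b_gt by (intro divide_left_mono) auto
  finally have half: "wt u \<le> 1 / 2" .
  have "v * x\<^sub>0 \<le> x\<^sub>0 \<and> x\<^sub>0 + v \<le> 1 + v * x\<^sub>0" if "v \<le> 1" for v
  proof -
    have "0 \<le> x\<^sub>0 * (1 - v)" "0 \<le> (1 - x\<^sub>0) * (1 - v)"
      using xs_in that by auto
    then show ?thesis
      by (simp add: algebra_simps)
  qed
  then have "wt u * x\<^sub>0 \<le> x\<^sub>0" "x\<^sub>0 + wt u \<le> 1 + wt u * x\<^sub>0"
    using wt_le_1 by blast+
  then have 1: "\<bar>\<delta> g\<bar> + wt u \<le> 1"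
    using word_frac_le [of b u] word_frac_nonneg [of b u] u(2) b_gt unfolding \<delta> by linarith
  have "wt u * (2 * \<epsilon>) \<le> 1 / 2 * (2 * \<epsilon>)"
    using half assms(3) by (intro mult_right_mono) auto
  then show ?thesis
    using 1 unfolding \<kappa> by (simp only: distrib_left mult_1_right)
qed

section \<open>Coefficients around the fixed point\<close>

abbreviation centered :: "real poly \<Rightarrow> real poly"
  where "centered q \<equiv> pcompose q [:x\<^sub>0, 1:]"

lemma centered_branch: "centered (branch g q) = pcompose (centered q) [:\<delta> g, wt g:]"
proof -
  have "pcompose [:word_frac b g, wt g:] [:x\<^sub>0, 1:] = pcompose [:x\<^sub>0, 1:] [:\<delta> g, wt g:]"
    by (simp add: pcompose_pCons \<delta>_def phi_def algebra_simps)
  then show ?thesis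
    by (simp only: pcompose_assoc [symmetric])
qed

lemma degree_centered: "degree (centered q) = degree q"
  by (simp add: degree_pcompose)

lemma poly_centered: "poly q x = (\<Sum>n\<le>degree q. coeff (centered q) n * (x - x\<^sub>0) ^ n)"
proof -
  have "poly q x = poly (centered q) (x - x\<^sub>0)"
    by (simp add: poly_pcompose)
  then show ?thesis
    by (simp add: poly_altdef degree_centered)
qed

text \<open>Comparing coefficients of \<open>(x - x\<^sub>0) ^ k\<close> in the eigenvalue equation
  expresses \<open>c k\<close> through higher coefficients, divided by a gap of order
  \<open>\<omega> ^ k\<close> with \<open>\<omega> = wt g\<^sub>0\<close>. Each contributing branch
  has the factor \<open>wt g ^ k = \<kappa> ^ k * \<omega> ^ k\<close>, which cancels the divisor.
  The contraction leaves room for the larger radius \<open>R'\<close> next to \<kappa>, and this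
  surplus becomes the factor \<open>(R / R') ^ k\<close>.\<close>

lemma eigenpoly_coeff_bound:
  assumes k: "k < m" and \<epsilon>: "\<epsilon> > 0"
  defines "c \<equiv> coeff (centered (B m))" and "R \<equiv> 1 + \<epsilon>" and "R' \<equiv> 1 + 2 * \<epsilon>"
  shows "\<bar>c k\<bar> * R ^ k \<le> 2 / wt g\<^sub>0 * (R / R') ^ k * (\<Sum>n=Suc k..m. \<bar>c n\<bar> * R ^ n)"
proof -
  define \<omega> where "\<omega> = wt g\<^sub>0"
  define S where "S = (\<Sum>n=Suc k..m. \<bar>c n\<bar> * R ^ n)"
  define t where "t g n = c n * (real (n choose k) * wt g ^ k * \<delta> g ^ (n - k))" for g n
  have \<omega>: "\<omega> > 0"
    using wt_pos by (simp add: \<omega>_def)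
  have R: "R > 0" "R' > 0" "S \<ge> 0"
    using \<epsilon> by (auto simp: R_def R'_def S_def intro!: sum_nonneg)
  have deg: "degree (B m) = m"
    by (rule eigenpoly_props)
  have expand: "coeff (centered (branch g (B m))) k = c k * wt g ^ k + (\<Sum>n=Suc k..m. t g n)" for g
  proof -
    have "coeff (centered (branch g (B m))) k = (\<Sum>n\<le>m. t g n)"
      unfolding centered_branch coeff_pcompose_affine degree_centered deg t_def c_def ..
    also have "\<dots> = (\<Sum>n\<in>{k..m}. t g n)"
      by (rule sum.mono_neutral_right) (auto simp: t_def binomial_eq_0)
    also have "\<dots> = t g k + (\<Sum>n=Suc k..m. t g n)"
      using k by (simp add: sum.atLeast_Suc_atMost)
    finally show ?thesis
      by (simp add: t_def)
  qed
  have "poly_functional (\<lambda>q. coeff (centered q) k)"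
    by (simp add: poly_functional_def pcompose_add pcompose_smult)
  from K_functional [OF this, of "B m"]
  have "((\<lambda>g. wt g * (c k * wt g ^ k + (\<Sum>n=Suc k..m. t g n))) has_sum lm (Suc m) * c k) G"
    by (simp only: expand eigenpoly_props pcompose_smult coeff_smult c_def)
  moreover have "((\<lambda>g. wt g ^ Suc k * c k) has_sum lm (Suc k) * c k) G"
    by (intro has_sum_cmult_left lam_has_sum) simp
  ultimately have "((\<lambda>g. wt g * (c k * wt g ^ k + (\<Sum>n=Suc k..m. t g n)) + - (wt g ^ Suc k * c k)) has_sum
      lm (Suc m) * c k + - (lm (Suc k) * c k)) G"
    by (intro has_sum_add has_sum_uminusI)
  then have sum: "((\<lambda>g. wt g * (\<Sum>n=Suc k..m. t g n)) has_sum (lm (Suc m) - lm (Suc k)) * c k) G"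
    by (simp add: algebra_simps)
  have bound: "\<bar>wt g * (\<Sum>n=Suc k..m. t g n)\<bar> * R ^ k \<le> wt g * (\<omega> ^ k * (R / R') ^ k * S)"
    if g: "g \<in> G" for g
  proof -
    define \<kappa> where "\<kappa> = wt g / \<omega>"
    have \<kappa>: "\<kappa> > 0"
      using wt_pos \<omega> unfolding \<kappa>_def by (rule divide_pos_pos)
    have "\<bar>t g n\<bar> * R ^ k \<le> \<omega> ^ k * (R / R') ^ k * (\<bar>c n\<bar> * R ^ n)" if n: "n \<in> {Suc k..m}" for n
    proof (cases "g = g\<^sub>0")
      case True
      then have "t g n = 0"
        using n by (simp add: t_def \<delta>_gs power_0_left)
      then show ?thesis
        using \<omega> R by simp
    next
      case False
      \<comment> \<open>One term of a binomial expansion is bounded by the whole, whose base is at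
        most \<open>R\<close> by \<open>\<delta>_bound\<close>.\<close>
      have "real (n choose k) * (\<kappa> * R') ^ k * \<bar>\<delta> g\<bar> ^ (n - k)
          \<le> (\<Sum>i\<le>n. real (n choose i) * (\<kappa> * R') ^ i * \<bar>\<delta> g\<bar> ^ (n - i))"
        using n \<kappa> R by (intro member_le_sum) auto
      also have "\<dots> = (\<kappa> * R' + \<bar>\<delta> g\<bar>) ^ n"
        by (simp add: binomial_ring)
      also have "\<dots> \<le> R ^ n"
        using \<delta>_bound [OF g False, of \<epsilon>] \<kappa> R \<epsilon>
        by (intro power_mono) (auto simp: \<kappa>_def \<omega>_def R_def R'_def)
      finally have le: "real (n choose k) * (\<kappa> * R') ^ k * \<bar>\<delta> g\<bar> ^ (n - k) \<le> R ^ n" .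
      have "wt g = \<kappa> * \<omega>"
        using \<omega> by (simp add: \<kappa>_def)
      then have "\<bar>t g n\<bar> * R ^ k = \<omega> ^ k * R ^ k * \<bar>c n\<bar> * (real (n choose k) * \<kappa> ^ k * \<bar>\<delta> g\<bar> ^ (n - k))"
        using \<kappa> \<omega> unfolding t_def by (simp add: abs_mult power_abs power_mult_distrib mult_ac)
      also have "\<dots> = \<omega> ^ k * (R / R') ^ k * \<bar>c n\<bar> * (real (n choose k) * (\<kappa> * R') ^ k * \<bar>\<delta> g\<bar> ^ (n - k))"
        using R by (simp add: power_mult_distrib power_divide)
      also have "\<dots> \<le> \<omega> ^ k * (R / R') ^ k * \<bar>c n\<bar> * R ^ n"
        using \<omega> R by (intro mult_left_mono le) auto
      finally show ?thesis
        by (simp add: mult.assoc)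
    qed
    then have "(\<Sum>n=Suc k..m. \<bar>t g n\<bar> * R ^ k) \<le> (\<Sum>n=Suc k..m. \<omega> ^ k * (R / R') ^ k * (\<bar>c n\<bar> * R ^ n))"
      by (rule sum_mono)
    then have "(\<Sum>n=Suc k..m. \<bar>t g n\<bar>) * R ^ k \<le> \<omega> ^ k * (R / R') ^ k * S"
      by (simp add: S_def sum_distrib_left sum_distrib_right)
    moreover have "\<bar>\<Sum>n=Suc k..m. t g n\<bar> * R ^ k \<le> (\<Sum>n=Suc k..m. \<bar>t g n\<bar>) * R ^ k"
      using R by (intro mult_right_mono sum_abs) auto
    ultimately have "\<bar>\<Sum>n=Suc k..m. t g n\<bar> * R ^ k \<le> \<omega> ^ k * (R / R') ^ k * S"
      by linarith
    then have "wt g * (\<bar>\<Sum>n=Suc k..m. t g n\<bar> * R ^ k) \<le> wt g * (\<omega> ^ k * (R / R') ^ k * S)"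
      by (rule mult_left_mono) simp
    then show ?thesis
      by (simp add: abs_mult)
  qed
  have "\<bar>(lm (Suc m) - lm (Suc k)) * c k\<bar> * R ^ k \<le> \<omega> ^ k * (R / R') ^ k * S"
  proof -
    have "((\<lambda>g. wt g * (\<Sum>n=Suc k..m. t g n) * R ^ k) has_sum (lm (Suc m) - lm (Suc k)) * c k * R ^ k) G"
      using sum by (rule has_sum_cmult_left)
    moreover have "((\<lambda>g. wt g * (\<omega> ^ k * (R / R') ^ k * S)) has_sum 1 * (\<omega> ^ k * (R / R') ^ k * S)) G"
      using wt_has_sum by (rule has_sum_cmult_left)
    ultimately have "\<bar>(lm (Suc m) - lm (Suc k)) * c k * R ^ k\<bar> \<le> 1 * (\<omega> ^ k * (R / R') ^ k * S)"
    proof (rule has_sum_abs_le)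
      fix g assume "g \<in> G"
      then show "\<bar>wt g * (\<Sum>n=Suc k..m. t g n) * R ^ k\<bar> \<le> wt g * (\<omega> ^ k * (R / R') ^ k * S)"
        using bound [of g] R by (simp add: abs_mult)
    qed
    then show ?thesis
      using R by (simp add: abs_mult)
  qed
  \<comment> \<open>Each further index costs a factor b \<ge> 2, so the gap is at least half of
    \<open>lm (Suc k)\<close>, and that sum contains the term of \<open>g\<^sub>0\<close>.\<close>
  moreover have "\<omega> ^ Suc k / 2 \<le> \<bar>lm (Suc m) - lm (Suc k)\<bar>"
  proof -
    have "lm (Suc k + (m - k)) \<le> lm (Suc k) / real b ^ (m - k)"
      by (rule lam_add_le) simp
    also have "\<dots> \<le> lm (Suc k) / 2"
    proof (rule divide_left_mono)
      have "real b ^ 1 \<le> real b ^ (m - k)"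
        using b_gt k by (intro power_increasing) auto
      moreover have "2 \<le> real b ^ 1"
        using b_gt by simp
      ultimately show "2 \<le> real b ^ (m - k)"
        by linarith
    qed (use b_gt lam_pos [of "Suc k"] in auto)
    finally have "lm (Suc m) \<le> lm (Suc k) / 2"
      using k by simp
    moreover have "\<omega> ^ Suc k \<le> lm (Suc k)"
      unfolding \<omega>_def by (rule wt_power_le_lam [OF _ gs_G]) simp
    ultimately show ?thesis
      by linarith
  qed
  ultimately have "\<omega> ^ Suc k / 2 * (\<bar>c k\<bar> * R ^ k) \<le> \<omega> ^ k * (R / R') ^ k * S"
    using R mult_right_mono [of "\<omega> ^ Suc k / 2" "\<bar>lm (Suc m) - lm (Suc k)\<bar>" "\<bar>c k\<bar> * R ^ k"]
    by (simp add: abs_mult mult.assoc)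
  then have "\<omega> ^ k * (\<omega> / 2 * (\<bar>c k\<bar> * R ^ k)) \<le> \<omega> ^ k * ((R / R') ^ k * S)"
    by (simp add: mult_ac)
  then have "\<omega> / 2 * (\<bar>c k\<bar> * R ^ k) \<le> (R / R') ^ k * S"
    using \<omega> by (simp only: mult_le_cancel_left_pos zero_less_power)
  then have "2 / \<omega> * (\<omega> / 2 * (\<bar>c k\<bar> * R ^ k)) \<le> 2 / \<omega> * ((R / R') ^ k * S)"
    using \<omega> by (intro mult_left_mono) auto
  then show ?thesis
    using \<omega> b_gt unfolding S_def \<omega>_def by (simp add: mult.assoc)
qed

text \<open>Bounding each coefficient by its tail gives
  \<open>T k \<le> (1 + A * q ^ k) * T (Suc k)\<close>. The infinite product of these factors
  converges, which makes the constant independent of m, and \<open>T m = R ^ m\<close> because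
  \<open>B m\<close> is monic.\<close>

theorem eigenpoly_growth:
  assumes \<epsilon>: "\<epsilon> > 0"
  shows "\<exists>C>0. \<forall>m. \<forall>x\<in>{0..1}. \<bar>poly (B m) x\<bar> \<le> C * (1 + \<epsilon>) ^ m"
proof -
  define R where "R = 1 + \<epsilon>"
  define q where "q = R / (1 + 2 * \<epsilon>)"
  define A where "A = 2 / wt g\<^sub>0"
  have R: "R > 1" and q: "0 < q" "q < 1"
    using \<epsilon> by (auto simp: R_def q_def)
  have A: "A > 0"
    using wt_pos [of g\<^sub>0] unfolding A_def by (intro divide_pos_pos) auto
  have "\<bar>poly (B m) x\<bar> \<le> exp (A / (1 - q)) * R ^ m" if x: "x \<in> {0..1}" for m x
  proof -
    define c where "c = coeff (centered (B m))"
    define T where "T k = (\<Sum>n=k..m. \<bar>c n\<bar> * R ^ n)" for k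
    have deg: "degree (B m) = m"
      by (rule eigenpoly_props)
    have T0: "T k \<ge> 0" for k
      using R by (auto simp: T_def intro!: sum_nonneg)
    have step: "T k \<le> exp (A * q ^ k) * T (Suc k)" if "k < m" for k
    proof -
      have "T k = \<bar>c k\<bar> * R ^ k + T (Suc k)"
        using that by (simp add: T_def sum.atLeast_Suc_atMost)
      also have "\<dots> \<le> A * q ^ k * T (Suc k) + T (Suc k)"
        using eigenpoly_coeff_bound [OF that \<epsilon>] by (simp add: A_def q_def R_def T_def c_def)
      also have "\<dots> = (1 + A * q ^ k) * T (Suc k)"
        by (simp add: algebra_simps)
      also have "\<dots> \<le> exp (A * q ^ k) * T (Suc k)"
        using T0 by (intro mult_right_mono exp_ge_add_one_self) auto
      finally show ?thesis .
    qed
    have "T 0 \<le> exp (\<Sum>i<k. A * q ^ i) * T k" if "k \<le> m" for k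
      using that
    proof (induction k)
      case (Suc k)
      then have "T 0 \<le> exp (\<Sum>i<k. A * q ^ i) * T k"
        by simp
      also have "\<dots> \<le> exp (\<Sum>i<k. A * q ^ i) * (exp (A * q ^ k) * T (Suc k))"
        using Suc.prems by (intro mult_left_mono step) auto
      finally show ?case
        by (simp add: exp_add mult_ac)
    qed simp
    from this [of m] have "T 0 \<le> exp (\<Sum>i<m. A * q ^ i) * T m"
      by simp
    also have "T m = R ^ m"
    proof -
      have "lead_coeff (centered (B m)) = 1"
        using lead_coeff_comp [of "[:x\<^sub>0, 1:]" "B m"] eigenpoly_props(2) [of m] by simp
      then show ?thesis
        using R by (simp add: T_def c_def degree_centered deg)
    qed
    also have "exp (\<Sum>i<m. A * q ^ i) * R ^ m \<le> exp (A / (1 - q)) * R ^ m"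
    proof -
      have "(\<Sum>i<m. q ^ i) \<le> (\<Sum>i. q ^ i)"
        using q by (intro sum_le_suminf summable_geometric) auto
      also have "\<dots> = 1 / (1 - q)"
        using q by (intro suminf_geometric) auto
      finally have "A * (\<Sum>i<m. q ^ i) \<le> A * (1 / (1 - q))"
        using A by (intro mult_left_mono) auto
      then show ?thesis
        using R by (simp add: sum_distrib_left)
    qed
    finally have "T 0 \<le> exp (A / (1 - q)) * R ^ m" .
    moreover have "\<bar>poly (B m) x\<bar> \<le> T 0"
    proof -
      have "\<bar>poly (B m) x\<bar> \<le> (\<Sum>n\<le>m. \<bar>c n * (x - x\<^sub>0) ^ n\<bar>)"
        unfolding poly_centered deg c_def by (rule sum_abs)
      also have "\<dots> \<le> (\<Sum>n\<le>m. \<bar>c n\<bar> * R ^ n)"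
      proof (rule sum_mono)
        fix n
        have "\<bar>x - x\<^sub>0\<bar> ^ n \<le> R ^ n"
          using x xs_in R by (intro power_mono) auto
        then show "\<bar>c n * (x - x\<^sub>0) ^ n\<bar> \<le> \<bar>c n\<bar> * R ^ n"
          by (simp add: abs_mult power_abs mult_left_mono)
      qed
      finally show ?thesis
        by (simp add: T_def atMost_atLeast0)
    qed
    ultimately show ?thesis
      by linarith
  qed
  then show ?thesis
    unfolding R_def by (intro exI [of _ "exp (A / (1 - q))"]) auto
qed

end

section \<open>The self-similar measures\<close>

text \<open>Coinduction on the family of all \<open>flat \<circ> h\<close> with measurable
  \<open>h\<close>. It is closed under \<open>stl\<close>: dropping a digit shortens the head word
  or, once that word is exhausted, moves on to the next one.\<close>

lemma measurable_flat:
  "flat \<in> measurable (stream_space (count_space UNIV)) (stream_space (count_space UNIV))"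
proof -
  let ?N = "stream_space (count_space UNIV) :: 'a list stream measure"
  define F where "F f \<longleftrightarrow> (\<exists>h \<in> measurable ?N ?N. f = (\<lambda>x. flat (h x)))" for f :: "'a list stream \<Rightarrow> 'a stream"
  have "F flat"
    unfolding F_def by (intro bexI [of _ "\<lambda>x. x"]) auto
  then show ?thesis
  proof (coinduct rule: measurable_stream_coinduct)
    case (shd f)
    then obtain h where h [measurable]: "h \<in> measurable ?N ?N" and f: "f = (\<lambda>x. flat (h x))"
      unfolding F_def by blast
    have "(\<lambda>x. shd (h x)) \<in> measurable ?N (count_space UNIV)"
      by measurable
    then have "(\<lambda>x. hd (shd (h x))) \<in> measurable ?N (count_space UNIV)"
      by (rule measurable_compose) simp
    then show ?case
      by (simp add: f)
  next
    case (stl f)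
    then obtain h where h [measurable]: "h \<in> measurable ?N ?N" and f: "f = (\<lambda>x. flat (h x))"
      unfolding F_def by blast
    have shd: "(\<lambda>x. shd (h x)) \<in> measurable ?N (count_space UNIV)"
      by measurable
    have pr: "Measurable.pred ?N (\<lambda>x. tl (shd (h x)) = [])"
      by (rule measurable_compose [OF shd]) simp
    have [measurable]: "(\<lambda>x. tl (shd (h x))) \<in> measurable ?N (count_space UNIV)"
      by (rule measurable_compose [OF shd]) simp
    have "(\<lambda>x. stl (h x)) \<in> measurable ?N ?N" "(\<lambda>x. tl (shd (h x)) ## stl (h x)) \<in> measurable ?N ?N"
      by measurable
    moreover have "{x \<in> space ?N. tl (shd (h x)) = []} \<in> sets ?N"
      using pr by (simp only: pred_def)
    ultimately have "(\<lambda>x. if tl (shd (h x)) = [] then stl (h x) else tl (shd (h x)) ## stl (h x)) \<in> measurable ?N ?N"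
      by (rule measurable_If)
    then show ?case
      unfolding F_def f by (rule bexI [rotated]) simp
  qed
qed

context return_words
begin

lemma measurable_stream_frac: "stream_frac b \<in> borel_measurable (stream_space (count_space UNIV))"
  unfolding stream_frac_def by measurable

lemma stream_frac_summable:
  assumes "sset s \<subseteq> {..<b}"
  shows "summable (\<lambda>i. real (s !! i) / real b ^ Suc i)" "stream_frac b s \<in> {0..1}"
proof -
  define q where "q = 1 / real b"
  have q: "0 < q" "q < 1" "real b * q = 1"
    using b_gt by (auto simp: q_def)
  have "(\<lambda>i. q ^ i) sums (1 / (1 - q))"
    using q by (intro geometric_sums) auto
  then have "(\<lambda>i. (1 - q) * q ^ i) sums ((1 - q) * (1 / (1 - q)))"
    by (rule sums_mult)
  then have geo: "(\<lambda>i. (1 - q) * q ^ i) sums 1"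
    using q by simp
  \<comment> \<open>Digits are at most b - 1 = (1 - q)/q. The majorant sums to exactly 1, which also
    gives the upper end of the range.\<close>
  have le: "real (s !! i) / real b ^ Suc i \<le> (1 - q) * q ^ i" for i
  proof -
    have "s !! i \<in> {..<b}"
      using assms snth_sset by blast
    then have "real (s !! i) \<le> real b - 1"
      by auto
    then have "real (s !! i) * q \<le> (real b - 1) * q"
      using q by (intro mult_right_mono) auto
    then have "real (s !! i) * q * q ^ i \<le> (1 - q) * q ^ i"
      using q by (intro mult_right_mono) (auto simp: left_diff_distrib)
    then show ?thesis
      by (simp add: q_def power_one_over mult.assoc)
  qed
  show sum: "summable (\<lambda>i. real (s !! i) / real b ^ Suc i)"
    by (rule summable_comparison_test' [OF sums_summable [OF geo]]) (use le in auto)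
  have "stream_frac b s \<le> 1"
    unfolding stream_frac_def using suminf_le [OF le sum sums_summable [OF geo]] sums_unique [OF geo] by simp
  moreover have "stream_frac b s \<ge> 0"
    unfolding stream_frac_def by (intro suminf_nonneg sum) auto
  ultimately show "stream_frac b s \<in> {0..1}"
    by simp
qed

lemma stream_frac_shift:
  assumes "g \<in> words b" "sset s \<subseteq> {..<b}"
  shows "stream_frac b (g @- s) = phi g (stream_frac b s)"
  using assms(1)
proof (induction g)
  case Nil
  then show ?case
    by (simp add: phi_def word_frac_def)
next
  case (Cons d g)
  let ?t = "g @- s"
  have t: "sset (d ## ?t) \<subseteq> {..<b}" "sset ?t \<subseteq> {..<b}"
    using Cons.prems assms(2) by (auto simp: words_def)
  have "stream_frac b (d ## ?t) = real d / real b + (\<Sum>i. real (?t !! i) / real b ^ Suc (Suc i))"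
    using suminf_split_head [OF stream_frac_summable(1) [OF t(1)]] by (simp add: stream_frac_def)
  also have "(\<Sum>i. real (?t !! i) / real b ^ Suc (Suc i)) = (\<Sum>i. real (?t !! i) / real b ^ Suc i * (1 / real b))"
    by (simp add: mult.commute)
  also have "\<dots> = stream_frac b ?t * (1 / real b)"
    unfolding stream_frac_def by (rule suminf_mult2 [OF stream_frac_summable(1) [OF t(2)], symmetric])
  also have "real d / real b + stream_frac b ?t * (1 / real b) = phi [d] (stream_frac b ?t)"
    using word_int_snoc [of b "[]" d] by (simp add: phi_def word_frac_def)
  finally show ?case
    using Cons phi_append [of "[d]" g] by simp
qed

section \<open>Random concatenation of return words\<close>

context
  fixes j :: nat
  assumes j: "j \<ge> 1"
begin

abbreviation "P \<equiv> return_word_pmf b w j"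
abbreviation "\<nu> \<equiv> nu b w j"

definition wp :: "nat list \<Rightarrow> real"
  where "wp g = wt g ^ j / lm j"

lemma wp_nonneg: "wp g \<ge> 0"
  using lam_pos [OF j] by (simp add: wp_def)

lemma wp_has_sum: "(wp has_sum 1) G"
  using has_sum_divide_const [OF lam_has_sum [OF j], of "lm j"] lam_pos [OF j] by (simp add: wp_def [abs_def])

lemma pmf_P: "pmf P g = (if g \<in> G then wp g else 0)"
proof -
  define f where "f g = (if g \<in> G then wp g else 0)" for g
  have f0: "f g \<ge> 0" for g
    by (simp add: f_def wp_nonneg)
  have sum: "(f has_sum 1) UNIV"
    using wp_has_sum by (rule has_sum_cong_neutral [THEN iffD1, rotated -1]) (auto simp: f_def)
  then have "(\<lambda>g. norm (f g)) summable_on UNIV"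
    using f0 by (simp add: has_sum_imp_summable)
  then have abs: "Infinite_Set_Sum.abs_summable_on f UNIV"
    by (rule abs_summable_equivalent [THEN iffD1])
  have "(\<integral>\<^sup>+ g. ennreal (f g) \<partial>count_space UNIV) = ennreal (infsetsum f UNIV)"
    by (rule nn_integral_conv_infsetsum [OF abs]) (rule f0)
  also have "\<dots> = 1"
    using infsetsum_infsum [OF abs] infsumI [OF sum] by simp
  finally have int: "(\<integral>\<^sup>+ g. ennreal (f g) \<partial>count_space UNIV) = 1" .
  have eq: "return_word_pmf b w j = embed_pmf f"
    unfolding return_word_pmf_def f_def [abs_def] wp_def wt_power ..
  have "pmf P g = f g"
    unfolding eq by (rule pmf_embed_pmf [OF f0 int])
  then show ?thesis
    by (simp add: f_def)
qed

lemma set_P: "set_pmf P \<subseteq> G"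
  by (auto simp: set_pmf_eq pmf_P split: if_splits)

lemma expectation_P:
  assumes "\<And>g. g \<in> G \<Longrightarrow> \<bar>f g\<bar> \<le> (M :: real)"
  shows "((\<lambda>g. wp g * f g) has_sum measure_pmf.expectation P f) G"
proof -
  have "(\<lambda>g. wp g * M) summable_on G"
    using has_sum_imp_summable [OF wp_has_sum] by (rule summable_on_cmult_left)
  then have "(\<lambda>g. norm (wp g * f g)) summable_on G"
    by (rule Infinite_Sum.abs_summable_on_comparison_test')
      (use assms wp_nonneg in \<open>auto simp: abs_mult intro!: mult_left_mono\<close>)
  moreover have "(\<lambda>g. norm (wp g * f g)) summable_on G \<longleftrightarrow> (\<lambda>g. norm (pmf P g * f g)) summable_on UNIV"
    by (rule summable_on_cong_neutral) (auto simp: pmf_P)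
  ultimately have "Infinite_Set_Sum.abs_summable_on (\<lambda>g. pmf P g * f g) UNIV"
    by (intro abs_summable_equivalent [THEN iffD1]) simp
  then have "measure_pmf.expectation P f = (\<Sum>\<^sub>\<infinity>g. pmf P g * f g)"
    by (simp add: pmf_expectation_eq_infsetsum infsetsum_infsum)
  also have "\<dots> = (\<Sum>\<^sub>\<infinity>g\<in>G. wp g * f g)"
    by (rule infsum_cong_neutral) (auto simp: pmf_P)
  finally have "measure_pmf.expectation P f = (\<Sum>\<^sub>\<infinity>g\<in>G. wp g * f g)" .
  moreover have "(\<lambda>g. wp g * f g) summable_on G"
    using \<open>(\<lambda>g. norm (wp g * f g)) summable_on G\<close> summable_on_iff_abs_summable_on_real by blast
  ultimately show ?thesis
    using has_sum_infsum by auto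
qed

abbreviation "S \<equiv> stream_space (measure_pmf P)"

definition F :: "nat list stream \<Rightarrow> real"
  where "F ss = stream_frac b (flat ss)"

lemma F_measurable [measurable]: "F \<in> borel_measurable S"
proof -
  have "(\<lambda>ss. stream_frac b (flat ss)) \<in> borel_measurable (stream_space (count_space UNIV))"
    by (rule measurable_compose [OF measurable_flat measurable_stream_frac])
  moreover have "sets S = sets (stream_space (count_space UNIV))"
    by (rule sets_stream_space_cong) simp
  ultimately show ?thesis
    using measurable_cong_sets [of S "stream_space (count_space UNIV)" borel borel] by (simp add: F_def [abs_def])
qed

lemma nu_distr: "\<nu> = distr S borel F"
  by (simp add: nu_def F_def [abs_def])

lemma sets_nu [measurable_cong, simp]: "sets \<nu> = sets borel"
  by (simp add: nu_distr)

lemma space_nu [simp]: "space \<nu> = UNIV"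
  by (simp add: nu_distr)

lemma prob_space_nu: "prob_space \<nu>"
  unfolding nu_distr using prob_space.prob_space_stream_space [OF prob_space_measure_pmf] F_measurable by (rule prob_space.prob_space_distr)

lemma AE_S: "AE ss in S. sset ss \<subseteq> G"
proof -
  have "AE ss in S. stream_all (\<lambda>g. g \<in> G) ss"
    by (rule prob_space.AE_stream_all [OF prob_space_measure_pmf]) (use set_P in \<open>auto simp: AE_measure_pmf_iff\<close>)
  then show ?thesis
    by eventually_elim (auto simp: stream_all_def sset_range)
qed

lemma flat_words:
  assumes "sset ss \<subseteq> G"
  shows "sset (flat ss) \<subseteq> {..<b}"
  using assms G_ne G_words by (subst sset_flat) (fastforce simp: words_def)+

lemma F_in: "sset ss \<subseteq> G \<Longrightarrow> F ss \<in> {0..1}"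
  unfolding F_def by (intro stream_frac_summable flat_words)

lemma F_Stream: "g \<in> G \<Longrightarrow> sset ss \<subseteq> G \<Longrightarrow> F (g ## ss) = phi g (F ss)"
  unfolding F_def using G_ne [of g] by (simp add: stream_frac_shift G_words flat_words)

lemma AE_nu: "AE x in \<nu>. x \<in> {0..1}"
  unfolding nu_distr using AE_S by (subst AE_distr_iff) (auto elim!: eventually_mono dest: F_in)

lemma AE_nuI: "(\<And>x. x \<in> {0..1} \<Longrightarrow> Q x) \<Longrightarrow> AE x in \<nu>. Q x"
  by (rule eventually_mono [OF AE_nu])

lemma AE_P: "AE g in measure_pmf P. g \<in> G"
  using set_P by (auto simp: AE_measure_pmf_iff)

lemma AE_PI: "(\<And>g. g \<in> G \<Longrightarrow> Q g) \<Longrightarrow> AE g in measure_pmf P. Q g"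
  by (rule eventually_mono [OF AE_P])

lemma nu_integrable:
  assumes [measurable]: "f \<in> borel_measurable borel"
    and bound: "\<And>x. x \<in> {0..1} \<Longrightarrow> \<bar>f x\<bar> \<le> (M :: real)"
  shows "integrable \<nu> f"
proof -
  interpret prob_space \<nu>
    by (rule prob_space_nu)
  show ?thesis
    by (rule integrable_const_bound [where B = M]) (use bound in \<open>auto intro!: AE_nuI\<close>)
qed

text \<open>Conditioning on the first return word: the law of the concatenation is a mixture of its
  own images under the branches. Nonnegativity allows the head of the stream to be split off by the
  nonnegative integral.\<close>

lemma nu_self_similar_nonneg:
  assumes f [measurable]: "f \<in> borel_measurable borel"
    and bound: "\<And>x. x \<in> {0..1} \<Longrightarrow> 0 \<le> f x \<and> f x \<le> (M :: real)"
  shows "((\<lambda>g. wp g * (LINT x|\<nu>. f (phi g x))) has_sum (LINT x|\<nu>. f x)) G"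
proof -
  interpret prob_space \<nu>
    by (rule prob_space_nu)
  have [measurable]: "phi g \<in> borel_measurable borel" for g
    unfolding phi_def by measurable
  have val: "ennreal (LINT x|\<nu>. h x) = (\<integral>\<^sup>+x. ennreal (h x) \<partial>\<nu>)"
    if "h \<in> borel_measurable borel" "\<And>x. x \<in> {0..1} \<Longrightarrow> 0 \<le> h x \<and> h x \<le> M" for h :: "real \<Rightarrow> real"
    by (rule nn_integral_eq_integral [symmetric])
      (use that in \<open>auto intro!: AE_nuI nu_integrable [where M = M]\<close>)
  have bg: "0 \<le> f (phi g x) \<and> f (phi g x) \<le> M" if "g \<in> G" "x \<in> {0..1}" for g x
    using bound phi_in [OF G_words [OF that(1)] that(2)] by blast
  have ge: "0 \<le> (LINT x|\<nu>. f (phi g x)) \<and> (LINT x|\<nu>. f (phi g x)) \<le> M" if "g \<in> G" for g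
  proof
    show "0 \<le> (LINT x|\<nu>. f (phi g x))"
      by (rule integral_nonneg_AE, rule AE_nuI) (use bg [OF that] in blast)
    show "(LINT x|\<nu>. f (phi g x)) \<le> M"
      by (rule integral_le_const)
        (use bg [OF that] in \<open>auto intro!: AE_nuI nu_integrable [where M = M]\<close>)
  qed
  have "ennreal (LINT x|\<nu>. f x) = (\<integral>\<^sup>+x. ennreal (f x) \<partial>\<nu>)"
    by (rule val [OF f bound])
  also have "\<dots> = (\<integral>\<^sup>+ss. ennreal (f (F ss)) \<partial>S)"
    unfolding nu_distr by (rule nn_integral_distr) measurable
  also have "\<dots> = (\<integral>\<^sup>+g. (\<integral>\<^sup>+ss. ennreal (f (F (g ## ss))) \<partial>S) \<partial>measure_pmf P)"
    by (rule prob_space.nn_integral_stream_space [OF prob_space_measure_pmf]) measurable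
  also have "\<dots> = (\<integral>\<^sup>+g. ennreal (LINT x|\<nu>. f (phi g x)) \<partial>measure_pmf P)"
  proof (rule nn_integral_cong_AE, use AE_P in eventually_elim)
    case (elim g)
    have "(\<integral>\<^sup>+ss. ennreal (f (F (g ## ss))) \<partial>S) = (\<integral>\<^sup>+ss. ennreal (f (phi g (F ss))) \<partial>S)"
      by (rule nn_integral_cong_AE, use AE_S in eventually_elim) (simp add: F_Stream elim)
    also have "\<dots> = (\<integral>\<^sup>+x. ennreal (f (phi g x)) \<partial>\<nu>)"
      unfolding nu_distr by (rule nn_integral_distr [symmetric]) measurable
    also have "\<dots> = ennreal (LINT x|\<nu>. f (phi g x))"
      by (rule val [symmetric]) (use bg [OF elim] in auto)
    finally show ?case .
  qed
  also have "\<dots> = ennreal (measure_pmf.expectation P (\<lambda>g. LINT x|\<nu>. f (phi g x)))"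
    by (rule nn_integral_eq_integral)
      (use ge in \<open>auto intro!: AE_PI measure_pmf.integrable_const_bound [where B = M]\<close>)
  finally have "(LINT x|\<nu>. f x) = measure_pmf.expectation P (\<lambda>g. LINT x|\<nu>. f (phi g x))"
  proof (subst (asm) ennreal_inj)
    show "0 \<le> (LINT x|\<nu>. f x)"
      by (rule integral_nonneg_AE, rule AE_nuI) (use bound in blast)
    show "0 \<le> measure_pmf.expectation P (\<lambda>g. LINT x|\<nu>. f (phi g x))"
      by (rule integral_nonneg_AE, rule AE_PI) (use ge in blast)
  qed
  moreover have "((\<lambda>g. wp g * (LINT x|\<nu>. f (phi g x))) has_sum
      measure_pmf.expectation P (\<lambda>g. LINT x|\<nu>. f (phi g x))) G"
    by (rule expectation_P [where M = M]) (use ge in auto)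
  ultimately show ?thesis
    by simp
qed

lemma nu_self_similar:
  assumes f [measurable]: "f \<in> borel_measurable borel"
    and bound: "\<And>x. x \<in> {0..1} \<Longrightarrow> \<bar>f x\<bar> \<le> (M :: real)"
  shows "((\<lambda>g. wp g * (LINT x|\<nu>. f (phi g x))) has_sum (LINT x|\<nu>. f x)) G"
proof -
  interpret prob_space \<nu>
    by (rule prob_space_nu)
  have [measurable]: "phi g \<in> borel_measurable borel" for g
    unfolding phi_def by measurable
  have shift: "(LINT x|\<nu>. h x + M) = (LINT x|\<nu>. h x) + M"
    if "h \<in> borel_measurable borel" "\<And>x. x \<in> {0..1} \<Longrightarrow> \<bar>h x\<bar> \<le> M" for h
    using nu_integrable [OF that] prob_space by simp
  \<comment> \<open>Adding the bound \<open>M\<close> reduces to nonnegative functions; since the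
    probabilities sum to 1, the constant can be removed again.\<close>
  have "((\<lambda>g. wp g * (LINT x|\<nu>. f (phi g x) + M)) has_sum (LINT x|\<nu>. f x + M)) G"
    by (rule nu_self_similar_nonneg [where M = "2 * M"]) (use bound in \<open>auto simp: abs_le_iff\<close>, force+)
  moreover have "(LINT x|\<nu>. f (phi g x) + M) = (LINT x|\<nu>. f (phi g x)) + M" if "g \<in> G" for g
    by (rule shift) (use bound phi_in [OF G_words [OF that]] in auto)
  ultimately have "((\<lambda>g. wp g * ((LINT x|\<nu>. f (phi g x)) + M)) has_sum (LINT x|\<nu>. f x) + M) G"
    using has_sum_cong [of G "\<lambda>g. wp g * (LINT x|\<nu>. f (phi g x) + M)"
        "\<lambda>g. wp g * ((LINT x|\<nu>. f (phi g x)) + M)"] shift [of f] bound by simp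
  moreover have "((\<lambda>g. - (wp g * M)) has_sum - (1 * M)) G"
    by (intro has_sum_uminusI has_sum_cmult_left wp_has_sum)
  ultimately have "((\<lambda>g. wp g * ((LINT x|\<nu>. f (phi g x)) + M) + - (wp g * M)) has_sum
      (LINT x|\<nu>. f x) + M + - (1 * M)) G"
    by (rule has_sum_add)
  then show ?thesis
    by (simp add: algebra_simps)
qed

end

end

section \<open>Biorthogonality and the expansion of simple poles\<close>

lemma poly_bounded_unit_interval: "\<exists>M. \<forall>x\<in>{0..1}. \<bar>poly q x\<bar> \<le> (M :: real)"
proof -
  have "compact (poly q ` {0..1})"
    by (intro compact_continuous_image continuous_intros) simp
  then obtain M where "\<forall>y\<in>poly q ` {0..1}. norm y \<le> M"
    using compact_imp_bounded bounded_iff by metis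
  then show ?thesis
    by auto
qed

lemma poly_borel [measurable]: "poly (q :: real poly) \<in> borel_measurable borel"
  by (intro borel_measurable_continuous_onI continuous_intros)

lemma higher_pderiv_low:
  assumes "degree q < m"
  shows "(pderiv ^^ m) q = (0 :: real poly)"
  by (rule poly_eqI) (use assms in \<open>simp add: coeff_higher_pderiv coeff_eq_0\<close>)

lemma higher_pderiv_top:
  fixes q :: "real poly"
  assumes "degree q = m"
  shows "(pderiv ^^ m) q = [:fact m * lead_coeff q:]"
proof (rule poly_eqI)
  fix n
  show "coeff ((pderiv ^^ m) q) n = coeff [:fact m * lead_coeff q:] n"
    using assms by (cases n) (simp_all add: coeff_higher_pderiv coeff_eq_0 pochhammer_fact)
qed

lemma higher_pderiv_affine:
  "(pderiv ^^ m) (pcompose q [:a, c:]) = smult (c ^ m) (pcompose ((pderiv ^^ m) q) [:a, c:])"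
  for q :: "real poly"
proof (induction m)
  case (Suc m)
  have "pderiv [:a, c:] = [:c:]"
    by (simp add: pderiv_pCons)
  then show ?case
    using Suc by (simp add: pderiv_smult pderiv_pcompose mult.commute)
qed simp

abbreviation refl_pow :: "nat \<Rightarrow> real poly"
  where "refl_pow i \<equiv> [:1, -1:] ^ i"

lemma poly_refl_pow: "poly (refl_pow i) = (\<lambda>x. (1 - x) ^ i)"
  by (rule ext) simp

lemma higher_pderiv_refl_pow:
  "(pderiv ^^ m) (refl_pow i) = smult ((-1) ^ m * (fact m * real (i choose m))) (refl_pow (i - m))"
proof (induction m)
  case (Suc m)
  have "real (Suc m * (i choose Suc m)) = real ((i - m) * (i choose m))"
    by (simp only: binomial_absorption binomial_absorb_comp)
  then have eq: "real (Suc m) * real (i choose Suc m) = real (i - m) * real (i choose m)"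
    by (simp only: of_nat_mult)
  have der: "pderiv (refl_pow k) = smult (- real k) (refl_pow (k - 1))" for k
    by (simp add: pderiv_power pderiv_pCons)
  have "(pderiv ^^ Suc m) (refl_pow i)
      = smult ((-1) ^ m * (fact m * real (i choose m))) (pderiv (refl_pow (i - m)))"
    by (simp add: Suc pderiv_smult)
  also have "\<dots> = smult (- ((-1) ^ m * fact m * (real (i - m) * real (i choose m)))) (refl_pow (i - Suc m))"
    unfolding der by (simp add: mult_ac)
  also have "\<dots> = smult ((-1) ^ Suc m * (fact (Suc m) * real (i choose Suc m))) (refl_pow (i - Suc m))"
    unfolding eq [symmetric] by (simp add: algebra_simps)
  finally show ?case .
qed simp

text \<open>To be used with y = 1 - x and N = n + 1, where N - y = n + x.\<close>

lemma negative_binomial_sums: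
  fixes y N :: real
  assumes "\<bar>y\<bar> < N"
  shows "(\<lambda>k. real ((m + k) choose m) * y ^ k / N ^ (m + k + 1)) sums (1 / (N - y) ^ Suc m)"
proof -
  have N: "N > 0" "N - y > 0"
    using assms by auto
  have "(\<lambda>k. (- real (Suc m) gchoose k) * (- (y / N)) ^ k) sums (1 + - (y / N)) powr (- real (Suc m))"
    using assms N by (intro gen_binomial_real) (simp add: abs_divide)
  moreover have "(- real (Suc m) gchoose k) * (- (y / N)) ^ k = real ((m + k) choose m) * (y / N) ^ k" for k
  proof -
    have "real (Suc m) + real k - 1 = real (m + k)"
      by simp
    then have "(- real (Suc m) gchoose k) = (-1) ^ k * real ((m + k) choose k)"
      by (simp only: gbinomial_minus binomial_gbinomial)
    also have "(m + k) choose k = (m + k) choose m"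
      by (subst binomial_symmetric) auto
    finally have "(- real (Suc m) gchoose k) * (- (y / N)) ^ k
        = real ((m + k) choose m) * ((-1) ^ k * (- (y / N)) ^ k)"
      by (simp only: mult_ac)
    also have "(-1) ^ k * (- (y / N)) ^ k = (y / N) ^ k"
      by (simp only: power_mult_distrib [symmetric]) simp
    finally show ?thesis .
  qed
  moreover have "(1 + - (y / N)) powr (- real (Suc m)) = 1 / ((N - y) / N) ^ Suc m"
  proof -
    have "1 + - (y / N) = (N - y) / N" "(N - y) / N > 0"
      using N by (simp_all add: diff_divide_distrib)
    then show ?thesis
      by (simp only: powr_minus_divide powr_realpow)
  qed
  ultimately have "(\<lambda>k. real ((m + k) choose m) * (y / N) ^ k) sums (1 / ((N - y) / N) ^ Suc m)"
    by simp
  then have "(\<lambda>k. 1 / N ^ Suc m * (real ((m + k) choose m) * (y / N) ^ k))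
      sums (1 / N ^ Suc m * (1 / ((N - y) / N) ^ Suc m))"
    by (rule sums_mult)
  moreover have "1 / N ^ Suc m * (1 / ((N - y) / N) ^ Suc m) = 1 / (N - y) ^ Suc m"
    using N by (simp add: power_divide)
  moreover have "1 / N ^ Suc m * (real ((m + k) choose m) * (y / N) ^ k)
      = real ((m + k) choose m) * y ^ k / N ^ (m + k + 1)" for k
    by (simp add: power_divide power_add mult_ac)
  ultimately show ?thesis
    by simp
qed

context return_words
begin

lemma nu_int: "integrable (nu b w (Suc m)) (poly q)"
  using poly_bounded_unit_interval [of q] nu_integrable [of "Suc m" "poly q"] by fastforce

section \<open>Dual functionals and expansion of polynomials\<close>

definition dual :: "nat \<Rightarrow> real poly \<Rightarrow> real"
  where "dual m q = (LINT x|nu b w (Suc m). poly ((pderiv ^^ m) q) x) / fact m"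

lemma nu_poly_add:
  "(LINT x|nu b w (Suc m). poly (p + q) x)
    = (LINT x|nu b w (Suc m). poly p x) + (LINT x|nu b w (Suc m). poly q x)"
  unfolding poly_add by (rule Bochner_Integration.integral_add) (rule nu_int)+

lemma nu_poly_smult: "(LINT x|nu b w (Suc m). poly (smult c q) x) = c * (LINT x|nu b w (Suc m). poly q x)"
  unfolding poly_smult by (rule integral_mult_right_zero)

lemma dual_functional: "poly_functional (dual m)"
  unfolding poly_functional_def dual_def higher_pderiv_add higher_pderiv_smult nu_poly_add nu_poly_smult
  by (simp add: add_divide_distrib)

text \<open>Differentiating a branch m times produces \<open>wt g ^ m\<close>; with the weight in
  \<open>K\<close> this is \<open>lm (Suc m)\<close> times the probability of g under the m-th law.
  Self-similarity of that measure absorbs the sum.\<close>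

lemma dual_K: "dual m (K q) = lm (Suc m) * dual m q"
proof -
  define D where "D = (pderiv ^^ m) q"
  define E where "E g = (LINT x|nu b w (Suc m). poly D (phi g x))" for g
  have "dual m (branch g q) = wt g ^ m * E g / fact m" for g
    unfolding dual_def higher_pderiv_affine D_def [symmetric] E_def nu_poly_smult poly_branch ..
  then have "((\<lambda>g. wt g * (wt g ^ m * E g / fact m)) has_sum dual m (K q)) G"
    using K_functional [OF dual_functional, of m q] by simp
  moreover have "((\<lambda>g. lm (Suc m) * (wp (Suc m) g * E g) / fact m) has_sum
      lm (Suc m) * (LINT x|nu b w (Suc m). poly D x) / fact m) G"
  proof -
    obtain M where "\<And>x. x \<in> {0..1} \<Longrightarrow> \<bar>poly D x\<bar> \<le> M"
      using poly_bounded_unit_interval by blast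
    then have "((\<lambda>g. wp (Suc m) g * E g) has_sum (LINT x|nu b w (Suc m). poly D x)) G"
      unfolding E_def by (intro nu_self_similar) auto
    then show ?thesis
      by (intro has_sum_divide_const has_sum_cmult_right)
  qed
  moreover have "lm (Suc m) * (wp (Suc m) g * E g) / fact m = wt g * (wt g ^ m * E g / fact m)" for g
    using lam_pos [of "Suc m"] by (simp add: wp_def)
  ultimately show ?thesis
    using has_sum_unique unfolding dual_def D_def by fastforce
qed

text \<open>For n < m the derivative vanishes, for n = m it is the constant \<open>fact m\<close>,
  and for n > m both sides of \<open>dual_K\<close> can only agree at 0, the eigenvalues being
  distinct.\<close>

lemma dual_B: "dual m (B n) = (if n = m then 1 else 0)"
proof (cases n m rule: linorder_cases)
  case less
  then show ?thesis
    by (simp add: dual_def higher_pderiv_low eigenpoly_props)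
next
  case equal
  have lead: "coeff (B m) m = 1"
    using eigenpoly_props(1,2) [of m] by simp
  interpret prob_space "nu b w (Suc m)"
    by (rule prob_space_nu) simp
  show ?thesis
    using higher_pderiv_top [OF eigenpoly_props(1) [of m]] equal
    using prob_space by (simp add: dual_def eigenpoly_props lead space_nu [of "Suc m"])
next
  case greater
  have "lm (Suc n) * dual m (B n) = lm (Suc m) * dual m (B n)"
    using dual_K [of m "B n"] dual_functional [of m] by (simp add: eigenpoly_props poly_functional_def)
  then show ?thesis
    using lam_less [of "Suc m" "Suc n"] greater by simp
qed

lemma span_B: "\<forall>k\<ge>e. coeff q k = 0 \<Longrightarrow> \<exists>\<beta>. q = (\<Sum>m<e. smult (\<beta> m) (B m))"
proof (induction e arbitrary: q)
  case 0
  then show ?case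
    by (simp add: poly_eq_iff)
next
  case (Suc e)
  define r where "r = q - smult (coeff q e) (B e)"
  have "coeff (B e) e = 1"
    using eigenpoly_props(1,2) [of e] by simp
  moreover have "coeff (B e) k = 0" if "k > e" for k
    using that by (intro coeff_eq_0) (simp add: eigenpoly_props)
  ultimately have "coeff r k = 0" if "k \<ge> e" for k
    using Suc.prems that by (cases "k = e") (auto simp: r_def)
  then obtain \<beta> where "r = (\<Sum>m<e. smult (\<beta> m) (B m))"
    using Suc.IH by blast
  then have "q = (\<Sum>m<Suc e. smult ((\<beta>(e := coeff q e)) m) (B m))"
    by (simp add: r_def algebra_simps)
  then show ?case
    by blast
qed

lemma expand_B:
  assumes "degree q \<le> d"
  shows "q = (\<Sum>m\<le>d. smult (dual m q) (B m))"
proof -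
  obtain \<beta> where \<beta>: "q = (\<Sum>m<Suc d. smult (\<beta> m) (B m))"
    using span_B [of "Suc d" q] assms by (auto simp: coeff_eq_0)
  have "dual k q = \<beta> k" if "k < Suc d" for k
  proof -
    have "dual k q = (\<Sum>m<Suc d. dual k (smult (\<beta> m) (B m)))"
      by (subst \<beta>) (rule poly_functional_sum [OF dual_functional])
    also have "\<dots> = (\<Sum>m<Suc d. if m = k then \<beta> m else 0)"
      using dual_functional [of k] by (intro sum.cong refl) (simp add: poly_functional_def dual_B)
    finally show ?thesis
      using that by simp
  qed
  then show ?thesis
    using \<beta> by (simp add: lessThan_Suc_atMost)
qed

text \<open>Powers of 1 - x are preferred to powers of x because these moments are nonnegative and
  every derivative brings the same sign: the coefficients of all degrees share the sign
  (-1)^m.\<close>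

definition mom :: "nat \<Rightarrow> nat \<Rightarrow> real"
  where "mom m k = (LINT x|nu b w (Suc m). (1 - x) ^ k)"

lemma mom_nonneg: "mom m k \<ge> 0"
  unfolding mom_def by (rule integral_nonneg_AE, rule AE_nuI) auto

lemma dual_refl_pow: "dual m (refl_pow i) = (-1) ^ m * (real (i choose m) * mom m (i - m))"
  unfolding dual_def higher_pderiv_refl_pow nu_poly_smult by (simp add: mom_def poly_refl_pow)

lemma refl_pow_expand:
  "(1 - x) ^ i = (\<Sum>m\<le>i. (-1) ^ m * (real (i choose m) * mom m (i - m)) * poly (B m) x)"
proof -
  have deg: "degree (refl_pow i) \<le> i"
    using degree_power_le [of "[:1, -1 :: real:]" i] by simp
  have "poly (refl_pow i) x = (\<Sum>m\<le>i. dual m (refl_pow i) * poly (B m) x)"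
    by (subst expand_B [OF deg]) (simp add: poly_sum)
  then show ?thesis
    by (simp add: dual_refl_pow)
qed

text \<open>Up to the sign (-1)^m this is the m-th dual functional at 1/(n + x), whose m-th
  derivative is (-1)^m m!/(n + x)^(m+1).\<close>

definition recip :: "nat \<Rightarrow> nat \<Rightarrow> real"
  where "recip n m = (LINT x|nu b w (Suc m). 1 / (real n + x) ^ Suc m)"

lemma recip_bounds:
  assumes "n \<ge> 1" "x \<in> {0..1}"
  shows "0 \<le> 1 / (real n + x) ^ Suc m" "1 / (real n + x) ^ Suc m \<le> 1 / real n ^ Suc m"
proof -
  have "real n ^ Suc m \<le> (real n + x) ^ Suc m"
    using assms by (intro power_mono) auto
  moreover have "0 < real n ^ Suc m"
    using assms by simp
  ultimately show "1 / (real n + x) ^ Suc m \<le> 1 / real n ^ Suc m"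
    by (intro divide_left_mono) auto
  show "0 \<le> 1 / (real n + x) ^ Suc m"
    using assms by simp
qed

lemma recip_integrable:
  assumes "n \<ge> 1"
  shows "integrable (nu b w (Suc m)) (\<lambda>x. 1 / (real n + x) ^ Suc m)"
proof (rule nu_integrable)
  fix x :: real assume "x \<in> {0..1}"
  then show "\<bar>1 / (real n + x) ^ Suc m\<bar> \<le> 1 / real n ^ Suc m"
    using recip_bounds [OF assms, of x m] by (simp only: abs_of_nonneg)
qed auto

lemma recip_nonneg: "n \<ge> 1 \<Longrightarrow> recip n m \<ge> 0"
  unfolding recip_def by (rule integral_nonneg_AE, rule AE_nuI) (auto intro: recip_bounds)

lemma recip_le:
  assumes "n \<ge> 1"
  shows "recip n m \<le> 1 / real n ^ Suc m"
proof -
  interpret prob_space "nu b w (Suc m)"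
    by (rule prob_space_nu) simp
  show ?thesis
    unfolding recip_def
    by (rule integral_le_const [OF recip_integrable [OF assms]], rule AE_nuI)
      (simp, rule recip_bounds(2) [OF assms])
qed

text \<open>The integrand is expanded at x = 1. The radius of convergence n + 1 exceeds 1, so the
  series is valid on all of [0,1] and may be integrated termwise.\<close>

lemma recip_has_sum:
  assumes "n \<ge> 1"
  shows "((\<lambda>k. real ((m + k) choose m) * mom m k / (real n + 1) ^ (m + k + 1)) has_sum recip n m) UNIV"
proof -
  let ?M = "nu b w (Suc m)"
  define N where "N = real n + 1"
  define c where "c k = real ((m + k) choose m) / N ^ (m + k + 1)" for k
  interpret prob_space ?M
    by (rule prob_space_nu) simp
  have N: "N > 1"
    using assms by (simp add: N_def)
  have c0: "c k \<ge> 0" for k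
    using N by (simp add: c_def)
  have pw: "(\<lambda>k. c k * (1 - x) ^ k) sums (1 / (real n + x) ^ Suc m)" if "x \<in> {0..1}" for x
    using negative_binomial_sums [of "1 - x" N m] that N by (simp add: c_def N_def add.commute)
  \<comment> \<open>At x = 0 all powers of 1 - x are 1, so the coefficients themselves are summable;
    they dominate the terms on [0,1].\<close>
  have sc: "summable c"
    using sums_summable [OF pw [of 0]] by simp
  have int: "integrable ?M (\<lambda>x. c k * (1 - x) ^ k)" for k
    using nu_int [of m "refl_pow k"] by (simp add: poly_refl_pow)
  have mom_le: "mom m k \<le> 1" for k
    unfolding mom_def
    using nu_int [of m "refl_pow k"] unfolding poly_refl_pow
    by (intro integral_le_const AE_nuI) (auto intro: power_le_one)
  have I: "(\<integral>x. c k * (1 - x) ^ k \<partial>?M) = c k * mom m k" for k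
    by (simp add: mom_def)
  have "(\<lambda>k. \<integral>x. c k * (1 - x) ^ k \<partial>?M) sums (\<integral>x. (\<Sum>k. c k * (1 - x) ^ k) \<partial>?M)"
  proof (rule sums_integral [OF int])
    show "AE x in ?M. summable (\<lambda>k. norm (c k * (1 - x) ^ k))"
    proof (rule AE_nuI)
      fix x :: real assume "x \<in> {0..1}"
      then show "summable (\<lambda>k. norm (c k * (1 - x) ^ k))"
        using sums_summable [OF pw] c0 by (simp add: abs_mult power_abs)
    qed simp
    have "norm (\<integral>x. norm (c k * (1 - x) ^ k) \<partial>?M) \<le> c k" for k
    proof -
      have "(\<integral>x. norm (c k * (1 - x) ^ k) \<partial>?M) = (\<integral>x. c k * (1 - x) ^ k \<partial>?M)"
        by (rule integral_cong_AE)
          (use c0 in \<open>auto intro!: AE_nuI simp: abs_mult power_abs\<close>)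
      also have "\<dots> = c k * mom m k"
        by (rule I)
      finally have eq: "(\<integral>x. norm (c k * (1 - x) ^ k) \<partial>?M) = c k * mom m k" .
      show ?thesis
        unfolding eq using mult_left_le [OF mom_le c0, of k k] c0 [of k] mom_nonneg [of m k] by simp
    qed
    then show "summable (\<lambda>k. \<integral>x. norm (c k * (1 - x) ^ k) \<partial>?M)"
      by (intro summable_comparison_test' [OF sc])
  qed
  also have "(\<integral>x. (\<Sum>k. c k * (1 - x) ^ k) \<partial>?M) = recip n m"
    unfolding recip_def
  proof (rule integral_cong_AE)
    show "AE x in ?M. (\<Sum>k. c k * (1 - x) ^ k) = 1 / (real n + x) ^ Suc m"
      by (rule AE_nuI) (use pw in \<open>auto simp: sums_iff\<close>)
  qed simp_all
  finally have "(\<lambda>k. c k * mom m k) sums recip n m"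
    by (simp only: I)
  then have "((\<lambda>k. c k * mom m k) has_sum recip n m) UNIV"
    by (rule sums_nonneg_imp_has_sum) (use c0 mom_nonneg in auto)
  then show ?thesis
    by (simp add: c_def N_def)
qed

text \<open>One double series is summed in two ways: over k for fixed m it gives
  \<open>recip\<close>, and along i = m + k it gives \<open>refl_pow_expand\<close> and so the
  geometric series of 1/(n + x). As all \<open>a m k\<close> are nonnegative, the assumption is
  absolute summability of the double series.\<close>

lemma recip_expansion:
  assumes n: "n \<ge> 1" and x: "x \<in> {0..1}"
    and sum: "(\<lambda>m. recip n m * \<bar>poly (B m) x\<bar>) summable_on UNIV"
  shows "((\<lambda>m. (-1) ^ m * recip n m * poly (B m) x) has_sum 1 / (real n + x)) UNIV"
proof -
  define N where "N = real n + 1"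
  define a where "a m k = real ((m + k) choose m) * mom m k / N ^ (m + k + 1)" for m k
  have N: "N > 1"
    using n by (simp add: N_def)
  have a0: "a m k \<ge> 0" for m k
    using N mom_nonneg by (simp add: a_def)
  have a_sum: "(a m has_sum recip n m) UNIV" for m
    using recip_has_sum [OF n, of m] by (simp add: a_def [abs_def] N_def)
  define f where "f = (\<lambda>(m, k). (-1) ^ m * a m k * poly (B m) x)"
  have "(\<lambda>(m, k). a m k * \<bar>poly (B m) x\<bar>) summable_on (SIGMA m:UNIV. UNIV)"
  proof (rule summable_on_SigmaI)
    show "((\<lambda>k. case (m, k) of (m, k) \<Rightarrow> a m k * \<bar>poly (B m) x\<bar>) has_sum recip n m * \<bar>poly (B m) x\<bar>) UNIV" for m
      using has_sum_cmult_left [OF a_sum] by simp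
  qed (use sum a0 in auto)
  then have "(\<lambda>p. norm (f p)) summable_on UNIV \<times> UNIV"
    using a0 by (simp add: f_def case_prod_unfold abs_mult)
  then have f: "f summable_on UNIV \<times> UNIV"
    using summable_on_iff_abs_summable_on_real by blast
  then obtain s where s: "(f has_sum s) (UNIV \<times> UNIV)"
    by (auto simp: summable_on_def)
  have 1: "((\<lambda>m. (-1) ^ m * recip n m * poly (B m) x) has_sum s) UNIV"
  proof (rule has_sum_SigmaD [OF s])
    fix m
    show "((\<lambda>k. f (m, k)) has_sum (-1) ^ m * recip n m * poly (B m) x) UNIV"
      unfolding f_def using has_sum_cmult_left [OF has_sum_cmult_right [OF a_sum]] by simp
  qed
  have "bij_betw (\<lambda>(i, m). (m, i - m)) (SIGMA i:UNIV. {..i :: nat}) (UNIV \<times> UNIV)"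
    by (rule bij_betw_byWitness [where f' = "\<lambda>(m, k). (m + k, m)"]) auto
  then have "((\<lambda>p. f (case p of (i, m) \<Rightarrow> (m, i - m))) has_sum s) (SIGMA i:UNIV. {..i})"
    using s by (subst has_sum_reindex_bij_betw)
  then have "((\<lambda>i. (1 - x) ^ i / N ^ Suc i) has_sum s) UNIV"
  proof (rule has_sum_SigmaD)
    fix i
    have "(\<Sum>m\<le>i. f (m, i - m)) = (1 - x) ^ i / N ^ Suc i"
      unfolding refl_pow_expand [of x i] sum_divide_distrib
      by (intro sum.cong refl) (simp add: f_def a_def)
    then show "((\<lambda>m. f (case (i, m) of (i, m) \<Rightarrow> (m, i - m))) has_sum (1 - x) ^ i / N ^ Suc i) {..i}"
      by (intro has_sum_finiteI) auto
  qed
  then have "(\<lambda>i. (1 - x) ^ i / N ^ Suc i) sums s"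
    by (rule has_sum_imp_sums)
  moreover have "(\<lambda>i. (1 - x) ^ i / N ^ Suc i) sums (1 / (real n + x))"
    using negative_binomial_sums [of "1 - x" N 0] x N by (simp add: N_def add.commute)
  ultimately have "s = 1 / (real n + x)"
    by (rule sums_unique2)
  with 1 show ?thesis
    by simp
qed

text \<open>Every other return word has at least one digit more than \<open>g\<^sub>0\<close>, which
  costs a factor b^-m: for large m the first random word is almost surely \<open>g\<^sub>0\<close>,
  up to a geometrically small probability.\<close>

lemma wp_gs_ge: "1 - wp (Suc m) g\<^sub>0 \<le> 1 / wt g\<^sub>0 * (1 / real b) ^ m"
proof -
  have G': "(f has_sum s - f g\<^sub>0) (G - {g\<^sub>0})" if "(f has_sum s) G" for f :: "nat list \<Rightarrow> real" and s
    using gs_G by (intro has_sum_Diff that has_sum_finiteI) auto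
  have pos: "wt g\<^sub>0 > 0" "lm (Suc m) > 0"
    using wt_pos lam_pos by auto
  have "lm (Suc m) - wt g\<^sub>0 ^ Suc m \<le> (1 - wt g\<^sub>0) * (wt g\<^sub>0 ^ m * (1 / real b) ^ m)"
  proof (rule has_sum_mono)
    show "((\<lambda>g. wt g ^ Suc m) has_sum lm (Suc m) - wt g\<^sub>0 ^ Suc m) (G - {g\<^sub>0})"
      by (rule G') (simp only: lam_has_sum)
    show "((\<lambda>g. wt g * (wt g\<^sub>0 ^ m * (1 / real b) ^ m)) has_sum (1 - wt g\<^sub>0) * (wt g\<^sub>0 ^ m * (1 / real b) ^ m)) (G - {g\<^sub>0})"
      by (intro has_sum_cmult_left G' wt_has_sum)
    fix g assume g: "g \<in> G - {g\<^sub>0}"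
    then obtain u where u: "g = u @ g\<^sub>0" "u \<noteq> []"
      using G_decompose [of g] by blast
    have "wt g \<le> wt g\<^sub>0 * (1 / real b)"
      using mult_left_mono [OF wt_le [OF u(2)], of "wt g\<^sub>0"] pos(1) unfolding u(1) wt_append
      by (simp only: mult.commute less_imp_le)
    then have "wt g ^ m \<le> (wt g\<^sub>0 * (1 / real b)) ^ m"
      using wt_pos [of g] by (intro power_mono) auto
    then have "wt g * wt g ^ m \<le> wt g * (wt g\<^sub>0 * (1 / real b)) ^ m"
      using wt_pos [of g] by (intro mult_left_mono) auto
    then show "wt g ^ Suc m \<le> wt g * (wt g\<^sub>0 ^ m * (1 / real b) ^ m)"
      by (simp only: power_mult_distrib power_Suc)
  qed
  also have "\<dots> \<le> 1 * (wt g\<^sub>0 ^ m * (1 / real b) ^ m)"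
    using pos by (intro mult_right_mono) auto
  finally have le: "lm (Suc m) - wt g\<^sub>0 ^ Suc m \<le> wt g\<^sub>0 ^ m * (1 / real b) ^ m"
    by simp
  have "1 - wp (Suc m) g\<^sub>0 = (lm (Suc m) - wt g\<^sub>0 ^ Suc m) / lm (Suc m)"
    using pos by (simp add: wp_def diff_divide_distrib)
  also have "\<dots> \<le> (wt g\<^sub>0 ^ m * (1 / real b) ^ m) / lm (Suc m)"
    using le pos by (intro divide_right_mono) auto
  also have "\<dots> \<le> (wt g\<^sub>0 ^ m * (1 / real b) ^ m) / wt g\<^sub>0 ^ Suc m"
  proof (rule divide_left_mono)
    show "wt g\<^sub>0 ^ Suc m \<le> lm (Suc m)"
      by (rule wt_power_le_lam [OF _ gs_G]) simp
  qed (use pos in auto)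
  also have "\<dots> = 1 / wt g\<^sub>0 * (1 / real b) ^ m"
    using pos b_gt by simp
  finally show ?thesis .
qed

end

section \<open>Decay of the coefficients\<close>

lemma has_sum_product:
  fixes f :: "'a \<Rightarrow> real" and g :: "'c \<Rightarrow> real"
  assumes f: "(f has_sum s) A" and g: "(g has_sum t) B"
    and nonneg: "\<And>x. x \<in> A \<Longrightarrow> f x \<ge> 0" "\<And>y. y \<in> B \<Longrightarrow> g y \<ge> 0"
  shows "((\<lambda>(x, y). f x * g y) has_sum s * t) (A \<times> B)"
proof -
  have inner: "((\<lambda>y. case (x, y) of (x, y) \<Rightarrow> f x * g y) has_sum f x * t) B" for x
    using has_sum_cmult_right [OF g] by simp
  have outer: "((\<lambda>x. f x * t) has_sum s * t) A"
    by (rule has_sum_cmult_left [OF f])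
  show ?thesis
    by (rule has_sum_SigmaI [OF inner outer summable_on_SigmaI [OF inner has_sum_imp_summable [OF outer]]])
      (use nonneg in auto)
qed

lemma abs_summable_on_dominated:
  fixes f g :: "'a \<Rightarrow> real"
  assumes "g summable_on A" "\<And>x. x \<in> A \<Longrightarrow> \<bar>f x\<bar> \<le> g x"
  shows "f summable_on A"
  using Infinite_Sum.abs_summable_on_comparison_test' [of g A f] assms
    summable_on_iff_abs_summable_on_real [of f A] by simp

lemma poly_antiderivative: "\<exists>H. pderiv H = (q :: real poly)"
proof
  have "pderiv (\<Sum>i\<le>degree q. monom (coeff q i / real (Suc i)) (Suc i))
      = (\<Sum>i\<le>degree q. pderiv (monom (coeff q i / real (Suc i)) (Suc i)))"
    using higher_pderiv_sum [of 1] by simp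
  also have "\<dots> = q"
    using poly_as_sum_of_monoms [of q] by (simp add: pderiv_monom del: of_nat_Suc)
  finally show "pderiv (\<Sum>i\<le>degree q. monom (coeff q i / real (Suc i)) (Suc i)) = q" .
qed

lemma integral_poly_unit_interval:
  assumes "pderiv H = q"
  shows "integral {0..1} (poly q) = poly H 1 - poly H (0 :: real)"
proof -
  have "(poly q has_integral poly H 1 - poly H 0) {0..1}"
  proof (rule fundamental_theorem_of_calculus)
    fix x :: real
    show "(poly H has_vector_derivative poly q x) (at x within {0..1})"
      using poly_DERIV [of H x] assms
      by (simp add: has_real_derivative_iff_has_vector_derivative [symmetric] has_field_derivative_at_within)
  qed simp
  then show ?thesis
    by (rule integral_unique)
qed

context return_words
begin

text \<open>The poles of \<open>f_L\<close> are the points -n for n in this set. Without leading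
  zeros a word is determined by its value, so the sums may run over n.\<close>

definition A :: "nat set"
  where "A = word_int b ` lang_L_pos b w"

lemma lang_L_posD:
  assumes "g \<in> lang_L_pos b w"
  shows "g \<in> words b" "g \<noteq> []" "hd g > 0" "g \<in> lang_L b w"
  using assms by (auto simp: lang_L_pos_def lang_L_def)

lemma bij_A: "bij_betw (word_int b) (lang_L_pos b w) A"
  unfolding A_def
  by (rule inj_on_imp_bij_betw, rule inj_on_inverseI [where g = "digits b"])
    (use digits_word_int [OF b_gt] lang_L_posD in auto)

lemma A_ge_1: "n \<in> A \<Longrightarrow> n \<ge> 1"
  using word_int_pos [OF b_gt] lang_L_posD by (auto simp: A_def Suc_le_eq)

lemma inverse_word_int_le:
  assumes "g \<in> words b" "g \<noteq> []" "hd g > 0"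
  shows "1 / real (word_int b g) \<le> real b * wt g"
proof -
  have "b ^ (length g - 1) \<le> word_int b g"
    using word_int_ge assms by blast
  then have "real (b ^ (length g - 1)) \<le> real (word_int b g)"
    by (rule of_nat_mono)
  then have "1 / real (word_int b g) \<le> 1 / real b ^ (length g - 1)"
    using b_gt by (intro frac_le) auto
  also have "\<dots> = real b * wt g"
    using b_gt assms(2) by (cases g) auto
  finally show ?thesis .
qed

lemma A_summable: "(\<lambda>n. 1 / real n) summable_on A"
proof -
  have "wt summable_on lang_L b w"
    unfolding lang_L_eq by (rule first_passage_weight_summable [OF b_gt unit_steps_occ [OF w_ne]])
  then have "wt summable_on lang_L_pos b w"
    by (rule summable_on_subset) (auto simp: lang_L_pos_def)
  then have "(\<lambda>g. real b * wt g) summable_on lang_L_pos b w"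
    by (rule summable_on_cmult_right)
  then have "(\<lambda>g. 1 / real (word_int b g)) summable_on lang_L_pos b w"
    by (rule summable_on_comparison_test) (use inverse_word_int_le lang_L_posD in auto)
  then show ?thesis
    using summable_on_reindex_bij_betw [OF bij_A, of "\<lambda>n. 1 / real n"] by simp
qed

text \<open>The logarithmic mass ln((n + 1)/n) of a word with value n is additive: its children have
  the values bn, ..., bn + b - 1, and the logarithms telescope. Words with a leading zero get mass
  0, and the digits 1, ..., b - 1 give the root ln b.\<close>

lemma A_log_has_sum: "((\<lambda>n. ln ((real n + 1) / real n)) has_sum ln (real b)) A"
proof -
  define h where "h u = (if u = [] then ln (real b) else if hd u = 0 then 0
    else ln (real (word_int b u) + 1) - ln (real (word_int b u)))" for u
  have tele: "(\<Sum>d<b. ln (real (c + d) + 1) - ln (real (c + d))) = ln (real (c + b)) - ln (real c)" for c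
    using sum_lessThan_telescope [of "\<lambda>d. ln (real (c + d))" b] by (simp add: add.commute)
  have "(h has_sum h []) (lang_L b w)"
    unfolding lang_L_eq
  proof (rule first_passage_has_sum [OF b_gt unit_steps_occ [OF w_ne] live_tendsto_0 [OF b_gt w_ne w_words order_refl]])
    fix u assume "u \<in> words b"
    show "h u = (\<Sum>d<b. h (u @ [d]))"
    proof (cases "u = []")
      case True
      obtain b' where b': "b = Suc b'"
        using b_gt by (cases b) auto
      have "(\<Sum>d<b. h (u @ [d])) = (\<Sum>d<b'. h [Suc d])"
        unfolding b' True by (subst sum.lessThan_Suc_shift) (simp add: h_def)
      also have "\<dots> = (\<Sum>d<b'. ln (real (Suc (Suc d))) - ln (real (Suc d)))"
        using word_int_snoc [of b "[]"] by (intro sum.cong refl) (simp add: h_def add.commute)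
      also have "\<dots> = ln (real b)"
        using sum_lessThan_telescope [of "\<lambda>d. ln (real (Suc d))" b'] by (simp add: b')
      finally show ?thesis
        by (simp add: h_def True)
    next
      case False
      show ?thesis
      proof (cases "hd u = 0")
        case True
        then show ?thesis
          using False by (simp add: h_def)
      next
        case hd: False
        define n where "n = word_int b u"
        have n: "n > 0"
          using word_int_pos [OF b_gt False] hd by (simp add: n_def)
        have "(\<Sum>d<b. h (u @ [d])) = (\<Sum>d<b. ln (real (b * n + d) + 1) - ln (real (b * n + d)))"
          using False hd by (intro sum.cong refl) (simp add: h_def word_int_snoc n_def)
        also have "\<dots> = ln (real (b * n + b)) - ln (real (b * n))"
          by (rule tele)
        also have "\<dots> = ln (real b * (real n + 1)) - ln (real b * real n)"
          by (simp add: algebra_simps)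
        also have "\<dots> = ln (real n + 1) - ln (real n)"
          using n b_gt by (simp add: ln_mult)
        finally show ?thesis
          using False hd by (simp add: h_def n_def)
      qed
    qed
  next
    fix u assume u: "u \<in> words b"
    show "\<bar>h u\<bar> \<le> real b / real b ^ length u"
    proof (cases "u = [] \<or> hd u = 0")
      case True
      then show ?thesis
        using b_gt ln_le_minus_one [of "real b"] by (auto simp: h_def)
    next
      case False
      define n where "n = word_int b u"
      have n: "n > 0"
        using word_int_pos [OF b_gt] False by (simp add: n_def)
      have "1 + 1 / real n = (real n + 1) / real n"
        using n by (simp add: field_simps)
      then have "h u = ln (1 + 1 / real n)"
        using False n ln_div [of "real n + 1" "real n"] by (simp add: h_def n_def [symmetric])
      also have "\<dots> \<le> 1 / real n"
        using n by (intro ln_add_one_self_le_self) auto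
      also have "\<dots> \<le> real b * wt u"
        using inverse_word_int_le u False by (simp add: n_def)
      finally have "h u \<le> real b / real b ^ length u"
        by simp
      moreover have "h u \<ge> 0"
        using \<open>h u = ln (1 + 1 / real n)\<close> by simp
      ultimately show ?thesis
        by simp
    qed
  qed
  moreover have "h [] = ln (real b)"
    by (simp add: h_def)
  ultimately have "(h has_sum ln (real b)) (lang_L b w)"
    by simp
  then have "(h has_sum ln (real b)) (lang_L_pos b w)"
  proof (rule has_sum_cong_neutral [THEN iffD1, rotated -1])
    show "h g = 0" if "g \<in> lang_L b w - lang_L_pos b w" for g
      using that by (auto simp: h_def lang_L_pos_def lang_L_def)
  qed (auto simp: lang_L_pos_def h_def)
  moreover have "h g = ln ((real (word_int b g) + 1) / real (word_int b g))" if "g \<in> lang_L_pos b w" for g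
    using lang_L_posD [OF that] word_int_pos [OF b_gt, of g] by (simp add: h_def ln_div)
  ultimately have "((\<lambda>g. ln ((real (word_int b g) + 1) / real (word_int b g))) has_sum ln (real b)) (lang_L_pos b w)"
    by (simp cong: has_sum_cong)
  then show ?thesis
    using has_sum_reindex_bij_betw [OF bij_A, of "\<lambda>n. ln ((real n + 1) / real n)"] by simp
qed

text \<open>The pole at \<open>-1\<close> only occurs for \<open>w = [1]\<close>; there the measures concentrate away from \<open>0\<close>.\<close>

lemma gs_if_1_in_A:
  assumes "1 \<in> A"
  shows "g\<^sub>0 = [1]"
proof -
  obtain g where g: "g \<in> lang_L_pos b w" "word_int b g = 1"
    using assms by (auto simp: A_def)
  note gD = lang_L_posD [OF g(1)]
  have "b ^ (length g - 1) \<le> 1"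
    using word_int_ge [of g b] gD g(2) by simp
  then have "length g - 1 = 0"
    using b_gt by (metis leD nat_neq_iff one_less_power zero_less_iff_neq_zero)
  then obtain d where d: "g = [d]"
    using gD(2) by (cases g) auto
  have "d = 1"
    using g(2) word_int_snoc [of b "[]" d] by (simp add: d)
  then have "w = [1]"
    using lang_L_suffix [OF w_ne gD(4)] w_ne unfolding d by (auto simp: suffix_Cons)
  moreover obtain c where "g\<^sub>0 = [c]"
  proof -
    have "length g\<^sub>0 \<le> 1"
      using short_return gs_min order_trans \<open>w = [1]\<close> by fastforce
    then show ?thesis
      using G_ne [OF gs_G] that by (cases g\<^sub>0) auto
  qed
  ultimately show ?thesis
    using lang_G_suffix [OF w_ne gs_G] by (auto simp: suffix_Cons)
qed

text \<open>For \<open>g\<^sub>0 = [1]\<close> the branch maps [0,1] to points at distance at least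
  1 + 1/b from the pole -1; the rate is the reciprocal of this distance.\<close>

abbreviation \<theta> :: real
  where "\<theta> \<equiv> real b / (real b + 1)"

lemma \<theta>_ge: "\<theta> \<ge> 1 / 2" "\<theta> \<ge> 1 / real b"
proof -
  show "\<theta> \<ge> 1 / 2"
    using b_gt by (simp add: field_simps)
  have "1 / real b \<le> 1 / 2"
    using b_gt by (intro divide_left_mono) auto
  with \<open>\<theta> \<ge> 1 / 2\<close> show "\<theta> \<ge> 1 / real b"
    by linarith
qed

text \<open>The integrand does not decay at x = 0. Conditioning on the first return word repairs
  this: behind \<open>g\<^sub>0\<close> the integrand is at most \<open>\<theta> ^ Suc m\<close>,
  and all other words together have probability at most b * b^-m.\<close>

lemma recip_1_le:
  assumes "g\<^sub>0 = [1]"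
  shows "recip 1 m \<le> (1 + real b) * \<theta> ^ m"
proof -
  let ?M = "nu b w (Suc m)"
  define E where "E g = (LINT x|?M. 1 / (1 + phi g x) ^ Suc m)" for g
  define t where "t = \<theta> ^ Suc m"
  interpret prob_space ?M
    by (rule prob_space_nu) simp
  have wt_gs: "wt g\<^sub>0 = 1 / real b" and frac: "word_frac b g\<^sub>0 = 1 / real b"
    using assms word_int_snoc [of b "[]" 1] by (simp_all add: word_frac_def)
  have phi_meas [measurable]: "phi g \<in> borel_measurable borel" for g
    unfolding phi_def by measurable
  have bound: "\<bar>1 / (1 + x) ^ Suc m\<bar> \<le> 1" if "x \<in> {0..1}" for x :: real
    using recip_bounds [of 1 x m] that by (simp only: abs_of_nonneg) simp
  have int: "integrable ?M (\<lambda>x. 1 / (1 + phi g x) ^ Suc m)" if "g \<in> G" for g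
  proof (rule nu_integrable)
    show "\<bar>1 / (1 + phi g x) ^ Suc m\<bar> \<le> 1" if "x \<in> {0..1}" for x
      using bound phi_in [OF G_words [OF \<open>g \<in> G\<close>] that] by blast
  qed auto
  have E1: "E g \<le> 1" if "g \<in> G" for g
    unfolding E_def
  proof (rule integral_le_const [OF int [OF that]], rule AE_nuI)
    fix x :: real assume "x \<in> {0..1}"
    then show "1 / (1 + phi g x) ^ Suc m \<le> 1"
      using bound [OF phi_in [OF G_words [OF that]]] abs_le_D1 by blast
  qed simp
  have Egs: "E g\<^sub>0 \<le> t"
    unfolding E_def
  proof (rule integral_le_const [OF int [OF gs_G]], rule AE_nuI)
    fix x :: real assume x: "x \<in> {0..1}"
    have "(real b + 1) / real b \<le> 1 + phi g\<^sub>0 x"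
      using x b_gt unfolding phi_def wt_gs frac by (simp add: field_simps)
    then have "((real b + 1) / real b) ^ Suc m \<le> (1 + phi g\<^sub>0 x) ^ Suc m"
      using b_gt by (intro power_mono) auto
    moreover have "0 < ((real b + 1) / real b) ^ Suc m"
      using b_gt by (intro zero_less_power) auto
    ultimately have "1 / (1 + phi g\<^sub>0 x) ^ Suc m \<le> 1 / ((real b + 1) / real b) ^ Suc m"
      by (intro frac_le) auto
    then show "1 / (1 + phi g\<^sub>0 x) ^ Suc m \<le> t"
      by (simp only: t_def power_divide divide_divide_eq_right mult_1)
  qed simp
  have "recip 1 m \<le> wp (Suc m) g\<^sub>0 * t + (1 - wp (Suc m) g\<^sub>0)"
  proof (rule has_sum_mono)
    show "((\<lambda>g. wp (Suc m) g * E g) has_sum recip 1 m) G"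
      using nu_self_similar [of "Suc m" "\<lambda>x. 1 / (1 + x) ^ Suc m" 1] bound
      by (simp add: E_def recip_def)
    have "((\<lambda>g. if g = g\<^sub>0 then wp (Suc m) g\<^sub>0 * (t - 1) else 0) has_sum wp (Suc m) g\<^sub>0 * (t - 1)) G"
      by (rule has_sum_finite_neutralI [of "{g\<^sub>0}"]) (use gs_G in auto)
    then have "((\<lambda>g. wp (Suc m) g + (if g = g\<^sub>0 then wp (Suc m) g\<^sub>0 * (t - 1) else 0)) has_sum
        1 + wp (Suc m) g\<^sub>0 * (t - 1)) G"
      by (intro has_sum_add wp_has_sum) simp
    then show "((\<lambda>g. wp (Suc m) g + (if g = g\<^sub>0 then wp (Suc m) g\<^sub>0 * (t - 1) else 0)) has_sum
        wp (Suc m) g\<^sub>0 * t + (1 - wp (Suc m) g\<^sub>0)) G"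
      by (simp add: algebra_simps)
    fix g assume g: "g \<in> G"
    have w0: "wp (Suc m) g \<ge> 0"
      by (rule wp_nonneg) simp
    show "wp (Suc m) g * E g \<le> wp (Suc m) g + (if g = g\<^sub>0 then wp (Suc m) g\<^sub>0 * (t - 1) else 0)"
      using mult_left_mono [OF E1 [OF g] w0] mult_left_mono [OF Egs w0] by (auto simp: algebra_simps)
  qed
  also have "\<dots> \<le> 1 * t + real b * (1 / real b) ^ m"
  proof (rule add_mono)
    have "wp (Suc m) g\<^sub>0 \<le> 1"
      using finite_sum_le_has_sum [OF wp_has_sum, of "Suc m" "{g\<^sub>0}"] gs_G wp_nonneg by simp
    then show "wp (Suc m) g\<^sub>0 * t \<le> 1 * t"
      by (intro mult_right_mono) (auto simp: t_def)
    show "1 - wp (Suc m) g\<^sub>0 \<le> real b * (1 / real b) ^ m"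
      using wp_gs_ge [of m] unfolding wt_gs by simp
  qed
  also have "\<dots> \<le> 1 * \<theta> ^ m + real b * \<theta> ^ m"
  proof (rule add_mono)
    have "\<theta> * \<theta> ^ m \<le> 1 * \<theta> ^ m"
      by (intro mult_right_mono) auto
    then show "1 * t \<le> 1 * \<theta> ^ m"
      by (simp add: t_def)
    show "real b * (1 / real b) ^ m \<le> real b * \<theta> ^ m"
      using \<theta>_ge(2) by (intro mult_left_mono power_mono) auto
  qed
  finally show ?thesis
    by (simp add: algebra_simps)
qed

text \<open>The factor 1/n is retained to make the bound summable over the poles; for n \<ge> 2 the
  decay in m comes from 1/n \<le> 1/2 \<le> \<theta>.\<close>

lemma recip_decay:
  assumes "n \<in> A"
  shows "recip n m \<le> (1 + real b) * \<theta> ^ m * (1 / real n)"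
proof (cases "n = 1")
  case True
  then show ?thesis
    using recip_1_le [OF gs_if_1_in_A] assms by simp
next
  case False
  then have n: "n \<ge> 2"
    using A_ge_1 [OF assms] by simp
  have "recip n m \<le> 1 / real n ^ Suc m"
    using n by (intro recip_le) simp
  also have "\<dots> = (1 / real n) ^ m * (1 / real n)"
    by (simp add: power_one_over)
  also have "\<dots> \<le> \<theta> ^ m * (1 / real n)"
  proof -
    have "1 / real n \<le> 1 / 2"
      using n by (intro divide_left_mono) auto
    then have "1 / real n \<le> \<theta>"
      using \<theta>_ge(1) by linarith
    then show ?thesis
      by (intro mult_right_mono power_mono) auto
  qed
  also have "\<dots> \<le> (1 + real b) * (\<theta> ^ m * (1 / real n))"
    using mult_right_mono [of 1 "1 + real b" "\<theta> ^ m * (1 / real n)"] by simp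
  finally show ?thesis
    by (simp add: mult.assoc)
qed

definition coef :: "nat \<Rightarrow> real"
  where "coef m = (\<Sum>\<^sub>\<infinity>n\<in>A. recip n m)"

lemma coef_has_sum: "((\<lambda>n. recip n m) has_sum coef m) A"
proof -
  have "(\<lambda>n. (1 + real b) * \<theta> ^ m * (1 / real n)) summable_on A"
    by (rule summable_on_cmult_right [OF A_summable])
  then have "(\<lambda>n. recip n m) summable_on A"
    by (rule summable_on_comparison_test) (use recip_decay recip_nonneg A_ge_1 in auto)
  then show ?thesis
    unfolding coef_def by (rule has_sum_infsum)
qed

lemma coef_nonneg: "coef m \<ge> 0"
  using coef_has_sum by (rule has_sum_nonneg) (use recip_nonneg A_ge_1 in auto)

lemma coef_le: "coef m \<le> (1 + real b) * (\<Sum>\<^sub>\<infinity>n\<in>A. 1 / real n) * \<theta> ^ m"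
proof -
  have "((\<lambda>n. (1 + real b) * \<theta> ^ m * (1 / real n)) has_sum (1 + real b) * \<theta> ^ m * (\<Sum>\<^sub>\<infinity>n\<in>A. 1 / real n)) A"
    by (intro has_sum_cmult_right has_sum_infsum A_summable)
  then show ?thesis
    using has_sum_mono [OF coef_has_sum] recip_decay by (fastforce simp: mult_ac)
qed

text \<open>The decay rate of the coefficients beats the growth rate of the eigenpolynomials.\<close>

lemma rates:
  obtains c \<rho> where "0 < \<rho>" "\<rho> < 1" "0 \<le> c"
    "\<And>m x. x \<in> {0..1} \<Longrightarrow> \<bar>\<theta> ^ m * poly (B m) x\<bar> \<le> c * \<rho> ^ m"
proof -
  obtain c where c: "c > 0" "\<And>m x. x \<in> {0..1} \<Longrightarrow> \<bar>poly (B m) x\<bar> \<le> c * (1 + 1 / (2 * real b)) ^ m"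
    using eigenpoly_growth [of "1 / (2 * real b)"] b_gt by auto
  \<comment> \<open>With the growth parameter 1/(2b) the product of the two rates is (2b + 1)/(2b +
    2) < 1.\<close>
  define \<rho> where "\<rho> = \<theta> * (1 + 1 / (2 * real b))"
  have \<rho>: "\<rho> = (2 * real b + 1) / (2 * real b + 2)"
    using b_gt by (simp add: \<rho>_def divide_simps)
  show thesis
  proof (rule that [of \<rho> c])
    show "\<bar>\<theta> ^ m * poly (B m) x\<bar> \<le> c * \<rho> ^ m" if "x \<in> {0..1}" for m x
    proof -
      have "\<bar>\<theta> ^ m * poly (B m) x\<bar> = \<theta> ^ m * \<bar>poly (B m) x\<bar>"
        by (simp add: abs_mult power_abs)
      also have "\<dots> \<le> \<theta> ^ m * (c * (1 + 1 / (2 * real b)) ^ m)"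
        using c(2) [OF that] by (intro mult_left_mono) auto
      also have "\<dots> = c * \<rho> ^ m"
        by (simp only: \<rho>_def power_mult_distrib mult_ac)
      finally show ?thesis .
    qed
  qed (use c b_gt in \<open>auto simp: \<rho>\<close>)
qed

lemma geometric_summable_on: "0 \<le> \<rho> \<Longrightarrow> \<rho> < (1 :: real) \<Longrightarrow> (\<lambda>m. \<rho> ^ m) summable_on UNIV"
  by (rule summable_nonneg_imp_summable_on) (auto intro: summable_geometric)

text \<open>The bound -1/2 leaves an open neighbourhood of [0,1] at distance at least 1/2 from all
  poles, as required for two-sided derivatives at 0.\<close>

lemma f_L_has_sum:
  assumes "z > -1/2"
  shows "((\<lambda>n. 1 / (real n + z)) has_sum f_L b w z) A"
proof -
  have "(\<lambda>n. 2 * (1 / real n)) summable_on A"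
    by (rule summable_on_cmult_right [OF A_summable])
  then have "(\<lambda>n. 1 / (real n + z)) summable_on A"
  proof (rule summable_on_comparison_test)
    fix n assume "n \<in> A"
    then have n: "real n \<ge> 1"
      using A_ge_1 by simp
    then have "real n / 2 \<le> real n + z"
      using assms by simp
    then have "1 / (real n + z) \<le> 1 / (real n / 2)"
      using n by (intro divide_left_mono) auto
    then show "1 / (real n + z) \<le> 2 * (1 / real n)"
      by simp
    show "0 \<le> 1 / (real n + z)"
      using n assms by simp
  qed
  then have "((\<lambda>n. 1 / (real n + z)) has_sum (\<Sum>\<^sub>\<infinity>n\<in>A. 1 / (real n + z))) A"
    by (rule has_sum_infsum)
  moreover have "(\<Sum>\<^sub>\<infinity>n\<in>A. 1 / (real n + z)) = f_L b w z"
    unfolding f_L_def lang_L_pos_def [symmetric]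
    by (rule infsum_reindex_bij_betw [OF bij_A, of "\<lambda>n. 1 / (real n + z)", symmetric])
  ultimately show ?thesis
    by simp
qed

text \<open>The pole expansions are summed over \<open>A\<close>. The double family is dominated by
  a multiple of 1/n times \<rho>^m, a product of summable families, so the sums may be
  exchanged.\<close>

lemma f_L_expansion:
  assumes x: "x \<in> {0..1}"
  shows "((\<lambda>m. (-1) ^ m * coef m * poly (B m) x) has_sum f_L b w x) UNIV"
proof -
  obtain c \<rho> where \<rho>: "0 < \<rho>" "\<rho> < 1" and c: "0 \<le> c"
    and bound: "\<And>m. \<bar>\<theta> ^ m * poly (B m) x\<bar> \<le> c * \<rho> ^ m"
    using rates x by metis
  define f where "f = (\<lambda>(n, m). (-1) ^ m * recip n m * poly (B m) x)"
  have geo: "(\<lambda>m. \<rho> ^ m) summable_on UNIV"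
    using \<rho> by (intro geometric_summable_on) auto
  have le: "\<bar>f (n, m)\<bar> \<le> (1 + real b) * c * (1 / real n * \<rho> ^ m)" if "n \<in> A" for n m
  proof -
    have "\<bar>f (n, m)\<bar> = recip n m * \<bar>poly (B m) x\<bar>"
      using recip_nonneg [OF A_ge_1 [OF that]] by (simp add: f_def abs_mult power_abs)
    also have "\<dots> \<le> ((1 + real b) * \<theta> ^ m * (1 / real n)) * \<bar>poly (B m) x\<bar>"
      by (intro mult_right_mono recip_decay [OF that]) auto
    also have "\<dots> = (1 + real b) * (1 / real n) * \<bar>\<theta> ^ m * poly (B m) x\<bar>"
      by (simp add: abs_mult power_abs mult_ac)
    also have "\<dots> \<le> (1 + real b) * (1 / real n) * (c * \<rho> ^ m)"
      by (intro mult_left_mono bound) auto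
    finally show ?thesis
      by (simp only: mult_ac)
  qed
  have "((\<lambda>(n, m). 1 / real n * \<rho> ^ m) has_sum (\<Sum>\<^sub>\<infinity>n\<in>A. 1 / real n) * (\<Sum>\<^sub>\<infinity>m. \<rho> ^ m)) (A \<times> UNIV)"
    by (rule has_sum_product [OF has_sum_infsum [OF A_summable] has_sum_infsum [OF geo]]) (use \<rho> in auto)
  then have "(\<lambda>p. (1 + real b) * c * (case p of (n, m) \<Rightarrow> 1 / real n * \<rho> ^ m)) summable_on A \<times> UNIV"
    by (intro summable_on_cmult_right has_sum_imp_summable)
  then have "f summable_on A \<times> UNIV"
    by (rule abs_summable_on_dominated) (use le in auto)
  then obtain s where s: "(f has_sum s) (A \<times> UNIV)"
    by (auto simp: summable_on_def)
  have "((\<lambda>n. 1 / (real n + x)) has_sum s) A"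
  proof (rule has_sum_SigmaD [OF s])
    fix n assume n: "n \<in> A"
    have "(\<lambda>m. (1 + real b) * c * (1 / real n) * \<rho> ^ m) summable_on UNIV"
      by (rule summable_on_cmult_right [OF geo])
    then have "(\<lambda>m. recip n m * \<bar>poly (B m) x\<bar>) summable_on UNIV"
    proof (rule summable_on_comparison_test)
      fix m
      show "recip n m * \<bar>poly (B m) x\<bar> \<le> (1 + real b) * c * (1 / real n) * \<rho> ^ m"
        using le [OF n, of m] recip_nonneg [OF A_ge_1 [OF n]]
        by (simp add: f_def abs_mult power_abs mult.assoc)
    qed (use recip_nonneg [OF A_ge_1 [OF n]] in auto)
    then show "((\<lambda>m. f (n, m)) has_sum 1 / (real n + x)) UNIV"
      using recip_expansion [OF A_ge_1 [OF n] x] by (simp add: f_def)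
  qed
  then have "s = f_L b w x"
    using f_L_has_sum [of x] x has_sum_unique by fastforce
  have "((\<lambda>(m, n). f (n, m)) has_sum s) (UNIV \<times> A)"
    using s by (subst has_sum_swap) (simp add: case_prod_unfold)
  then have "((\<lambda>m. (-1) ^ m * coef m * poly (B m) x) has_sum s) UNIV"
  proof (rule has_sum_SigmaD)
    fix m
    show "((\<lambda>n. case (m, n) of (m, n) \<Rightarrow> f (n, m)) has_sum (-1) ^ m * coef m * poly (B m) x) A"
      using has_sum_cmult_left [OF has_sum_cmult_right [OF coef_has_sum]] by (simp add: f_def)
  qed
  then show ?thesis
    using \<open>s = f_L b w x\<close> by simp
qed

end

section \<open>Irwin sums\<close>

context return_words
begin

lemma level_weight_has_sum: "(wt has_sum real b ^ length w) (lang_R_level b w k)"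
proof (induction k)
  case 0
  then show ?case
    using lang_R_has_sum [OF b_gt w_ne w_words] by (simp add: lang_R_level_0)
next
  case (Suc k)
  have "((\<lambda>(g, r). wt g * wt r) has_sum 1 * real b ^ length w) (G \<times> lang_R_level b w k)"
    by (rule has_sum_product [OF wt_has_sum Suc]) auto
  then show ?case
    using has_sum_reindex_bij_betw [OF bij_betw_lang_R_level [OF w_ne], of wt b k]
    by (simp add: case_prod_unfold power_add)
qed

lemma level_words: "r \<in> lang_R_level b w k \<Longrightarrow> r \<in> words b"
  by (simp add: lang_R_level_def)

lemma level_summable: "(\<lambda>r. wt r * poly q (word_frac b r)) summable_on lang_R_level b w k"
proof -
  obtain M where M: "\<And>x. x \<in> {0..1} \<Longrightarrow> \<bar>poly q x\<bar> \<le> M"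
    using poly_bounded_unit_interval by blast
  have "(\<lambda>r. wt r * M) summable_on lang_R_level b w k"
    by (rule summable_on_cmult_left [OF has_sum_imp_summable [OF level_weight_has_sum]])
  then show ?thesis
  proof (rule abs_summable_on_dominated)
    fix r assume "r \<in> lang_R_level b w k"
    then have "\<bar>poly q (word_frac b r)\<bar> \<le> M"
      by (intro M word_frac_in level_words)
    then show "\<bar>wt r * poly q (word_frac b r)\<bar> \<le> wt r * M"
      using mult_left_mono [of _ M "wt r"] by (simp add: abs_mult)
  qed
qed

lemma coeff_R_has_sum:
  "((\<lambda>r. wt r * poly (B m) (word_frac b r)) has_sum coeff_R b w (Suc m)) (lang_R b w)"
proof -
  let ?R = "lang_R b w"
  define f where "f r = wt r * poly (B m) (word_frac b r)" for r
  have sum: "f summable_on ?R"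
    using level_summable [of "B m" 0] by (simp add: f_def [abs_def] lang_R_level_0)
  then have "(\<lambda>r. norm (f r)) summable_on ?R"
    using summable_on_iff_abs_summable_on_real by blast
  then have abs: "Infinite_Set_Sum.abs_summable_on f ?R"
    by (rule abs_summable_equivalent [THEN iffD1])
  have [measurable]: "(\<lambda>x. indicator {0..1} x *\<^sub>R poly (B m) x) \<in> borel_measurable borel"
    by measurable
  have "coeff_R b w (Suc m) = (LINT x|eta0 b w. indicator {0..1} x *\<^sub>R poly (B m) x)"
    by (simp add: coeff_R_def set_lebesgue_integral_def)
  also have "\<dots> = (LINT r|point_measure ?R (\<lambda>r. ennreal (wt r)).
      indicator {0..1} (word_frac b r) *\<^sub>R poly (B m) (word_frac b r))"
    unfolding eta0_def by (rule integral_distr) simp_all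
  also have "\<dots> = (LINT r|count_space ?R. wt r *\<^sub>R
      (indicator {0..1} (word_frac b r) *\<^sub>R poly (B m) (word_frac b r)))"
    unfolding point_measure_def by (rule integral_density) simp_all
  also have "\<dots> = infsetsum f ?R"
    unfolding infsetsum_def
  proof (rule Bochner_Integration.integral_cong)
    fix r assume "r \<in> space (count_space ?R)"
    then have "word_frac b r \<in> {0..1}"
      by (intro word_frac_in) (simp add: lang_R_def)
    then show "wt r *\<^sub>R (indicator {0..1} (word_frac b r) *\<^sub>R poly (B m) (word_frac b r)) = f r"
      by (simp add: f_def)
  qed simp
  also have "\<dots> = infsum f ?R"
    by (rule infsetsum_infsum [OF abs])
  finally have "coeff_R b w (Suc m) = infsum f ?R" .
  then show ?thesis
    using has_sum_infsum [OF sum] by (simp add: f_def [abs_def])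
qed

text \<open>Summing over the first return word of a word at level \<open>Suc k\<close> applies
  \<open>K\<close> to \<open>B m\<close> at the value of the rest, so each level contributes one
  factor \<open>lm (Suc m)\<close>.\<close>

lemma level_eigen_has_sum:
  "((\<lambda>r. wt r * poly (B m) (word_frac b r)) has_sum lm (Suc m) ^ k * coeff_R b w (Suc m))
    (lang_R_level b w k)"
proof (induction k)
  case 0
  then show ?case
    using coeff_R_has_sum by (simp add: lang_R_level_0)
next
  case (Suc k)
  let ?f = "\<lambda>r. wt r * poly (B m) (word_frac b r)"
  obtain s where s: "(?f has_sum s) (lang_R_level b w (Suc k))"
    using level_summable by (auto simp: summable_on_def)
  then have "((\<lambda>p. ?f (case p of (g, r) \<Rightarrow> g @ r)) has_sum s) (G \<times> lang_R_level b w k)"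
    by (subst has_sum_reindex_bij_betw [OF bij_betw_lang_R_level [OF w_ne]])
  then have "((\<lambda>(r, g). ?f (g @ r)) has_sum s) (lang_R_level b w k \<times> G)"
    by (subst (asm) has_sum_swap) (simp add: case_prod_unfold)
  then have "((\<lambda>r. lm (Suc m) * ?f r) has_sum s) (lang_R_level b w k)"
  proof (rule has_sum_SigmaD)
    fix r
    have "((\<lambda>g. wt r * (wt g * poly (B m) (phi g (word_frac b r)))) has_sum
        wt r * poly (K (B m)) (word_frac b r)) G"
      by (rule has_sum_cmult_right [OF poly_K_has_sum])
    then show "((\<lambda>g. case (r, g) of (r, g) \<Rightarrow> ?f (g @ r)) has_sum lm (Suc m) * ?f r) G"
      by (simp add: eigenpoly_props word_frac_append' power_add mult_ac)
  qed
  moreover have "((\<lambda>r. lm (Suc m) * ?f r) has_sum lm (Suc m) * (lm (Suc m) ^ k * coeff_R b w (Suc m))) (lang_R_level b w k)"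
    by (rule has_sum_cmult_right [OF Suc])
  ultimately have "s = lm (Suc m) ^ Suc k * coeff_R b w (Suc m)"
    using has_sum_unique by fastforce
  with s show ?case
    by simp
qed

lemma bij_irwin:
  "bij_betw (\<lambda>(n, r). n * b ^ length r + word_int b r) (A \<times> lang_R_level b w k) (irwin_set b w (Suc k))"
proof -
  have "bij_betw (\<lambda>(g, r). (word_int b g, r)) (lang_L_pos b w \<times> lang_R_level b w k) (A \<times> lang_R_level b w k)"
    using bij_betw_map_prod [OF bij_A bij_betw_id] by (simp add: map_prod_def id_def)
  moreover have "bij_betw ((\<lambda>(n, r). n * b ^ length r + word_int b r) \<circ> (\<lambda>(g, r). (word_int b g, r)))
      (lang_L_pos b w \<times> lang_R_level b w k) (irwin_set b w (Suc k))"
    using bij_betw_irwin_set [OF b_gt w_ne, of k] by (simp add: o_def case_prod_unfold word_int_append)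
  ultimately show ?thesis
    using bij_betw_comp_iff by blast
qed

text \<open>A number composed of n and the digits r equals b^|r| (n + x(r)); summing its reciprocal
  over n gives \<open>wt r\<close> times \<open>f_L\<close> at x(r). The terms are dominated by 1/n
  times \<open>wt r\<close>.\<close>

lemma irwin_has_sum:
  obtains s where "((\<lambda>n. 1 / real n) has_sum s) (irwin_set b w (Suc k))"
    "((\<lambda>r. wt r * f_L b w (word_frac b r)) has_sum s) (lang_R_level b w k)"
proof -
  let ?R = "lang_R_level b w k"
  define f where "f = (\<lambda>(n, r). wt r * (1 / (real n + word_frac b r)))"
  have eq: "1 / real (case p of (n, r) \<Rightarrow> n * b ^ length r + word_int b r) = f p" for p
    using b_gt by (cases p) (simp add: f_def word_frac_def field_simps)
  have "((\<lambda>(n, r). 1 / real n * wt r) has_sum (\<Sum>\<^sub>\<infinity>n\<in>A. 1 / real n) * real b ^ length w) (A \<times> ?R)"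
    by (rule has_sum_product [OF has_sum_infsum [OF A_summable] level_weight_has_sum]) auto
  then have "f summable_on A \<times> ?R"
  proof (rule abs_summable_on_dominated [OF has_sum_imp_summable])
    fix p assume "p \<in> A \<times> ?R"
    then obtain n r where p: "p = (n, r)" "n \<in> A"
      by auto
    have n: "real n > 0"
      using A_ge_1 [OF p(2)] by simp
    then have "wt r * (1 / (real n + word_frac b r)) \<le> wt r * (1 / real n)"
      using word_frac_nonneg [of b r] by (intro mult_left_mono frac_le) auto
    then show "\<bar>f p\<bar> \<le> (case p of (n, r) \<Rightarrow> 1 / real n * wt r)"
      using n word_frac_nonneg [of b r] by (simp add: f_def p(1) abs_of_nonneg mult_ac)
  qed
  then obtain s where s: "(f has_sum s) (A \<times> ?R)"
    by (auto simp: summable_on_def)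
  have 1: "((\<lambda>n. 1 / real n) has_sum s) (irwin_set b w (Suc k))"
    using s has_sum_reindex_bij_betw [OF bij_irwin [of k], of "\<lambda>n. 1 / real n" s] by (simp only: eq)
  have "((\<lambda>(r, n). f (n, r)) has_sum s) (?R \<times> A)"
    using s by (subst (asm) has_sum_swap) (simp add: case_prod_unfold)
  then have "((\<lambda>r. wt r * f_L b w (word_frac b r)) has_sum s) ?R"
  proof (rule has_sum_SigmaD)
    fix r
    have "((\<lambda>n. 1 / (real n + word_frac b r)) has_sum f_L b w (word_frac b r)) A"
      using word_frac_nonneg [of b r] by (intro f_L_has_sum) linarith
    then show "((\<lambda>n. case (r, n) of (r, n) \<Rightarrow> f (n, r)) has_sum wt r * f_L b w (word_frac b r)) A"
      unfolding f_def by (simp only: prod.case has_sum_cmult_right)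
  qed
  with 1 show thesis
    by (rule that)
qed

text \<open>The bound by \<rho>^m is uniform on [0,1], so the sum over r needs nothing but the
  finite mass of the level; this gives absolute summability and the exchange of the two
  sums.\<close>

lemma main_expansion:
  assumes "((\<lambda>r. wt r * f_L b w (word_frac b r)) has_sum s) (lang_R_level b w k)"
  shows "((\<lambda>m. (-1) ^ m * coef m * lm (Suc m) ^ k * coeff_R b w (Suc m)) has_sum s) UNIV"
proof -
  let ?R = "lang_R_level b w k"
  define C where "C = (1 + real b) * (\<Sum>\<^sub>\<infinity>n\<in>A. 1 / real n)"
  obtain c \<rho> where \<rho>: "0 < \<rho>" "\<rho> < 1" and c: "0 \<le> c"
    and bound: "\<And>m x. x \<in> {0..1} \<Longrightarrow> \<bar>\<theta> ^ m * poly (B m) x\<bar> \<le> c * \<rho> ^ m"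
    using rates by metis
  have C: "C \<ge> 0"
    by (auto simp: C_def intro!: mult_nonneg_nonneg infsum_nonneg)
  define f where "f = (\<lambda>(r, m). wt r * ((-1) ^ m * coef m * poly (B m) (word_frac b r)))"
  have geo: "(\<lambda>m. \<rho> ^ m) summable_on UNIV"
    using \<rho> by (intro geometric_summable_on) auto
  have "((\<lambda>(r, m). wt r * \<rho> ^ m) has_sum real b ^ length w * (\<Sum>\<^sub>\<infinity>m. \<rho> ^ m)) (?R \<times> UNIV)"
    by (rule has_sum_product [OF level_weight_has_sum has_sum_infsum [OF geo]]) (use \<rho> in auto)
  then have "(\<lambda>p. C * c * (case p of (r, m) \<Rightarrow> wt r * \<rho> ^ m)) summable_on ?R \<times> UNIV"
    by (intro summable_on_cmult_right has_sum_imp_summable)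
  then have "f summable_on ?R \<times> UNIV"
  proof (rule abs_summable_on_dominated)
    fix p assume "p \<in> ?R \<times> (UNIV :: nat set)"
    then obtain r m where p: "p = (r, m)" "r \<in> ?R"
      by auto
    let ?x = "word_frac b r"
    have x: "?x \<in> {0..1}"
      using p(2) by (intro word_frac_in level_words)
    have "\<bar>f p\<bar> = wt r * (coef m * \<bar>poly (B m) ?x\<bar>)"
      using coef_nonneg [of m] by (simp add: f_def p(1) abs_mult power_abs)
    also have "\<dots> \<le> wt r * (C * \<theta> ^ m * \<bar>poly (B m) ?x\<bar>)"
      using coef_le [of m] by (intro mult_left_mono mult_right_mono) (auto simp: C_def)
    also have "\<dots> = wt r * (C * \<bar>\<theta> ^ m * poly (B m) ?x\<bar>)"
      by (simp add: abs_mult power_abs)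
    also have "\<dots> \<le> wt r * (C * (c * \<rho> ^ m))"
      using C by (intro mult_left_mono bound [OF x]) auto
    finally show "\<bar>f p\<bar> \<le> C * c * (case p of (r, m) \<Rightarrow> wt r * \<rho> ^ m)"
      by (simp only: p(1) prod.case mult_ac)
  qed
  then obtain s' where s': "(f has_sum s') (?R \<times> UNIV)"
    by (auto simp: summable_on_def)
  then have "((\<lambda>r. wt r * f_L b w (word_frac b r)) has_sum s') ?R"
  proof (rule has_sum_SigmaD)
    fix r assume "r \<in> ?R"
    then have "word_frac b r \<in> {0..1}"
      by (intro word_frac_in level_words)
    then show "((\<lambda>m. f (r, m)) has_sum wt r * f_L b w (word_frac b r)) UNIV"
      unfolding f_def prod.case by (intro has_sum_cmult_right f_L_expansion)
  qed
  then have "s' = s"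
    using assms has_sum_unique by blast
  have "((\<lambda>(m, r). f (r, m)) has_sum s') (UNIV \<times> ?R)"
    using s' by (subst (asm) has_sum_swap) (simp add: case_prod_unfold)
  then have "((\<lambda>m. (-1) ^ m * coef m * lm (Suc m) ^ k * coeff_R b w (Suc m)) has_sum s') UNIV"
  proof (rule has_sum_SigmaD)
    fix m
    have "((\<lambda>r. (-1) ^ m * coef m * (wt r * poly (B m) (word_frac b r))) has_sum
        (-1) ^ m * coef m * (lm (Suc m) ^ k * coeff_R b w (Suc m))) ?R"
      by (rule has_sum_cmult_right [OF level_eigen_has_sum])
    then show "((\<lambda>r. case (m, r) of (m, r) \<Rightarrow> f (r, m)) has_sum
        (-1) ^ m * coef m * lm (Suc m) ^ k * coeff_R b w (Suc m)) ?R"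
      by (simp add: f_def mult_ac)
  qed
  then show ?thesis
    unfolding \<open>s' = s\<close> .
qed

section \<open>Termwise differentiation of \<open>f_L\<close>\<close>

definition pole :: "nat \<Rightarrow> nat \<Rightarrow> real \<Rightarrow> real"
  where "pole m n z = (if n \<in> A then (-1) ^ m * fact m / (real n + z) ^ Suc m else 0)"

lemma pole_majorant_summable: "summable (\<lambda>n. if n \<in> A then c * (1 / real n) else 0 :: real)"
proof -
  have "(\<lambda>n. c * (1 / real n)) summable_on A"
    by (rule summable_on_cmult_right [OF A_summable])
  then have "(\<lambda>n. if n \<in> A then c * (1 / real n) else 0) summable_on UNIV"
    by (rule summable_on_cong_neutral [THEN iffD1, rotated -1]) auto
  then show ?thesis
    by (rule summable_on_imp_summable)
qed

lemma pole_le: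
  assumes "z > -1/2"
  shows "norm (pole m n z) \<le> (if n \<in> A then (fact m * 2 ^ Suc m) * (1 / real n) else 0)"
proof (cases "n \<in> A")
  case True
  then have n: "real n \<ge> 1"
    using A_ge_1 by simp
  have "(real n / 2) ^ Suc m \<le> (real n + z) ^ Suc m"
    using n assms by (intro power_mono) auto
  then have "1 / (real n + z) ^ Suc m \<le> 1 / (real n / 2) ^ Suc m"
    using n by (intro frac_le) auto
  also have "\<dots> = 2 ^ Suc m * (1 / real n ^ Suc m)"
    by (simp only: power_divide) simp
  also have "\<dots> \<le> 2 ^ Suc m * (1 / real n)"
    using n power_increasing [of 1 "Suc m" "real n"] by (intro mult_left_mono frac_le) auto
  finally have "fact m * (1 / (real n + z) ^ Suc m) \<le> fact m * (2 ^ Suc m * (1 / real n))"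
    by (intro mult_left_mono) auto
  moreover have "norm (pole m n z) = fact m * (1 / (real n + z) ^ Suc m)"
    using True n assms by (simp add: pole_def abs_mult power_abs)
  ultimately show ?thesis
    using True by (simp only: if_True mult.assoc)
qed (simp add: pole_def)

lemma pole_derivative:
  assumes "z > -1/2"
  shows "(pole m n has_field_derivative pole (Suc m) n z) (at z)"
proof (cases "n \<in> A")
  case True
  then have y: "real n + z > 0"
    using A_ge_1 [OF True] assms by simp
  have "((\<lambda>z. (real n + z) ^ Suc m) has_field_derivative real (Suc m) * (real n + z) ^ m) (at z)"
  proof -
    have "((\<lambda>z. real n + z) has_field_derivative 1) (at z)"
      by (auto intro!: derivative_eq_intros)
    from DERIV_power [OF this, of "Suc m"] show ?thesis
      by simp
  qed
  then have "((\<lambda>z. ((-1) ^ m * fact m) / (real n + z) ^ Suc m) has_field_derivative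
      (0 * (real n + z) ^ Suc m - ((-1) ^ m * fact m) * (real (Suc m) * (real n + z) ^ m))
        / ((real n + z) ^ Suc m * (real n + z) ^ Suc m)) (at z)"
    using y by (intro DERIV_divide DERIV_const) auto
  moreover have "(0 * (real n + z) ^ Suc m - ((-1) ^ m * fact m) * (real (Suc m) * (real n + z) ^ m))
        / ((real n + z) ^ Suc m * (real n + z) ^ Suc m) = pole (Suc m) n z"
    using y True by (simp add: pole_def)
  moreover have "pole m n = (\<lambda>z. ((-1) ^ m * fact m) / (real n + z) ^ Suc m)"
    using True by (simp add: pole_def [abs_def])
  ultimately show ?thesis
    by simp
next
  case False
  then show ?thesis
    by (simp add: pole_def [abs_def])
qed

lemma pole_summable: "z > -1/2 \<Longrightarrow> summable (\<lambda>n. pole m n z)"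
  by (rule summable_comparison_test' [OF pole_majorant_summable]) (rule pole_le)

text \<open>The pole terms vanish outside \<open>A\<close>, which permits a series over all
  naturals. To the right of -1/2 the derivatives of each order have a summable majorant that does
  not depend on the point, so each induction step may differentiate termwise.\<close>

lemma higher_deriv_f_L:
  assumes "z > -1/2"
  shows "(deriv ^^ m) (f_L b w) z = (\<Sum>n. pole m n z)"
  using assms
proof (induction m arbitrary: z)
  case 0
  have "((\<lambda>n. pole 0 n z) has_sum f_L b w z) UNIV"
    using f_L_has_sum [OF 0] by (rule has_sum_cong_neutral [THEN iffD1, rotated -1]) (auto simp: pole_def)
  then show ?case
    using has_sum_imp_sums sums_unique by fastforce
next
  case (Suc m)
  let ?S = "{-1/2 <..} :: real set"
  \<comment> \<open>The derivative at z depends on a whole neighbourhood, on which the induction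
    hypothesis is needed.\<close>
  have "\<forall>\<^sub>F y in nhds z. y \<in> ?S"
    using Suc.prems by (intro eventually_nhds_in_open) auto
  then have "\<forall>\<^sub>F y in nhds z. (deriv ^^ m) (f_L b w) y = (\<Sum>n. pole m n y)"
    by eventually_elim (use Suc.IH in auto)
  then have "(deriv ^^ Suc m) (f_L b w) z = deriv (\<lambda>y. \<Sum>n. pole m n y) z"
    by (simp add: deriv_cong_ev)
  also have "\<dots> = (\<Sum>n. pole (Suc m) n z)"
  proof (rule DERIV_imp_deriv, rule has_field_derivative_series'(2) [of ?S])
    show "uniformly_convergent_on ?S (\<lambda>n x. \<Sum>i<n. pole (Suc m) i x)"
      by (rule Weierstrass_m_test' [OF pole_le pole_majorant_summable]) simp
    show "summable (\<lambda>n. pole m n z)"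
      by (rule pole_summable [OF Suc.prems])
    show "z \<in> interior ?S"
      using Suc.prems by (simp add: interior_open)
  qed (use Suc.prems pole_derivative in \<open>auto intro: has_field_derivative_at_within\<close>)
  finally show ?case .
qed

text \<open>Termwise integration of the pole series: m! cancels and the sign of the m-th derivative
  remains.\<close>

lemma coeff_L_eq: "coeff_L b w (Suc m) = (-1) ^ m * coef m"
proof -
  let ?M = "nu b w (Suc m)"
  have sets: "sets ?M = sets borel"
    by (rule sets_nu) simp
  interpret prob_space ?M
    by (rule prob_space_nu) simp
  have meas [measurable]: "pole m n \<in> borel_measurable borel" for n
    unfolding pole_def [abs_def] by measurable
  have bound: "norm (pole m n x) \<le> (if n \<in> A then (fact m * 2 ^ Suc m) * (1 / real n) else 0)"
    if "x \<in> {0..1}" for n x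
    using that by (intro pole_le) auto
  have int: "integrable ?M (pole m n)" for n
    by (rule nu_integrable) (use bound in auto)
  have val: "(LINT x|?M. pole m n x) = (if n \<in> A then (-1) ^ m * fact m * recip n m else 0)" for n
  proof (cases "n \<in> A")
    case True
    then have "(LINT x|?M. pole m n x) = (LINT x|?M. ((-1) ^ m * fact m) * (1 / (real n + x) ^ Suc m))"
      by (simp add: pole_def)
    also have "\<dots> = ((-1) ^ m * fact m) * recip n m"
      unfolding recip_def by (rule integral_mult_right_zero)
    finally show ?thesis
      using True by simp
  qed (simp add: pole_def)
  have sums: "(\<lambda>n. LINT x|?M. pole m n x) sums (LINT x|?M. (\<Sum>n. pole m n x))"
  proof (rule sums_integral [OF int])
    show "AE x in ?M. summable (\<lambda>n. norm (pole m n x))"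
    proof (rule AE_nuI)
      fix x :: real assume x: "x \<in> {0..1}"
      show "summable (\<lambda>n. norm (pole m n x))"
      proof (rule summable_comparison_test' [OF pole_majorant_summable])
        fix n
        show "norm (norm (pole m n x)) \<le> (if n \<in> A then (fact m * 2 ^ Suc m) * (1 / real n) else 0)"
          using bound [OF x, of n] by (simp only: real_norm_def abs_abs)
      qed
    qed simp
    have "norm (LINT x|?M. norm (pole m n x)) \<le> (if n \<in> A then (fact m * 2 ^ Suc m) * (1 / real n) else 0)" for n
    proof -
      have "(LINT x|?M. norm (pole m n x)) \<le> (if n \<in> A then (fact m * 2 ^ Suc m) * (1 / real n) else 0)"
        by (rule integral_le_const [OF integrable_norm [OF int]], rule AE_nuI)
          (simp, rule bound)
      moreover have "(LINT x|?M. norm (pole m n x)) \<ge> 0"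
        by (rule integral_nonneg_AE) simp
      ultimately show ?thesis
        by simp
    qed
    then show "summable (\<lambda>n. LINT x|?M. norm (pole m n x))"
      by (intro summable_comparison_test' [OF pole_majorant_summable])
  qed
  have "((\<lambda>n. (-1) ^ m * fact m * recip n m) has_sum (-1) ^ m * fact m * coef m) A"
    by (rule has_sum_cmult_right [OF coef_has_sum])
  then have "((\<lambda>n. LINT x|?M. pole m n x) has_sum (-1) ^ m * fact m * coef m) UNIV"
    by (rule has_sum_cong_neutral [THEN iffD1, rotated -1]) (auto simp: val)
  then have total: "(LINT x|?M. (\<Sum>n. pole m n x)) = (-1) ^ m * fact m * coef m"
    using sums has_sum_imp_sums sums_unique2 by blast
  have "(LINT x:{0..1}|?M. (deriv ^^ m) (f_L b w) x) = (LINT x:{0..1}|?M. (\<Sum>n. pole m n x))"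
    by (rule set_lebesgue_integral_cong) (auto simp: sets higher_deriv_f_L)
  also have "\<dots> = (LINT x|?M. (\<Sum>n. pole m n x))"
    unfolding set_lebesgue_integral_def
  proof (rule integral_cong_AE)
    have [measurable]: "(\<lambda>x. \<Sum>n. pole m n x) \<in> borel_measurable borel"
      by measurable
    show "(\<lambda>x. \<Sum>n. pole m n x) \<in> borel_measurable ?M"
      using measurable_cong_sets [OF sets refl] by measurable
    show "(\<lambda>x. indicator {0..1} x *\<^sub>R (\<Sum>n. pole m n x)) \<in> borel_measurable ?M"
      using measurable_cong_sets [OF sets refl] by measurable
    show "AE x in ?M. indicator {0..1} x *\<^sub>R (\<Sum>n. pole m n x) = (\<Sum>n. pole m n x)"
      by (rule AE_nuI) auto
  qed
  finally show ?thesis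
    unfolding coeff_L_def total [symmetric] by (simp add: total)
qed

lemma irwin_term_eq:
  "irwin_term b w (Suc k) (Suc m) = (-1) ^ m * coef m * lm (Suc m) ^ k * coeff_R b w (Suc m)"
  by (simp add: irwin_term_def coeff_L_eq)

text \<open>The measure for \<open>\<lambda>\<^sub>1\<close> is uniform: like \<open>nu b w 1\<close>, Lebesgue measure is invariant under
  the return operator, and hence annihilates all eigenpolynomials of positive degree.\<close>

lemma integral_poly_functional: "poly_functional (\<lambda>q. integral {0..1} (poly q))"
proof -
  have int: "poly q integrable_on {0..1}" for q :: "real poly"
    by (intro integrable_continuous_real continuous_intros)
  have "integral {0..1} (\<lambda>x. poly p x + poly q x) = integral {0..1} (poly p) + integral {0..1} (poly q)" for p q :: "real poly"
    by (rule Henstock_Kurzweil_Integration.integral_add [OF int int])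
  moreover have "poly (p + q) = (\<lambda>x. poly p x + poly q x)" "poly (smult c q) = (\<lambda>x. c * poly q x)"
    for p q :: "real poly" and c
    by auto
  ultimately show ?thesis
    by (simp add: poly_functional_def)
qed

text \<open>By substitution \<open>h u\<close> is the integral of q over the image of [0,1] under
  \<open>phi u\<close>. The next digit cuts this interval into b parts, so \<open>h\<close> is
  additive, and its sum over the return words is the integral over [0,1].\<close>

lemma integral_K: "integral {0..1} (poly (K q)) = integral {0..1} (poly q)"
proof -
  obtain H where H: "pderiv H = q"
    using poly_antiderivative by blast
  obtain M where M: "\<And>x. x \<in> {0..1} \<Longrightarrow> \<bar>poly q x\<bar> \<le> M"
    using poly_bounded_unit_interval by blast
  define h where "h u = poly H (phi u 1) - poly H (phi u 0)" for u
  have branch: "wt u * integral {0..1} (poly (branch u q)) = h u" for u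
  proof -
    have "pderiv [:word_frac b u, wt u:] = [:wt u:]"
      by (simp add: pderiv_pCons)
    then have "pderiv (smult (1 / wt u) (branch u H)) = branch u q"
      using b_gt by (simp add: pderiv_smult pderiv_pcompose H)
    from integral_poly_unit_interval [OF this] show ?thesis
      using b_gt by (simp add: h_def poly_branch right_diff_distrib)
  qed
  have "(h has_sum h []) G"
  proof (rule G_has_sum)
    fix u
    have "phi (u @ [d]) 0 = phi u (real d / real b)" "phi (u @ [d]) 1 = phi u (real (Suc d) / real b)" for d
      using word_int_snoc [of b "[]" d] unfolding phi_append
      by (simp_all add: phi_def [of "[d]"] word_frac_def add_divide_distrib add.commute)
    then have "(\<Sum>d<b. h (u @ [d])) = (\<Sum>d<b. poly H (phi u (real (Suc d) / real b)) - poly H (phi u (real d / real b)))"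
      by (simp add: h_def)
    also have "\<dots> = h u"
      using b_gt by (subst sum_lessThan_telescope) (simp add: h_def)
    finally show "h u = (\<Sum>d<b. h (u @ [d]))" ..
  next
    fix u assume u: "u \<in> words b"
    have "norm (integral {0..1} (poly (branch u q))) \<le> M * (1 - 0)"
    proof (rule integral_bound)
      show "norm (poly (branch u q) x) \<le> M" if "x \<in> {0..1}" for x
        using M [OF phi_in [OF u that]] by (simp add: poly_branch)
    qed (auto intro: continuous_intros)
    then show "\<bar>h u\<bar> \<le> M / real b ^ length u"
      unfolding branch [symmetric] by (simp add: abs_mult divide_right_mono)
  qed
  moreover have "(h has_sum integral {0..1} (poly (K q))) G"
    using K_functional [OF integral_poly_functional, of q] by (simp only: branch)
  moreover have "h [] = integral {0..1} (poly q)"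
    using branch [of "[]"] by (simp add: word_frac_def)
  ultimately show ?thesis
    using has_sum_unique by metis
qed

lemma B_0: "B 0 = 1"
  using eigenpoly_props(1,2) [of 0] by (metis degree_eq_zeroE lead_coeff_pCons(2) one_pCons)

lemma integral_B: "integral {0..1} (poly (B m)) = (if m = 0 then 1 else 0)"
proof (cases "m = 0")
  case True
  have "poly (1 :: real poly) = (\<lambda>x. 1)"
    by (rule ext) simp
  then show ?thesis
    using True by (simp add: B_0)
next
  case False
  have "integral {0..1} (poly (B m)) = lm (Suc m) * integral {0..1} (poly (B m))"
    using integral_K [of "B m"] integral_poly_functional by (simp add: eigenpoly_props poly_functional_def)
  moreover have "lm (Suc m) < 1"
    using lam_less [of 1 "Suc m"] False lam_1 by simp
  ultimately show ?thesis
    using False by simp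
qed

text \<open>Both functionals are 1 at \<open>B 0\<close> and 0 at the other eigenpolynomials. This
  determines the integrals of polynomials against \<open>nu b w 1\<close> without computing that
  measure.\<close>

lemma dual_0: "dual 0 q = integral {0..1} (poly q)"
proof -
  have "integral {0..1} (poly q) = (\<Sum>m\<le>degree q. integral {0..1} (poly (smult (dual m q) (B m))))"
    by (subst expand_B [OF order_refl]) (rule poly_functional_sum [OF integral_poly_functional])
  also have "\<dots> = (\<Sum>m\<le>degree q. if m = 0 then dual m q else 0)"
    using integral_poly_functional by (intro sum.cong refl) (simp add: poly_functional_def integral_B)
  finally show ?thesis
    by simp
qed

lemma mom_0: "mom 0 k = 1 / real (Suc k)"
proof -
  have "pderiv (smult (- 1 / real (Suc k)) (refl_pow (Suc k))) = refl_pow k"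
    by (simp add: pderiv_minus pderiv_smult pderiv_power pderiv_pCons del: power_Suc of_nat_Suc)
  then have "integral {0..1} (poly (refl_pow k)) = 1 / real (Suc k)"
    by (subst integral_poly_unit_interval) auto
  then show ?thesis
    using dual_0 [of "refl_pow k"] dual_refl_pow [of 0 k] by simp
qed

text \<open>With the uniform moments 1/(k + 1) the series of \<open>recip\<close> becomes the
  logarithmic series at x = n/(n + 1), where x - 1 = -1/(n + 1).\<close>

lemma recip_0:
  assumes "n \<ge> 1"
  shows "recip n 0 = ln ((real n + 1) / real n)"
proof -
  define x where "x = real n / (real n + 1)"
  have x: "0 < x" "x < 1" "x - 1 = - (1 / (real n + 1))"
    using assms by (auto simp: x_def field_simps)
  have "(\<lambda>k. mom 0 k / (real n + 1) ^ Suc k) sums recip n 0"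
    using has_sum_imp_sums [OF recip_has_sum [OF assms, of 0]] by simp
  then have "(\<lambda>k. - (mom 0 k / (real n + 1) ^ Suc k)) sums (- recip n 0)"
    by (rule sums_minus)
  moreover have "- (mom 0 k / (real n + 1) ^ Suc k) = (-1) ^ k * (1 / real (k + 1)) * (x - 1) ^ Suc k" for k
  proof -
    have "(x - 1) ^ Suc k = (-1) ^ Suc k * (1 / (real n + 1)) ^ Suc k"
      unfolding x(3) by (rule power_minus)
    then have "(-1) ^ k * (1 / real (k + 1)) * (x - 1) ^ Suc k
        = ((-1) ^ k * (-1) ^ Suc k) * (1 / real (k + 1) * (1 / (real n + 1)) ^ Suc k)"
      by (simp only: mult_ac)
    also have "(-1) ^ k * (-1) ^ Suc k = (-1 :: real)"
      by (simp flip: power_mult_distrib)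
    finally show ?thesis
      by (simp add: mom_0 power_one_over)
  qed
  ultimately have "(\<lambda>k. (-1) ^ k * (1 / real (k + 1)) * (x - 1) ^ Suc k) sums (- recip n 0)"
    by simp
  then have "ln x = - recip n 0"
    using ln_series [of x] x sums_unique by fastforce
  then show ?thesis
    using assms by (simp add: x_def ln_div)
qed

text \<open>Since \<open>B 0 = 1\<close>, the right coefficient is the total weight of
  \<open>lang_R\<close>, and the left one is the logarithmic mass of \<open>A\<close>.\<close>

lemma first_term: "irwin_term b w (Suc k) 1 = real b ^ length w * ln (real b)"
proof -
  have "((\<lambda>n. ln ((real n + 1) / real n)) has_sum coef 0) A"
    using coef_has_sum [of 0] A_ge_1 recip_0 by (simp cong: has_sum_cong)
  then have "coef 0 = ln (real b)"
    using A_log_has_sum has_sum_unique by blast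
  moreover have "coeff_R b w 1 = real b ^ length w"
    using coeff_R_has_sum [of 0] lang_R_has_sum [OF b_gt w_ne w_words] has_sum_unique by (fastforce simp: B_0)
  ultimately show ?thesis
    using irwin_term_eq [of k 0] lam_1 by simp
qed

lemma irwin_expansion:
  "(\<lambda>n. 1 / real n) summable_on irwin_set b w (Suc k)"
  "summable (\<lambda>m. \<bar>irwin_term b w (Suc k) (Suc m)\<bar>)"
  "irwin_sum b w (Suc k) = (\<Sum>m. irwin_term b w (Suc k) (Suc m))"
proof -
  obtain s where s: "((\<lambda>n. 1 / real n) has_sum s) (irwin_set b w (Suc k))"
    "((\<lambda>r. wt r * f_L b w (word_frac b r)) has_sum s) (lang_R_level b w k)"
    by (rule irwin_has_sum)
  show "(\<lambda>n. 1 / real n) summable_on irwin_set b w (Suc k)"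
    using s(1) by (rule has_sum_imp_summable)
  have sum: "((\<lambda>m. irwin_term b w (Suc k) (Suc m)) has_sum s) UNIV"
    using main_expansion [OF s(2)] by (simp only: irwin_term_eq)
  have "(\<lambda>m. norm (irwin_term b w (Suc k) (Suc m))) summable_on UNIV"
    by (rule summable_on_iff_abs_summable_on_real [THEN iffD1, OF has_sum_imp_summable [OF sum]])
  then show "summable (\<lambda>m. \<bar>irwin_term b w (Suc k) (Suc m)\<bar>)"
    unfolding real_norm_def by (rule summable_on_imp_summable)
  show "irwin_sum b w (Suc k) = (\<Sum>m. irwin_term b w (Suc k) (Suc m))"
    unfolding irwin_sum_def infsumI [OF s(1)] by (rule sums_unique [OF has_sum_imp_sums [OF sum]])
qed

end

theorem theorem3:
  fixes b :: nat and w :: "nat list"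
  assumes "b > 1" and "w \<noteq> []" and "w \<in> words b"
  shows
    "(\<forall>k\<ge>1.
        (\<lambda>n. 1 / real n) summable_on irwin_set b w k \<and>
        summable (\<lambda>j. \<bar>irwin_term b w k (Suc j)\<bar>) \<and>
        irwin_sum b w k = (\<Sum>j. irwin_term b w k (Suc j)) \<and>
        irwin_term b w k 1 = real b ^ length w * ln (real b)) \<and>
     lam b w 1 = 1 \<and>
     (\<forall>j\<ge>1. lam b w (Suc j) < lam b w j) \<and>
     (\<lambda>j. lam b w j) \<longlonglongrightarrow> 0 \<and>
     (\<forall>j\<ge>1. lam b w j = gf_G b w (1 / real b ^ j) \<and>
        (\<lambda>n. real (card {g \<in> lang_G b w. length g = n}) * (1 / real b ^ j) ^ n)
          sums gf_G b w (1 / real b ^ j))"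
proof -
  interpret return_words b w
    using assms by unfold_locales
  have "(\<lambda>n. 1 / real n) summable_on irwin_set b w k \<and>
      summable (\<lambda>j. \<bar>irwin_term b w k (Suc j)\<bar>) \<and>
      irwin_sum b w k = (\<Sum>j. irwin_term b w k (Suc j)) \<and>
      irwin_term b w k 1 = real b ^ length w * ln (real b)" if "k \<ge> 1" for k
  proof -
    define i where "i = k - 1"
    then have "k = Suc i"
      using that by simp
    then show ?thesis
      using irwin_expansion [of i] first_term [of i] by simp
  qed
  then show ?thesis
    using lam_1 lam_Suc_less lam_tendsto_0 lam_eq_gf gf_sums by blast
qed

end
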